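(* Let $q\ge0$ be an integer, let $G=\langle g_1,\dots,g_n\mid r_1,\dots,r_l\rangle$ be a polycyclic group given by a consistent polycyclic presentation with index set $I$, and let $\langle w_1,\dots,w_r\mid u_1,\dots,u_s\rangle$ be a consistent polycyclic presentation of $G\wedge^qG$. Let $\tau^q(G)$ be the group defined by the generators $g_1,\dots,g_n,g_1^\varphi,\dots,g_n^\varphi,w_1,\dots,w_r$ and the relations (T1)–(T5) given in the context, and let $W=\langle w_1,\dots,w_r\rangle\le\tau^q(G)$. Then: (i) $W$ is a normal subgroup of $\tau^q(G)$ and $\tau^q(G)/W\cong G\times G$; (ii) the presentation of $\tau^q(G)$ given by (T1)–(T5) is a consistent polycyclic presentation; (iii) $W\cong G\wedge^qG$; (iv) the map $\psi:\nu^q(G)\to\tau^q(G)$ defined by $(g_i)\psi=g_i$, $(g_i^\varphi)\psi=g_i^\varphi$ and $(\widehat k)\psi=(1,1,k)\lambda$ for all $1\le i\le n$ and all $k\in G$ extends to a well defined homomorphism (also denoted $\psi$) such that $\operatorname{Ker}\psi=\Delta^q(G)$.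
   Context: Conventions: $y^x=x^{-1}yx$, $[x,y]=x^{-1}y^{-1}xy$; maps are written on the right. Polycyclic presentations. A polycyclic presentation on an ordered list $g_1,\dots,g_n$ with index set $I\subseteq\{1,\dots,n\}$ has relations of the form $g_i^{e_i}=g_{i+1}^{\alpha_{i,i+1}}\cdots g_n^{\alpha_{i,n}}$ for $i\in I$; $g_j^{-1}g_ig_j=g_{j+1}^{\beta_{i,j,j+1}}\cdots g_n^{\beta_{i,j,n}}$ for $j<i$; $g_jg_ig_j^{-1}=g_{j+1}^{\gamma_{i,j,j+1}}\cdots g_n^{\gamma_{i,j,n}}$ for $j<i$, $j\notin I$, with $e_i\in\mathbb N$ and other exponents integers. It is consistent if every element of the group is uniquely of the form $g_1^{a_1}\cdots g_n^{a_n}$ with $a_i\in\mathbb Z$ and $0\le a_i<e_i$ for $i\in I$. The $q$-exterior square. For $q\ge1$, $G\otimes^qG$ is the group generated by symbols $g\otimes h$ and $\widehat k$ ($g,h,k\in G$) subject to, for all $g,g_1,h,h_1,k,k_1\in G$: (1) $g\otimes hh_1=(g\otimes h_1)(g^{h_1}\otimes h^{h_1})$; (2) $gg_1\otimes h=(g^{g_1}\otimes h^{g_1})(g_1\otimes h)$; (3) $(g\otimes h)^{\widehat k}=g^{k^q}\otimes h^{k^q}$; (4) $\widehat{kk_1}=\widehat k\prod_{i=1}^{q-1}(k\otimes k_1^{-i})^{k^{q-1-i}}\widehat{k_1}$, where $(g\otimes h)^x=g^x\otimes h^x$; (5) $[\widehat k,\widehat{k_1}]=k^q\otimes k_1^q$;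 (6) $\widehat{[g,h]}=(g\otimes h)^q$. For $q=0$ there are no symbols $\widehat k$ and only relations (1), (2) (any mention of $\widehat k$ is then void, i.e. $\widehat k$ is read as $1$). Then $G\wedge^qG=(G\otimes^qG)/\langle g\otimes g\mid g\in G\rangle$, with $g\wedge h$ the image of $g\otimes h$, and the image of $\widehat k$ again written $\widehat k$. The group $G$ acts on $G\wedge^qG$ by $(g\wedge h)^x=g^x\wedge h^x$, $(\widehat k)^x=\widehat{k^x}$. Let $\lambda:G\times G\times G\to G\wedge^qG$, $(g,h,k)\lambda=(g\wedge h)\widehat k$; so $(g,h,1)\lambda=g\wedge h$ and $(1,1,k)\lambda=\widehat k$. Values of $\lambda$, and the elements $w_i^{g}$ ($g\in G$) obtained from the action, are elements of $G\wedge^qG$ and are written as (normal form) words in $w_1,\dots,w_r$. Relations of $\tau^q(G)$ (generators ordered as $g_1,\dots,g_n,g_1^\varphi,\dots,g_n^\varphi,w_1,\dots,w_r$): (T1) $r_i(g_1,\dots,g_n)=1$, $1\le i\le l$; (T2) $r_i(g_1^\varphi,\dots,g_n^\varphi)=1$, $1\le i\le l$; (T3) $u_i(w_1,\dots,w_r)=1$, $1\le i\le s$; (T4) $g_i^{-1}g_j^\varphi g_i=g_j^\varphi((g_i,g_j,1)\lambda)^{-1}$ for $1\le i,j\le n$; and $g_ig_j^\varphi g_i^{-1}=g_j^\varphi((g_i^{-1},g_j,1)\lambda)^{-1}$ for $1\le i,j\le n$, $i\notin I$; (T5) for $1\le i\le r$, $1\le j\le n$: $g_j^{-1}w_ig_j=w_i^{g_j}$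 and $(g_j^{\varphi})^{-1}w_ig_j^\varphi=w_i^{g_j}$ and, if $j\notin I$, also $g_jw_ig_j^{-1}=w_i^{g_j^{-1}}$ and $g_j^\varphi w_i(g_j^{\varphi})^{-1}=w_i^{g_j^{-1}}$ (the right-hand sides being the images of $w_i$ under the action of $G$ on $G\wedge^qG$). The group $\nu^q(G)$. Let $G^\varphi$ be an isomorphic copy of $G$ via $\varphi:g\mapsto g^\varphi$, and $\nu(G)=\langle G\cup G^\varphi\mid [g,h^\varphi]^k=[g^k,(h^k)^\varphi]=[g,h^\varphi]^{k^\varphi},\ \forall g,h,k\in G\rangle$ (where the multiplication relations of $G$ and $G^\varphi$ are understood). For $q\ge1$ let $\widehat{\mathcal G}=\{\widehat k\mid k\in G\}$ be a set of symbols (empty for $q=0$). Then $\nu^q(G)$ is the quotient of the free product $\nu(G)*F(\widehat{\mathcal G})$ ($F(\widehat{\mathcal G})$ free on $\widehat{\mathcal G}$) by the relations, for all $g,h,k,k_1\in G$: $g^{-1}\widehat kg=\widehat{k^g}$; $(g^\varphi)^{-1}\widehat kg^\varphi=\widehat{k^g}$; $\widehat k^{-1}[g,h^\varphi]\widehat k=[g^{k^q},(h^{k^q})^\varphi]$; $\widehat k^{-1}\,\widehat{kk_1}\,\widehat{k_1}^{-1}=\prod_{i=1}^{q-1}[k,(k_1^{-i})^\varphi]^{k^{q-1-i}}$; $[\widehat k,\widehat{k_1}]=[k^q,(k_1^q)^\varphi]$; $\widehat{[g,h]}=[g,h^\varphi]^q$. Finally $\Delta^q(G)=\langle[g,g^\varphi]\mid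 g\in G\rangle\le\nu^q(G)$. *)

theory Defs
  imports "HOL-Algebra.Generated_Groups"
begin

section \<open>Words and groups given by generators and relations\<close>

text \<open>The letter \<open>(x, True)\<close> stands for the generator \<open>x\<close> and \<open>(x, False)\<close> for its inverse.\<close>

type_synonym 'x word = "('x \<times> bool) list"

text \<open>A pair \<open>(l, r)\<close> of words stands for the relation \<open>l = r\<close>.\<close>

type_synonym 'x relations = "('x word \<times> 'x word) set"

definition words :: "'x set \<Rightarrow> 'x word set" where
  "words X = lists (X \<times> UNIV)"

definition gen :: "'x \<Rightarrow> 'x word" where
  "gen x = [(x, True)]"

definition winv :: "'x word \<Rightarrow> 'x word" where
  "winv u = rev (map (\<lambda>(x, b). (x, \<not> b)) u)"

definition wpow :: "'x word \<Rightarrow> int \<Rightarrow> 'x word" where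
  "wpow u k = (if 0 \<le> k then concat (replicate (nat k) u)
               else concat (replicate (nat (- k)) (winv u)))"

definition wconj :: "'x word \<Rightarrow> 'x word \<Rightarrow> 'x word" where
  "wconj u v = winv v @ u @ v"

definition wcomm :: "'x word \<Rightarrow> 'x word \<Rightarrow> 'x word" where
  "wcomm u v = winv u @ winv v @ u @ v"

definition wrename :: "('x \<Rightarrow> 'y) \<Rightarrow> 'x word \<Rightarrow> 'y word" where
  "wrename f = map (map_prod f id)"

inductive pres_eq :: "'x set \<Rightarrow> 'x relations \<Rightarrow> 'x word \<Rightarrow> 'x word \<Rightarrow> bool"
  for X R where
    refl: "u \<in> words X \<Longrightarrow> pres_eq X R u u"
  | sym: "pres_eq X R u v \<Longrightarrow> pres_eq X R v u"
  | trans: "pres_eq X R u v \<Longrightarrow> pres_eq X R v t \<Longrightarrow> pres_eq X R u t"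
  | cancel: "u \<in> words X \<Longrightarrow> v \<in> words X \<Longrightarrow> x \<in> X \<Longrightarrow>
      pres_eq X R (u @ [(x, b), (x, \<not> b)] @ v) (u @ v)"
  | rel: "(l, r) \<in> R \<Longrightarrow> u \<in> words X \<Longrightarrow> v \<in> words X \<Longrightarrow> l \<in> words X \<Longrightarrow> r \<in> words X \<Longrightarrow>
      pres_eq X R (u @ l @ v) (u @ r @ v)"

definition pres_class :: "'x set \<Rightarrow> 'x relations \<Rightarrow> 'x word \<Rightarrow> 'x word set" where
  "pres_class X R u = {v. pres_eq X R u v}"

definition presented_group :: "'x set \<Rightarrow> 'x relations \<Rightarrow> 'x word set monoid" where
  "presented_group X R =
     \<lparr>carrier = pres_class X R ` words X,
      mult = (\<lambda>A B. \<Union>a\<in>A. \<Union>b\<in>B. pres_class X R (a @ b)),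
      one = pres_class X R []\<rparr>"

definition word_eval :: "('a, 'b) monoid_scheme \<Rightarrow> ('x \<Rightarrow> 'a) \<Rightarrow> 'x word \<Rightarrow> 'a" where
  "word_eval H f u =
     foldr (\<lambda>(x, b) a. (if b then f x else inv\<^bsub>H\<^esub> (f x)) \<otimes>\<^bsub>H\<^esub> a) u \<one>\<^bsub>H\<^esub>"


section \<open>Polycyclic presentations\<close>

text \<open>The generators are symbols listed in order; the index set is given as the set of those
  symbols \<open>g\<^sub>i\<close> (rather than positions \<open>i\<close>) that have a power relation.\<close>

record 'x pc_presentation =
  pc_gens :: "'x list"
  pc_index :: "'x set"
  pc_exp :: "'x \<Rightarrow> nat"
  pc_rels :: "'x relations"

text \<open>\<open>pc_word [x\<^sub>1, \<dots>, x\<^sub>m] a\<close> is the word \<open>x\<^sub>1^a(x\<^sub>1) \<dots> x\<^sub>m^a(x\<^sub>m)\<close>.\<close>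

definition pc_word :: "'x list \<Rightarrow> ('x \<Rightarrow> int) \<Rightarrow> 'x word" where
  "pc_word xs a = concat (map (\<lambda>x. wpow (gen x) (a x)) xs)"

text \<open>In a decomposition \<open>pc_gens P = us @ y # vs\<close> the list \<open>vs\<close> consists of the generators
  after \<open>y\<close>.\<close>

definition is_pc_presentation :: "'x pc_presentation \<Rightarrow> bool" where
  "is_pc_presentation P \<longleftrightarrow>
     distinct (pc_gens P) \<and> pc_index P \<subseteq> set (pc_gens P) \<and> (\<forall>x\<in>pc_index P. 0 < pc_exp P x) \<and>
     (\<exists>\<alpha> \<beta> \<gamma>. pc_rels P =
        {(wpow (gen x) (int (pc_exp P x)), pc_word vs (\<alpha> x)) |us x vs.
            pc_gens P = us @ x # vs \<and> x \<in> pc_index P} \<union>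
        {(winv (gen y) @ gen x @ gen y, pc_word vs (\<beta> x y)) |us y vs x.
            pc_gens P = us @ y # vs \<and> x \<in> set vs} \<union>
        {(gen y @ gen x @ winv (gen y), pc_word vs (\<gamma> x y)) |us y vs x.
            pc_gens P = us @ y # vs \<and> x \<in> set vs \<and> y \<notin> pc_index P})"

definition pc_group :: "'x pc_presentation \<Rightarrow> 'x word set monoid" where
  "pc_group P = presented_group (set (pc_gens P)) (pc_rels P)"

definition pc_class :: "'x pc_presentation \<Rightarrow> 'x word \<Rightarrow> 'x word set" where
  "pc_class P = pres_class (set (pc_gens P)) (pc_rels P)"

text \<open>Exponent functions are normalised to be zero off the generators, so that uniqueness
  of exponents can be expressed by equality of functions.\<close>

definition nf_exponents :: "'x pc_presentation \<Rightarrow> ('x \<Rightarrow> int) set" where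
  "nf_exponents P = {a. (\<forall>x\<in>pc_index P. 0 \<le> a x \<and> a x < int (pc_exp P x)) \<and>
                        (\<forall>x. x \<notin> set (pc_gens P) \<longrightarrow> a x = 0)}"

definition consistent_pc_presentation :: "'x pc_presentation \<Rightarrow> bool" where
  "consistent_pc_presentation P \<longleftrightarrow>
     is_pc_presentation P \<and>
     (\<forall>A\<in>carrier (pc_group P). \<exists>!a. a \<in> nf_exponents P \<and> A = pc_class P (pc_word (pc_gens P) a))"

text \<open>\<open>P\<close> is a presentation of the group \<open>H\<close>, the symbol \<open>x\<close> naming the element \<open>f x\<close> of \<open>H\<close>.\<close>

definition presents :: "'x pc_presentation \<Rightarrow> ('a, 'b) monoid_scheme \<Rightarrow> ('x \<Rightarrow> 'a) \<Rightarrow> bool" where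
  "presents P H f \<longleftrightarrow>
     (\<exists>\<theta>\<in>iso (pc_group P) H. \<forall>x\<in>set (pc_gens P). \<theta> (pc_class P (gen x)) = f x)"

text \<open>The normal form word of an element \<open>v\<close> of a group \<open>H\<close> that is presented by \<open>P\<close> via \<open>f\<close>.\<close>

definition nf_word ::
  "'x pc_presentation \<Rightarrow> ('a, 'b) monoid_scheme \<Rightarrow> ('x \<Rightarrow> 'a) \<Rightarrow> 'a \<Rightarrow> 'x word" where
  "nf_word P H f v =
     pc_word (pc_gens P)
       (THE a. a \<in> nf_exponents P \<and> word_eval H f (pc_word (pc_gens P) a) = v)"


section \<open>The \<open>q\<close>-tensor square and the \<open>q\<close>-exterior square\<close>

definition gconj :: "('a, 'b) monoid_scheme \<Rightarrow> 'a \<Rightarrow> 'a \<Rightarrow> 'a" where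
  "gconj G y x = inv\<^bsub>G\<^esub> x \<otimes>\<^bsub>G\<^esub> y \<otimes>\<^bsub>G\<^esub> x"

definition gcomm :: "('a, 'b) monoid_scheme \<Rightarrow> 'a \<Rightarrow> 'a \<Rightarrow> 'a" where
  "gcomm G x y = inv\<^bsub>G\<^esub> x \<otimes>\<^bsub>G\<^esub> inv\<^bsub>G\<^esub> y \<otimes>\<^bsub>G\<^esub> x \<otimes>\<^bsub>G\<^esub> y"

datatype 'a tensor_sym = Tens 'a 'a | Hat 'a

definition qtensor_gens :: "('a, 'b) monoid_scheme \<Rightarrow> nat \<Rightarrow> 'a tensor_sym set" where
  "qtensor_gens G q = {Tens g h |g h. g \<in> carrier G \<and> h \<in> carrier G} \<union>
                      (if q = 0 then {} else Hat ` carrier G)"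

inductive_set qtensor_rels :: "('a, 'b) monoid_scheme \<Rightarrow> nat \<Rightarrow> 'a tensor_sym relations"
  for G q where
    tens_right: "\<lbrakk>g \<in> carrier G; h \<in> carrier G; h1 \<in> carrier G\<rbrakk> \<Longrightarrow>
      (gen (Tens g (h \<otimes>\<^bsub>G\<^esub> h1)),
       gen (Tens g h1) @ gen (Tens (gconj G g h1) (gconj G h h1))) \<in> qtensor_rels G q"
  | tens_left: "\<lbrakk>g \<in> carrier G; g1 \<in> carrier G; h \<in> carrier G\<rbrakk> \<Longrightarrow>
      (gen (Tens (g \<otimes>\<^bsub>G\<^esub> g1) h),
       gen (Tens (gconj G g g1) (gconj G h g1)) @ gen (Tens g1 h)) \<in> qtensor_rels G q"
  | tens_hat: "\<lbrakk>1 \<le> q; g \<in> carrier G; h \<in> carrier G; k \<in> carrier G\<rbrakk> \<Longrightarrow>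
      (wconj (gen (Tens g h)) (gen (Hat k)),
       gen (Tens (gconj G g (k [^]\<^bsub>G\<^esub> q)) (gconj G h (k [^]\<^bsub>G\<^esub> q)))) \<in> qtensor_rels G q"
  | hat_mult: "\<lbrakk>1 \<le> q; k \<in> carrier G; k1 \<in> carrier G\<rbrakk> \<Longrightarrow>
      (gen (Hat (k \<otimes>\<^bsub>G\<^esub> k1)),
       gen (Hat k) @
       concat (map (\<lambda>i. gen (Tens (gconj G k (k [^]\<^bsub>G\<^esub> (q - 1 - i)))
                                  (gconj G (inv\<^bsub>G\<^esub> (k1 [^]\<^bsub>G\<^esub> i)) (k [^]\<^bsub>G\<^esub> (q - 1 - i))))) [1..<q]) @
       gen (Hat k1)) \<in> qtensor_rels G q"
  | hat_hat: "\<lbrakk>1 \<le> q; k \<in> carrier G; k1 \<in> carrier G\<rbrakk> \<Longrightarrow>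
      (wcomm (gen (Hat k)) (gen (Hat k1)),
       gen (Tens (k [^]\<^bsub>G\<^esub> q) (k1 [^]\<^bsub>G\<^esub> q))) \<in> qtensor_rels G q"
  | hat_comm: "\<lbrakk>1 \<le> q; g \<in> carrier G; h \<in> carrier G\<rbrakk> \<Longrightarrow>
      (gen (Hat (gcomm G g h)), wpow (gen (Tens g h)) (int q)) \<in> qtensor_rels G q"

definition qtensor :: "('a, 'b) monoid_scheme \<Rightarrow> nat \<Rightarrow> 'a tensor_sym word set monoid" where
  "qtensor G q = presented_group (qtensor_gens G q) (qtensor_rels G q)"

definition qtensor_class ::
  "('a, 'b) monoid_scheme \<Rightarrow> nat \<Rightarrow> 'a tensor_sym word \<Rightarrow> 'a tensor_sym word set" where
  "qtensor_class G q = pres_class (qtensor_gens G q) (qtensor_rels G q)"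

type_synonym 'a qext_elem = "'a tensor_sym word set set"

definition qdiag :: "('a, 'b) monoid_scheme \<Rightarrow> nat \<Rightarrow> 'a tensor_sym word set set" where
  "qdiag G q = generate (qtensor G q) ((\<lambda>g. qtensor_class G q (gen (Tens g g))) ` carrier G)"

definition qext :: "('a, 'b) monoid_scheme \<Rightarrow> nat \<Rightarrow> 'a qext_elem monoid" where
  "qext G q = qtensor G q Mod qdiag G q"

definition wedge :: "('a, 'b) monoid_scheme \<Rightarrow> nat \<Rightarrow> 'a \<Rightarrow> 'a \<Rightarrow> 'a qext_elem" where
  "wedge G q g h = qdiag G q #>\<^bsub>qtensor G q\<^esub> qtensor_class G q (gen (Tens g h))"

definition hat :: "('a, 'b) monoid_scheme \<Rightarrow> nat \<Rightarrow> 'a \<Rightarrow> 'a qext_elem" where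
  "hat G q k = (if q = 0 then \<one>\<^bsub>qext G q\<^esub>
                else qdiag G q #>\<^bsub>qtensor G q\<^esub> qtensor_class G q (gen (Hat k)))"

definition lam :: "('a, 'b) monoid_scheme \<Rightarrow> nat \<Rightarrow> 'a \<Rightarrow> 'a \<Rightarrow> 'a \<Rightarrow> 'a qext_elem" where
  "lam G q g h k = wedge G q g h \<otimes>\<^bsub>qext G q\<^esub> hat G q k"

text \<open>The action of \<open>G\<close> replaces every symbol \<open>g \<otimes> h\<close> by \<open>g\<^sup>x \<otimes> h\<^sup>x\<close> and every hat symbol of \<open>k\<close>
  by that of \<open>k\<^sup>x\<close>, first on words, then on the classes forming the \<open>q\<close>-tensor square, then
  on the cosets forming the \<open>q\<close>-exterior square.\<close>

definition qtensor_act ::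
  "('a, 'b) monoid_scheme \<Rightarrow> nat \<Rightarrow> 'a \<Rightarrow> 'a tensor_sym word set \<Rightarrow> 'a tensor_sym word set" where
  "qtensor_act G q x A =
     (\<Union>u\<in>A. qtensor_class G q (wrename (map_tensor_sym (\<lambda>y. gconj G y x)) u))"

definition qext_act ::
  "('a, 'b) monoid_scheme \<Rightarrow> nat \<Rightarrow> 'a \<Rightarrow> 'a qext_elem \<Rightarrow> 'a qext_elem" where
  "qext_act G q x V = qtensor_act G q x ` V"


section \<open>The group \<open>\<nu>\<^sup>q(G)\<close>\<close>

text \<open>\<open>NG g\<close>, \<open>NP g\<close> and \<open>NH k\<close> are the generators for the elements \<open>g\<close> of \<open>G\<close>, for their images
  in the copy of \<open>G\<close> under \<open>\<phi>\<close>, and for the hat symbols.  The quotient of the free product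
  of \<open>\<nu>(G)\<close> and the free group on the hat symbols is written as a single presentation.\<close>

datatype 'a nu_sym = NG 'a | NP 'a | NH 'a

definition nuq_gens :: "('a, 'b) monoid_scheme \<Rightarrow> nat \<Rightarrow> 'a nu_sym set" where
  "nuq_gens G q = NG ` carrier G \<union> NP ` carrier G \<union> (if q = 0 then {} else NH ` carrier G)"

definition nu_comm :: "'a \<Rightarrow> 'a \<Rightarrow> 'a nu_sym word" where
  "nu_comm g h = wcomm (gen (NG g)) (gen (NP h))"

inductive_set nuq_rels :: "('a, 'b) monoid_scheme \<Rightarrow> nat \<Rightarrow> 'a nu_sym relations"
  for G q where
    mult_G: "\<lbrakk>g \<in> carrier G; h \<in> carrier G\<rbrakk> \<Longrightarrow>
      (gen (NG g) @ gen (NG h), gen (NG (g \<otimes>\<^bsub>G\<^esub> h))) \<in> nuq_rels G q"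
  | mult_phi: "\<lbrakk>g \<in> carrier G; h \<in> carrier G\<rbrakk> \<Longrightarrow>
      (gen (NP g) @ gen (NP h), gen (NP (g \<otimes>\<^bsub>G\<^esub> h))) \<in> nuq_rels G q"
  | conj_G: "\<lbrakk>g \<in> carrier G; h \<in> carrier G; k \<in> carrier G\<rbrakk> \<Longrightarrow>
      (wconj (nu_comm g h) (gen (NG k)), nu_comm (gconj G g k) (gconj G h k)) \<in> nuq_rels G q"
  | conj_phi: "\<lbrakk>g \<in> carrier G; h \<in> carrier G; k \<in> carrier G\<rbrakk> \<Longrightarrow>
      (wconj (nu_comm g h) (gen (NP k)), nu_comm (gconj G g k) (gconj G h k)) \<in> nuq_rels G q"
  | hat_conj_G: "\<lbrakk>1 \<le> q; g \<in> carrier G; k \<in> carrier G\<rbrakk> \<Longrightarrow>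
      (wconj (gen (NH k)) (gen (NG g)), gen (NH (gconj G k g))) \<in> nuq_rels G q"
  | hat_conj_phi: "\<lbrakk>1 \<le> q; g \<in> carrier G; k \<in> carrier G\<rbrakk> \<Longrightarrow>
      (wconj (gen (NH k)) (gen (NP g)), gen (NH (gconj G k g))) \<in> nuq_rels G q"
  | comm_hat: "\<lbrakk>1 \<le> q; g \<in> carrier G; h \<in> carrier G; k \<in> carrier G\<rbrakk> \<Longrightarrow>
      (wconj (nu_comm g h) (gen (NH k)),
       nu_comm (gconj G g (k [^]\<^bsub>G\<^esub> q)) (gconj G h (k [^]\<^bsub>G\<^esub> q))) \<in> nuq_rels G q"
  | hat_mult: "\<lbrakk>1 \<le> q; k \<in> carrier G; k1 \<in> carrier G\<rbrakk> \<Longrightarrow>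
      (winv (gen (NH k)) @ gen (NH (k \<otimes>\<^bsub>G\<^esub> k1)) @ winv (gen (NH k1)),
       concat (map (\<lambda>i. wconj (nu_comm k (inv\<^bsub>G\<^esub> (k1 [^]\<^bsub>G\<^esub> i)))
                              (gen (NG (k [^]\<^bsub>G\<^esub> (q - 1 - i))))) [1..<q])) \<in> nuq_rels G q"
  | hat_hat: "\<lbrakk>1 \<le> q; k \<in> carrier G; k1 \<in> carrier G\<rbrakk> \<Longrightarrow>
      (wcomm (gen (NH k)) (gen (NH k1)),
       nu_comm (k [^]\<^bsub>G\<^esub> q) (k1 [^]\<^bsub>G\<^esub> q)) \<in> nuq_rels G q"
  | hat_comm: "\<lbrakk>1 \<le> q; g \<in> carrier G; h \<in> carrier G\<rbrakk> \<Longrightarrow>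
      (gen (NH (gcomm G g h)), wpow (nu_comm g h) (int q)) \<in> nuq_rels G q"

definition nuq :: "('a, 'b) monoid_scheme \<Rightarrow> nat \<Rightarrow> 'a nu_sym word set monoid" where
  "nuq G q = presented_group (nuq_gens G q) (nuq_rels G q)"

definition nuq_class ::
  "('a, 'b) monoid_scheme \<Rightarrow> nat \<Rightarrow> 'a nu_sym word \<Rightarrow> 'a nu_sym word set" where
  "nuq_class G q = pres_class (nuq_gens G q) (nuq_rels G q)"

definition Delta :: "('a, 'b) monoid_scheme \<Rightarrow> nat \<Rightarrow> 'a nu_sym word set set" where
  "Delta G q = generate (nuq G q) ((\<lambda>g. nuq_class G q (nu_comm g g)) ` carrier G)"


section \<open>The group \<open>\<tau>\<^sup>q(G)\<close>\<close>

text \<open>\<open>TG x\<close> and \<open>TP x\<close> are the generators \<open>g\<^sub>i\<close> and \<open>g\<^sub>i\<^sup>\<phi>\<close>, where \<open>x\<close> is the symbol of \<open>g\<^sub>i\<close> in the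
  presentation \<open>P\<close> of \<open>G\<close>; \<open>TW y\<close> is the generator \<open>w\<^sub>i\<close>, where \<open>y\<close> is its symbol in the
  presentation \<open>Q\<close> of the \<open>q\<close>-exterior square.\<close>

datatype ('x, 'y) tau_sym = TG 'x | TP 'x | TW 'y

definition tau_W_word ::
  "('a, 'b) monoid_scheme \<Rightarrow> nat \<Rightarrow> 'y pc_presentation \<Rightarrow> ('y \<Rightarrow> 'a qext_elem) \<Rightarrow>
   'a qext_elem \<Rightarrow> ('x, 'y) tau_sym word" where
  "tau_W_word G q Q w v = wrename TW (nf_word Q (qext G q) w v)"

inductive_set tau_rels ::
  "('a, 'b) monoid_scheme \<Rightarrow> nat \<Rightarrow> 'x pc_presentation \<Rightarrow> ('x \<Rightarrow> 'a) \<Rightarrow>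
   'y pc_presentation \<Rightarrow> ('y \<Rightarrow> 'a qext_elem) \<Rightarrow> ('x, 'y) tau_sym relations"
  for G q P g Q w where
    T1: "(l, r) \<in> pc_rels P \<Longrightarrow> (wrename TG l, wrename TG r) \<in> tau_rels G q P g Q w"
  | T2: "(l, r) \<in> pc_rels P \<Longrightarrow> (wrename TP l, wrename TP r) \<in> tau_rels G q P g Q w"
  | T3: "(l, r) \<in> pc_rels Q \<Longrightarrow> (wrename TW l, wrename TW r) \<in> tau_rels G q P g Q w"
  | T4: "\<lbrakk>x \<in> set (pc_gens P); x' \<in> set (pc_gens P)\<rbrakk> \<Longrightarrow>
      (winv (gen (TG x)) @ gen (TP x') @ gen (TG x),
       gen (TP x') @ tau_W_word G q Q w (inv\<^bsub>qext G q\<^esub> (lam G q (g x) (g x') \<one>\<^bsub>G\<^esub>)))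
      \<in> tau_rels G q P g Q w"
  | T4_inv: "\<lbrakk>x \<in> set (pc_gens P); x' \<in> set (pc_gens P); x \<notin> pc_index P\<rbrakk> \<Longrightarrow>
      (gen (TG x) @ gen (TP x') @ winv (gen (TG x)),
       gen (TP x') @ tau_W_word G q Q w (inv\<^bsub>qext G q\<^esub> (lam G q (inv\<^bsub>G\<^esub> (g x)) (g x') \<one>\<^bsub>G\<^esub>)))
      \<in> tau_rels G q P g Q w"
  | T5_G: "\<lbrakk>y \<in> set (pc_gens Q); x \<in> set (pc_gens P)\<rbrakk> \<Longrightarrow>
      (winv (gen (TG x)) @ gen (TW y) @ gen (TG x),
       tau_W_word G q Q w (qext_act G q (g x) (w y))) \<in> tau_rels G q P g Q w"
  | T5_phi: "\<lbrakk>y \<in> set (pc_gens Q); x \<in> set (pc_gens P)\<rbrakk> \<Longrightarrow>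
      (winv (gen (TP x)) @ gen (TW y) @ gen (TP x),
       tau_W_word G q Q w (qext_act G q (g x) (w y))) \<in> tau_rels G q P g Q w"
  | T5_G_inv: "\<lbrakk>y \<in> set (pc_gens Q); x \<in> set (pc_gens P); x \<notin> pc_index P\<rbrakk> \<Longrightarrow>
      (gen (TG x) @ gen (TW y) @ winv (gen (TG x)),
       tau_W_word G q Q w (qext_act G q (inv\<^bsub>G\<^esub> (g x)) (w y))) \<in> tau_rels G q P g Q w"
  | T5_phi_inv: "\<lbrakk>y \<in> set (pc_gens Q); x \<in> set (pc_gens P); x \<notin> pc_index P\<rbrakk> \<Longrightarrow>
      (gen (TP x) @ gen (TW y) @ winv (gen (TP x)),
       tau_W_word G q Q w (qext_act G q (inv\<^bsub>G\<^esub> (g x)) (w y))) \<in> tau_rels G q P g Q w"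

definition tau_pres ::
  "('a, 'b) monoid_scheme \<Rightarrow> nat \<Rightarrow> 'x pc_presentation \<Rightarrow> ('x \<Rightarrow> 'a) \<Rightarrow>
   'y pc_presentation \<Rightarrow> ('y \<Rightarrow> 'a qext_elem) \<Rightarrow> ('x, 'y) tau_sym pc_presentation" where
  "tau_pres G q P g Q w =
     \<lparr>pc_gens = map TG (pc_gens P) @ map TP (pc_gens P) @ map TW (pc_gens Q),
      pc_index = TG ` pc_index P \<union> TP ` pc_index P \<union> TW ` pc_index Q,
      pc_exp = case_tau_sym (pc_exp P) (pc_exp P) (pc_exp Q),
      pc_rels = tau_rels G q P g Q w\<rparr>"

definition tau ::
  "('a, 'b) monoid_scheme \<Rightarrow> nat \<Rightarrow> 'x pc_presentation \<Rightarrow> ('x \<Rightarrow> 'a) \<Rightarrow>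
   'y pc_presentation \<Rightarrow> ('y \<Rightarrow> 'a qext_elem) \<Rightarrow> ('x, 'y) tau_sym word set monoid" where
  "tau G q P g Q w = pc_group (tau_pres G q P g Q w)"

definition tau_class ::
  "('a, 'b) monoid_scheme \<Rightarrow> nat \<Rightarrow> 'x pc_presentation \<Rightarrow> ('x \<Rightarrow> 'a) \<Rightarrow>
   'y pc_presentation \<Rightarrow> ('y \<Rightarrow> 'a qext_elem) \<Rightarrow> ('x, 'y) tau_sym word \<Rightarrow> ('x, 'y) tau_sym word set"
  where
  "tau_class G q P g Q w = pc_class (tau_pres G q P g Q w)"

definition tau_W ::
  "('a, 'b) monoid_scheme \<Rightarrow> nat \<Rightarrow> 'x pc_presentation \<Rightarrow> ('x \<Rightarrow> 'a) \<Rightarrow>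
   'y pc_presentation \<Rightarrow> ('y \<Rightarrow> 'a qext_elem) \<Rightarrow> ('x, 'y) tau_sym word set set" where
  "tau_W G q P g Q w =
     generate (tau G q P g Q w) ((\<lambda>y. tau_class G q P g Q w (gen (TW y))) ` set (pc_gens Q))"

end

theory Submission
  imports Defs
begin

text \<open>
  Everything follows from a concrete model of \<open>\<tau>\<^sup>q(G)\<close>.  Let \<open>M\<close> be a group on which \<open>G\<close> acts, with an
  equivariant pairing \<open>p: G \<times> G \<rightarrow> M\<close> that satisfies the two expansion rules of the nonabelian tensor
  square and the Peiffer identity: \<open>[g, h]\<close> acts on \<open>M\<close> as conjugation by \<open>p g h\<close>.  Then the set
  \<open>G \<times> G \<times> M\<close>, with \<open>(a, b, m)\<close> thought of as \<open>a b\<^sup>\<phi> m\<close> and \<open>[a, b\<^sup>\<phi>] = p a b\<close>, is a group \<open>E(M)\<close>, an extension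
  of \<open>G \<times> G\<close> by \<open>M\<close> (\<open>pairing_extension\<close>, \<open>group_E\<close>); the Peiffer identity is what associativity
  requires.

  The q-tensor square \<open>T\<close> is such an \<open>M\<close> (\<open>tensor_crossed\<close>).  For conjugates of tensors, the Peiffer
  identity is the classical consequence of expanding \<open>g g1 \<otimes> h h1\<close> in two ways
  (\<open>act_gcomm_pairing\<close>).  For conjugates of hats it is less obvious: the hat of \<open>k\<^sup>d\<close>, where \<open>d = [g, h]\<close>, is
  expanded by the product rule for hats, and the resulting product telescopes to \<open>k\<^sup>q \<otimes> d\<close>
  (\<open>pairing_pow_left\<close>, \<open>act_gcomm_hat\<close>).  It follows that the elements \<open>g \<otimes> g\<close> are central, so the
  q-exterior square is a quotient group of \<open>T\<close>, and it inherits all the structure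
  (\<open>exterior_crossed\<close>).

  Let \<open>E\<close> be the extension by the q-exterior square.  The generators of \<open>\<tau>\<^sup>q(G)\<close> have evident
  values in \<open>E\<close>, and these satisfy its relations (\<open>tval_rels\<close>).  On the other hand these relations
  form a polycyclic presentation (\<open>tau_pc_presentation\<close>), so every element of \<open>\<tau>\<^sup>q(G)\<close> is represented by a
  normal form word (\<open>pc_group_normal_form_exists\<close>).  Such a word is a triple of normal form words for
  \<open>G\<close>, \<open>G\<close> and the exterior square, and its value in \<open>E\<close> is the triple of their values.  As the given presentations are
  consistent, the value determines the word (\<open>tval_nf_inj\<close>).  Hence the presentation of
  \<open>\<tau>\<^sup>q(G)\<close> is consistent, and \<open>\<tau>\<^sup>q(G)\<close> is isomorphic to \<open>E\<close> with \<open>W\<close> corresponding to the exterior square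
  (\<open>tau_iso\<close>); this gives the first three claims.

  For the last claim, the relations of \<open>\<nu>\<^sup>q(G)\<close> hold in \<open>E\<close>, and the relations of \<open>T\<close> hold for the commutators
  \<open>[g, h\<^sup>\<phi>]\<close> and the hats in \<open>\<nu>\<^sup>q(G)\<close>.  The latter gives a surjection from \<open>E(T)\<close> onto \<open>\<nu>\<^sup>q(G)\<close>
  (\<open>tensor_extension_to_nu\<close>).  The composite from \<open>E(T)\<close> to \<open>E\<close> is the identity on \<open>G \<times> G\<close> and the projection on
  \<open>T\<close>, so the kernel of the map from \<open>\<nu>\<^sup>q(G)\<close> to \<open>E\<close> is the image of the diagonal of \<open>T\<close>, which is
  \<open>\<Delta>\<^sup>q(G)\<close> (\<open>nu_to_extension\<close>).
\<close>

section \<open>Conjugation, commutators and other preliminaries on groups\<close>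

context group
begin

lemma cancel_left [simp]:
  assumes "x \<in> carrier G" "y \<in> carrier G"
  shows "inv x \<otimes> (x \<otimes> y) = y" and "x \<otimes> (inv x \<otimes> y) = y"
  using assms by (simp_all flip: m_assoc)

text \<open>Rewriting with these rules and \<open>cancel_left\<close> brings a product of group elements and their
  inverses into freely reduced form, so \<open>simp\<close> decides identities that hold in free groups.\<close>

lemmas free_reduction = m_assoc inv_mult_group gconj_def gcomm_def

lemma gconj_closed [simp]:
  "x \<in> carrier G \<Longrightarrow> y \<in> carrier G \<Longrightarrow> gconj G y x \<in> carrier G"
  by (simp add: gconj_def)

lemma gcomm_closed [simp]:
  "x \<in> carrier G \<Longrightarrow> y \<in> carrier G \<Longrightarrow> gcomm G x y \<in> carrier G"
  by (simp add: gcomm_def)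

lemma gconj_mult:
  "\<lbrakk>x \<in> carrier G; y \<in> carrier G; z \<in> carrier G\<rbrakk> \<Longrightarrow>
    gconj G (y \<otimes> z) x = gconj G y x \<otimes> gconj G z x"
  by (simp add: free_reduction)

lemma gconj_one [simp]: "x \<in> carrier G \<Longrightarrow> gconj G \<one> x = \<one>"
  by (simp add: gconj_def)

lemma gconj_by_one [simp]: "x \<in> carrier G \<Longrightarrow> gconj G x \<one> = x"
  by (simp add: gconj_def)

lemma gconj_by_mult:
  "\<lbrakk>x \<in> carrier G; y \<in> carrier G; z \<in> carrier G\<rbrakk> \<Longrightarrow>
    gconj G z (x \<otimes> y) = gconj G (gconj G z x) y"
  by (simp add: free_reduction)

lemma gconj_inv:
  "\<lbrakk>x \<in> carrier G; y \<in> carrier G\<rbrakk> \<Longrightarrow> gconj G (inv y) x = inv (gconj G y x)"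
  by (simp add: free_reduction)

lemma gconj_hom: "x \<in> carrier G \<Longrightarrow> (\<lambda>y. gconj G y x) \<in> hom G G"
  by (simp add: hom_def gconj_mult)

lemma gconj_pow:
  "\<lbrakk>x \<in> carrier G; y \<in> carrier G\<rbrakk> \<Longrightarrow> gconj G (y [^] (n::nat)) x = gconj G y x [^] n"
  by (induction n) (simp_all add: gconj_mult)

lemma gconj_gconj:
  "\<lbrakk>x \<in> carrier G; y \<in> carrier G; z \<in> carrier G\<rbrakk> \<Longrightarrow>
    gconj G (gconj G z y) x = gconj G (gconj G z x) (gconj G y x)"
  by (simp add: free_reduction)

lemma gconj_gcomm:
  "\<lbrakk>x \<in> carrier G; y \<in> carrier G; z \<in> carrier G\<rbrakk> \<Longrightarrow>
    gconj G (gcomm G y z) x = gcomm G (gconj G y x) (gconj G z x)"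
  by (simp add: free_reduction)

lemma gconj_self [simp]: "x \<in> carrier G \<Longrightarrow> gconj G x x = x"
  by (simp add: gconj_def)

lemma gconj_pow_self [simp]: "x \<in> carrier G \<Longrightarrow> gconj G x (x [^] (n::nat)) = x"
  by (induction n) (simp_all add: gconj_by_mult)

lemma gconj_inv_cancel [simp]:
  "\<lbrakk>x \<in> carrier G; y \<in> carrier G\<rbrakk> \<Longrightarrow> gconj G (gconj G y (inv x)) x = y"
  by (simp add: gconj_by_mult[symmetric])

end

definition list_prod :: "('a, 'b) monoid_scheme \<Rightarrow> 'a list \<Rightarrow> 'a" where
  "list_prod H xs = foldr (\<otimes>\<^bsub>H\<^esub>) xs \<one>\<^bsub>H\<^esub>"

lemma list_prod_Nil [simp]: "list_prod H [] = \<one>\<^bsub>H\<^esub>"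
  by (simp add: list_prod_def)

lemma list_prod_Cons [simp]: "list_prod H (x # xs) = x \<otimes>\<^bsub>H\<^esub> list_prod H xs"
  by (simp add: list_prod_def)

context group
begin

lemma list_prod_closed [simp]: "set xs \<subseteq> carrier G \<Longrightarrow> list_prod G xs \<in> carrier G"
  by (induction xs) auto

lemma list_prod_append:
  "set xs \<subseteq> carrier G \<Longrightarrow> set ys \<subseteq> carrier G \<Longrightarrow>
    list_prod G (xs @ ys) = list_prod G xs \<otimes> list_prod G ys"
  by (induction xs) (auto simp: m_assoc)

end

lemma hom_list_prod:
  assumes "group H" "group K" "h \<in> hom H K" "set xs \<subseteq> carrier H"
  shows "h (list_prod H xs) = list_prod K (map h xs)"
  using assms(4)
proof (induction xs)
  case Nil
  then show ?case using assms by (simp add: hom_one)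
next
  case (Cons x xs)
  then show ?case
    using assms by (simp add: hom_mult[OF assms(3)] group.list_prod_closed)
qed

lemma (in group) normal_generate_central:
  assumes "S \<subseteq> carrier G" "\<And>s x. s \<in> S \<Longrightarrow> x \<in> carrier G \<Longrightarrow> x \<otimes> s = s \<otimes> x"
  shows "generate G S \<lhd> G"
proof (rule normal_generateI[OF assms(1)])
  fix s x assume *: "s \<in> S" "x \<in> carrier G"
  then have "s \<in> carrier G" using assms(1) by blast
  with * assms(2)[of s x] show "x \<otimes> s \<otimes> inv x \<in> S" by (simp add: m_assoc)
qed

lemma (in group) gconj_eqI:
  "\<lbrakk>x \<in> carrier G; y \<in> carrier G; z \<in> carrier G; x \<otimes> y = y \<otimes> z\<rbrakk> \<Longrightarrow> gconj G x y = z"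
  by (simp add: gconj_def m_assoc)

lemma (in group_hom) hom_gcomm:
  "x \<in> carrier G \<Longrightarrow> y \<in> carrier G \<Longrightarrow> h (gcomm G x y) = gcomm H (h x) (h y)"
  by (simp add: gcomm_def)

lemma kernel_compose_inj:
  assumes "group H" "group K" "inj_on f (carrier H)" "f \<in> hom H K" "h \<in> hom N H"
  shows "kernel N K (f \<circ> h) = kernel N H h"
proof -
  have "f (h x) = \<one>\<^bsub>K\<^esub> \<longleftrightarrow> h x = \<one>\<^bsub>H\<^esub>" if "x \<in> carrier N" for x
  proof -
    have "f \<one>\<^bsub>H\<^esub> = \<one>\<^bsub>K\<^esub>" using assms(1,2,4) by (simp add: hom_one)
    moreover have "h x \<in> carrier H" "\<one>\<^bsub>H\<^esub> \<in> carrier H"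
      using hom_in_carrier[OF assms(5) that] assms(1) by (simp_all add: group.is_monoid)
    ultimately show ?thesis using inj_on_eq_iff[OF assms(3)] by metis
  qed
  then show ?thesis by (auto simp: kernel_def)
qed

section \<open>Words and presented groups\<close>

lemma words_Nil [simp]: "[] \<in> words X"
  by (simp add: words_def)

lemma words_Cons [simp]: "a # u \<in> words X \<longleftrightarrow> fst a \<in> X \<and> u \<in> words X"
  by (cases a) (auto simp: words_def)

lemma words_append [simp]: "u @ v \<in> words X \<longleftrightarrow> u \<in> words X \<and> v \<in> words X"
  by (auto simp: words_def)

lemma words_gen [simp]: "gen x \<in> words X \<longleftrightarrow> x \<in> X"
  by (simp add: gen_def)

lemma winv_Nil [simp]: "winv [] = []"
  by (simp add: winv_def)

lemma winv_Cons: "winv ((x, b) # u) = winv u @ [(x, \<not> b)]"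
  by (simp add: winv_def)

lemma words_winv [simp]: "winv u \<in> words X \<longleftrightarrow> u \<in> words X"
  by (induction u) (auto simp: winv_Cons)

lemma words_concat: "(\<And>v. v \<in> set us \<Longrightarrow> v \<in> words X) \<Longrightarrow> concat us \<in> words X"
  by (induction us) auto

lemma words_wpow [simp]: "u \<in> words X \<Longrightarrow> wpow u k \<in> words X"
  by (auto simp: wpow_def intro!: words_concat)

lemma words_wconj [simp]: "wconj u v \<in> words X \<longleftrightarrow> u \<in> words X \<and> v \<in> words X"
  by (auto simp: wconj_def)

lemma words_wcomm [simp]: "wcomm u v \<in> words X \<longleftrightarrow> u \<in> words X \<and> v \<in> words X"
  by (auto simp: wcomm_def)

lemma words_wrename: "u \<in> words X \<Longrightarrow> (\<And>x. x \<in> X \<Longrightarrow> f x \<in> Y) \<Longrightarrow> wrename f u \<in> words Y"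
  by (induction u) (auto simp: wrename_def)

lemma wrename_append [simp]: "wrename f (u @ v) = wrename f u @ wrename f v"
  by (simp add: wrename_def)

lemma wrename_gen [simp]: "wrename f (gen x) = gen (f x)"
  by (simp add: wrename_def gen_def)

lemma wrename_Nil [simp]: "wrename f [] = []"
  by (simp add: wrename_def)

lemma wrename_winv [simp]: "wrename f (winv u) = winv (wrename f u)"
  by (auto simp: wrename_def winv_def rev_map)

lemma wrename_concat: "wrename f (concat us) = concat (map (wrename f) us)"
  by (induction us) auto

lemma wrename_wpow [simp]: "wrename f (wpow u k) = wpow (wrename f u) k"
  by (simp add: wpow_def wrename_concat)

lemma wrename_wconj [simp]: "wrename f (wconj u v) = wconj (wrename f u) (wrename f v)"
  by (simp add: wconj_def)

lemma wrename_wcomm [simp]: "wrename f (wcomm u v) = wcomm (wrename f u) (wrename f v)"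
  by (simp add: wcomm_def)

lemma wrename_wrename: "wrename f (wrename h u) = wrename (f \<circ> h) u"
  by (auto simp: wrename_def)

lemma wrename_cong:
  "u \<in> words X \<Longrightarrow> (\<And>x. x \<in> X \<Longrightarrow> f x = h x) \<Longrightarrow> wrename f u = wrename h u"
  by (induction u) (auto simp: wrename_def)

lemma wrename_id: "wrename (\<lambda>x. x) u = u"
  by (simp add: wrename_def map_prod_def)

locale word_evaluation = group H for H (structure) +
  fixes X :: "'x set" and f :: "'x \<Rightarrow> 'a"
  assumes gen_value_closed [simp]: "x \<in> X \<Longrightarrow> f x \<in> carrier H"
begin

lemma eval_Nil [simp]: "word_eval H f [] = \<one>"
  by (simp add: word_eval_def)

lemma eval_Cons:
  "word_eval H f (a # u) = (if snd a then f (fst a) else inv f (fst a)) \<otimes> word_eval H f u"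
  by (cases a) (simp add: word_eval_def)

lemma eval_closed [simp]: "u \<in> words X \<Longrightarrow> word_eval H f u \<in> carrier H"
  by (induction u) (auto simp: eval_Cons)

lemma eval_append [simp]:
  "u \<in> words X \<Longrightarrow> v \<in> words X \<Longrightarrow> word_eval H f (u @ v) = word_eval H f u \<otimes> word_eval H f v"
  by (induction u) (auto simp: eval_Cons m_assoc)

lemma eval_gen [simp]: "x \<in> X \<Longrightarrow> word_eval H f (gen x) = f x"
  by (simp add: gen_def eval_Cons)

lemma eval_winv [simp]: "u \<in> words X \<Longrightarrow> word_eval H f (winv u) = inv (word_eval H f u)"
proof (induction u)
  case (Cons a u)
  then show ?case
    by (cases a) (auto simp: winv_Cons eval_Cons inv_mult_group)
qed auto

lemma eval_replicate:
  "u \<in> words X \<Longrightarrow> word_eval H f (concat (replicate n u)) = word_eval H f u [^] n"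
proof (induction n)
  case (Suc n)
  have "concat (replicate n u) \<in> words X"
    using Suc.prems by (auto intro: words_concat)
  then have "word_eval H f (concat (replicate (Suc n) u)) = word_eval H f u \<otimes> word_eval H f u [^] n"
    using Suc by simp
  also have "\<dots> = word_eval H f u [^] Suc n"
    using Suc.prems by (intro nat_pow_Suc2[symmetric] eval_closed)
  finally show ?case .
qed simp

lemma eval_wpow [simp]: "u \<in> words X \<Longrightarrow> word_eval H f (wpow u k) = word_eval H f u [^] k"
proof (cases k rule: int_cases2)
  case (nonneg n)
  assume "u \<in> words X"
  then show ?thesis
    unfolding nonneg int_pow_int by (simp add: wpow_def eval_replicate)
next
  case (nonpos n)
  assume u: "u \<in> words X"
  have "n = 0" if "0 \<le> - int n" using that by simp
  then show ?thesis
    using u unfolding nonpos int_pow_neg_int[OF eval_closed[OF u]]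
    by (auto simp: wpow_def eval_replicate nat_pow_inv)
qed

lemma eval_wconj [simp]:
  "u \<in> words X \<Longrightarrow> v \<in> words X \<Longrightarrow>
    word_eval H f (wconj u v) = gconj H (word_eval H f u) (word_eval H f v)"
  by (simp add: wconj_def gconj_def m_assoc)

lemma eval_wcomm [simp]:
  "u \<in> words X \<Longrightarrow> v \<in> words X \<Longrightarrow>
    word_eval H f (wcomm u v) = gcomm H (word_eval H f u) (word_eval H f v)"
  by (simp add: wcomm_def gcomm_def m_assoc)

lemma eval_concat_map:
  "(\<And>i. i \<in> set is \<Longrightarrow> c i \<in> words X) \<Longrightarrow>
    word_eval H f (concat (map c is)) = list_prod H (map (\<lambda>i. word_eval H f (c i)) is)"
proof (induction "is")
  case (Cons i "is")
  have "concat (map c is) \<in> words X"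
    using Cons.prems by (auto intro!: words_concat)
  then show ?case using Cons by simp
qed simp

end

lemma word_eval_wrename: "word_eval H f (wrename h u) = word_eval H (f \<circ> h) u"
  by (induction u) (auto simp: word_eval_def wrename_def)

lemma word_eval_cong:
  "u \<in> words X \<Longrightarrow> (\<And>x. x \<in> X \<Longrightarrow> f x = h x) \<Longrightarrow> word_eval H f u = word_eval H h u"
  by (induction u) (auto simp: word_eval_def)

lemma hom_word_eval:
  assumes "word_evaluation H X f" "group K" "h \<in> hom H K" "u \<in> words X"
  shows "h (word_eval H f u) = word_eval K (h \<circ> f) u"
proof -
  interpret H: word_evaluation H X f by fact
  interpret K: word_evaluation K X "h \<circ> f"
    using assms by (auto simp: word_evaluation_def word_evaluation_axioms_def hom_def Pi_def)
  interpret h: group_hom H K h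
    by (simp add: assms group_hom_axioms.intro group_hom_def)
  show ?thesis
    using assms(4) by (induction u) (auto simp: H.eval_Cons K.eval_Cons)
qed

lemma (in group) word_eval_in_subgroup:
  assumes "subgroup K G" "u \<in> words Y" "\<And>y. y \<in> Y \<Longrightarrow> f y \<in> K"
  shows "word_eval G f u \<in> K"
  using assms(2)
  by (induction u)
    (auto simp: word_eval_def assms(3) subgroup.one_closed[OF assms(1)]
      subgroup.m_closed[OF assms(1)] subgroup.m_inv_closed[OF assms(1)])

locale presentation =
  fixes X :: "'x set" and R :: "'x relations"
begin

abbreviation "F \<equiv> presented_group X R"
abbreviation "cls \<equiv> pres_class X R"

lemma pres_eq_words: "pres_eq X R u v \<Longrightarrow> u \<in> words X \<and> v \<in> words X"
  by (induction rule: pres_eq.induct) auto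

lemma pres_eq_appendI:
  assumes "pres_eq X R u v" "p \<in> words X" "s \<in> words X"
  shows "pres_eq X R (p @ u @ s) (p @ v @ s)"
  using assms
proof (induction rule: pres_eq.induct)
  case (cancel u v x b)
  then show ?case using pres_eq.cancel[of "p @ u" X "v @ s" x R b] by simp
next
  case (rel l r u v)
  then show ?case using pres_eq.rel[of l r R "p @ u" X "v @ s"] by simp
qed (auto intro: pres_eq.intros)

lemma pres_eq_append:
  assumes "pres_eq X R u u'" "pres_eq X R v v'"
  shows "pres_eq X R (u @ v) (u' @ v')"
  using pres_eq_appendI[OF assms(1), of "[]" v] pres_eq_appendI[OF assms(2), of u' "[]"]
    pres_eq_words assms by (auto intro: pres_eq.trans)

lemma pres_eq_winv: "u \<in> words X \<Longrightarrow> pres_eq X R (winv u @ u) []"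
proof (induction u)
  case (Cons a u)
  obtain x b where a: "a = (x, b)" by fastforce
  have "pres_eq X R (winv u @ [(x, \<not> b), (x, \<not> \<not> b)] @ u) (winv u @ u)"
    using Cons a by (intro pres_eq.cancel) auto
  then show ?case using Cons a by (auto simp: winv_Cons intro: pres_eq.trans)
qed (auto intro: pres_eq.refl)

lemma cls_eq_iff: "u \<in> words X \<Longrightarrow> cls u = cls v \<longleftrightarrow> pres_eq X R u v"
  unfolding pres_class_def
  using pres_eq.refl pres_eq.sym pres_eq.trans by blast

lemma cls_mult:
  assumes "u \<in> words X" "v \<in> words X"
  shows "cls u \<otimes>\<^bsub>F\<^esub> cls v = cls (u @ v)"
proof -
  have "cls (a @ b) = cls (u @ v)" if "a \<in> cls u" "b \<in> cls v" for a b
  proof -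
    have "pres_eq X R (u @ v) (a @ b)"
      using that by (auto simp: pres_class_def intro: pres_eq_append)
    with assms show ?thesis by (metis cls_eq_iff words_append)
  qed
  moreover have "u \<in> cls u" "v \<in> cls v"
    using assms by (auto simp: pres_class_def intro: pres_eq.refl)
  ultimately have "(\<Union>a\<in>cls u. \<Union>b\<in>cls v. cls (a @ b)) = cls (u @ v)" by blast
  then show ?thesis by (simp add: presented_group_def)
qed

lemma cls_closed [simp]: "u \<in> words X \<Longrightarrow> cls u \<in> carrier F"
  by (simp add: presented_group_def)

lemma carrier_cases:
  assumes "A \<in> carrier F" obtains u where "u \<in> words X" "A = cls u"
  using assms by (auto simp: presented_group_def)

lemma one_eq: "\<one>\<^bsub>F\<^esub> = cls []"
  by (simp add: presented_group_def)

lemma group_F: "group F"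
proof (rule groupI)
  fix A assume "A \<in> carrier F"
  then obtain u where u: "u \<in> words X" "A = cls u" by (rule carrier_cases)
  then have "cls (winv u) \<otimes>\<^bsub>F\<^esub> A = \<one>\<^bsub>F\<^esub>"
    using pres_eq_winv by (simp add: cls_mult one_eq cls_eq_iff)
  with u show "\<exists>B\<in>carrier F. B \<otimes>\<^bsub>F\<^esub> A = \<one>\<^bsub>F\<^esub>" by force
qed (auto elim!: carrier_cases simp: cls_mult one_eq)

sublocale group F by (rule group_F)

sublocale word_evaluation F X "\<lambda>x. cls (gen x)"
  by unfold_locales simp

lemma cls_inv: "u \<in> words X \<Longrightarrow> inv\<^bsub>F\<^esub> cls u = cls (winv u)"
  by (rule inv_equality) (simp_all add: cls_mult one_eq cls_eq_iff pres_eq_winv)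

lemma eval_cls: "u \<in> words X \<Longrightarrow> word_eval F (\<lambda>x. cls (gen x)) u = cls u"
proof (induction u)
  case (Cons a u)
  obtain x b where a: "a = (x, b)" by fastforce
  have "cls [(x, b)] = (if b then cls (gen x) else inv\<^bsub>F\<^esub> cls (gen x))" if "x \<in> X"
    using that by (auto simp: cls_inv) (simp_all add: gen_def winv_def)
  moreover have "cls [(x, b)] \<otimes>\<^bsub>F\<^esub> cls u = cls (a # u)"
    using Cons a by (simp add: cls_mult)
  ultimately show ?case using Cons a by (auto simp: eval_Cons)
qed (simp add: one_eq)

lemma cls_rel: "(l, r) \<in> R \<Longrightarrow> l \<in> words X \<Longrightarrow> r \<in> words X \<Longrightarrow> cls l = cls r"
  using pres_eq.rel[of l r R "[]" X "[]"] by (simp add: cls_eq_iff)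

lemma eval_rel:
  "(l, r) \<in> R \<Longrightarrow> l \<in> words X \<Longrightarrow> r \<in> words X \<Longrightarrow>
    word_eval F (\<lambda>x. cls (gen x)) l = word_eval F (\<lambda>x. cls (gen x)) r"
  by (simp add: eval_cls cls_rel)

lemma hom_cls:
  assumes "group K" "h \<in> hom F K" "u \<in> words X"
  shows "h (cls u) = word_eval K (\<lambda>x. h (cls (gen x))) u"
  using hom_word_eval[OF word_evaluation_axioms assms] assms(3)
  by (simp add: eval_cls comp_def)

lemma hom_eqI:
  assumes "group K" "h \<in> hom F K" "h' \<in> hom F K" "\<And>x. x \<in> X \<Longrightarrow> h (cls (gen x)) = h' (cls (gen x))"
    "A \<in> carrier F"
  shows "h A = h' A"
proof -
  obtain u where u: "u \<in> words X" "A = cls u" using assms(5) by (rule carrier_cases)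
  then have "h A = word_eval K (\<lambda>x. h (cls (gen x))) u" using assms(1,2) by (simp add: hom_cls)
  also have "\<dots> = word_eval K (\<lambda>x. h' (cls (gen x))) u"
    using u(1) assms(4) by (rule word_eval_cong)
  also have "\<dots> = h' A" using u assms(1,3) by (simp add: hom_cls)
  finally show ?thesis .
qed

text \<open>The universal property of a presented group: every homomorphism below whose source is given by
  generators and relations comes from here.\<close>

lemma lift_exists:
  assumes "word_evaluation K X f"
    and "\<And>l r. (l, r) \<in> R \<Longrightarrow> l \<in> words X \<Longrightarrow> r \<in> words X \<Longrightarrow> word_eval K f l = word_eval K f r"
  shows "\<exists>h\<in>hom F K. \<forall>u\<in>words X. h (cls u) = word_eval K f u"
proof -
  interpret K: word_evaluation K X f by fact
  have eq: "word_eval K f u = word_eval K f v" if "pres_eq X R u v" for u v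
    using that
  proof (induction rule: pres_eq.induct)
    case (cancel u v x b)
    then show ?case by (cases b) (simp_all add: K.eval_Cons)
  next
    case (rel l r u v)
    then show ?case using assms(2)[of l r] by simp
  qed auto
  \<comment> \<open>the evaluation is constant on every class\<close>
  define h where "h = (\<lambda>A. the_elem (word_eval K f ` A))"
  have h: "h (cls u) = word_eval K f u" if "u \<in> words X" for u
  proof -
    have "word_eval K f ` cls u = {word_eval K f u}"
      using eq that by (auto simp: pres_class_def intro: pres_eq.refl)
    then show ?thesis by (simp add: h_def)
  qed
  then have "h \<in> hom F K"
    by (auto simp: hom_def cls_mult elim!: carrier_cases)
  with h show ?thesis by blast
qed

text \<open>Applied to the action of \<open>G\<close> on the symbols of the tensor square.  The union in the last clause is
  the shape in which \<open>qtensor_act\<close> extends a renaming from words to classes.\<close>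

lemma rename_hom:
  assumes f: "\<And>x. x \<in> X \<Longrightarrow> f x \<in> X"
    and rel: "\<And>l r. (l, r) \<in> R \<Longrightarrow> (wrename f l, wrename f r) \<in> R"
  obtains h where "h \<in> hom F F" "\<And>u. u \<in> words X \<Longrightarrow> h (cls u) = cls (wrename f u)"
    "\<And>u. u \<in> words X \<Longrightarrow> (\<Union>v\<in>cls u. cls (wrename f v)) = cls (wrename f u)"
proof -
  have words: "wrename f u \<in> words X" if "u \<in> words X" for u
    using that f by (rule words_wrename)
  have eval: "word_eval F (\<lambda>x. cls (gen (f x))) u = cls (wrename f u)" if "u \<in> words X" for u
    using eval_cls[OF words[OF that]] by (simp add: word_eval_wrename comp_def)
  have "word_evaluation F X (\<lambda>x. cls (gen (f x)))"
    by unfold_locales (simp add: f)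
  moreover have "word_eval F (\<lambda>x. cls (gen (f x))) l = word_eval F (\<lambda>x. cls (gen (f x))) r"
    if "(l, r) \<in> R" "l \<in> words X" "r \<in> words X" for l r
    using cls_rel[OF rel] that by (simp add: eval words)
  ultimately obtain h where h: "h \<in> hom F F"
    "\<And>u. u \<in> words X \<Longrightarrow> h (cls u) = word_eval F (\<lambda>x. cls (gen (f x))) u"
    using lift_exists[of F "\<lambda>x. cls (gen (f x))"] by auto
  have "(\<Union>v\<in>cls u. cls (wrename f v)) = cls (wrename f u)" if u: "u \<in> words X" for u
  proof -
    have "cls (wrename f v) = cls (wrename f u)" if "v \<in> cls u" for v
    proof -
      from that have "pres_eq X R u v" by (simp add: pres_class_def)
      then have v: "v \<in> words X" and "cls u = cls v"
        using pres_eq_words u by (blast, simp add: cls_eq_iff)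
      from v have "cls (wrename f v) = h (cls v)" by (simp add: h(2) eval)
      also have "\<dots> = cls (wrename f u)" using u by (simp add: h(2) eval flip: \<open>cls u = cls v\<close>)
      finally show ?thesis .
    qed
    moreover have "u \<in> cls u" using u by (simp add: pres_class_def pres_eq.refl)
    ultimately show ?thesis by blast
  qed
  with h show thesis by (intro that[of h]) (simp_all add: eval)
qed

end

section \<open>Normal forms in polycyclic presentations\<close>

lemma pc_word_Nil [simp]: "pc_word [] a = []"
  by (simp add: pc_word_def)

lemma pc_word_Cons: "pc_word (x # xs) a = wpow (gen x) (a x) @ pc_word xs a"
  by (simp add: pc_word_def)

lemma pc_word_append: "pc_word (xs @ ys) a = pc_word xs a @ pc_word ys a"
  by (simp add: pc_word_def)

lemma words_pc_word [simp]: "set xs \<subseteq> X \<Longrightarrow> pc_word xs a \<in> words X"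
  by (induction xs) (auto simp: pc_word_Cons)

lemma pc_word_cong: "(\<And>x. x \<in> set xs \<Longrightarrow> a x = b x) \<Longrightarrow> pc_word xs a = pc_word xs b"
  by (induction xs) (auto simp: pc_word_Cons)

lemma pc_word_map: "pc_word (map f xs) a = wrename f (pc_word xs (a \<circ> f))"
  by (induction xs) (auto simp: pc_word_Cons)

lemma wpow_0 [simp]: "wpow u 0 = []"
  by (simp add: wpow_def)

lemma wpow_1 [simp]: "wpow u 1 = u"
  by (simp add: wpow_def)

lemma pc_word_zero: "(\<And>x. x \<in> set xs \<Longrightarrow> a x = 0) \<Longrightarrow> pc_word xs a = []"
  by (induction xs) (auto simp: pc_word_Cons)

lemma pc_word_single:
  "distinct xs \<Longrightarrow> x \<in> set xs \<Longrightarrow> pc_word xs (\<lambda>z. if z = x then 1 else 0) = gen x"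
proof (induction xs)
  case (Cons y ys)
  then show ?case
    by (cases "y = x") (auto simp: pc_word_Cons intro: pc_word_zero)
qed simp

context group
begin

lemma gconj_int_pow_mem:
  assumes "subgroup K G" "y \<in> carrier G"
    and "\<And>k. k \<in> K \<Longrightarrow> gconj G k y \<in> K" "\<And>k. k \<in> K \<Longrightarrow> gconj G k (inv y) \<in> K" "k \<in> K"
  shows "gconj G k (y [^] (i::int)) \<in> K"
proof -
  have K: "k \<in> carrier G" if "k \<in> K" for k
    using that by (rule subgroup.mem_carrier[OF assms(1)])
  have *: "gconj G k (z [^] (n::nat)) \<in> K"
    if "z \<in> carrier G" "\<And>k. k \<in> K \<Longrightarrow> gconj G k z \<in> K" for z n
    using assms(5)
    by (induction n arbitrary: k) (auto simp: that K gconj_by_mult)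
  show ?thesis
    using *[of y] *[of "inv y"] assms(2-4)
    by (cases i rule: int_cases2) (auto simp: int_pow_int int_pow_neg_int nat_pow_inv)
qed

lemma cyclic_extension_subgroup:
  assumes "subgroup K G" "y \<in> carrier G"
    and "\<And>k. k \<in> K \<Longrightarrow> gconj G k y \<in> K" "\<And>k. k \<in> K \<Longrightarrow> gconj G k (inv y) \<in> K"
  shows "subgroup {y [^] (i::int) \<otimes> k |i k. k \<in> K} G" (is "subgroup ?L G")
proof -
  note conj = gconj_int_pow_mem[OF assms]
  have K: "k \<in> carrier G" if "k \<in> K" for k
    using that by (rule subgroup.mem_carrier[OF assms(1)])
  show ?thesis
  proof (rule subgroupI)
    show "?L \<subseteq> carrier G"
      using assms(2) K by auto
    show "?L \<noteq> {}"
      using subgroup.one_closed[OF assms(1)] by auto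
  next
    fix a assume "a \<in> ?L"
    then obtain i k where a: "a = y [^] (i::int) \<otimes> k" "k \<in> K" by blast
    have "inv a = y [^] (- i) \<otimes> gconj G (inv k) (y [^] (- i))"
      using a K assms(2) by (simp add: int_pow_neg free_reduction)
    moreover have "gconj G (inv k) (y [^] (- i)) \<in> K"
      using conj a assms(1) by (simp add: subgroup.m_inv_closed)
    ultimately show "inv a \<in> ?L" by blast
  next
    fix a b assume "a \<in> ?L" "b \<in> ?L"
    then obtain i k j l where ab: "a = y [^] (i::int) \<otimes> k" "k \<in> K" "b = y [^] (j::int) \<otimes> l" "l \<in> K"
      by blast
    have "a \<otimes> b = y [^] (i + j) \<otimes> (gconj G k (y [^] j) \<otimes> l)"
      using ab K assms(2) by (simp add: int_pow_mult free_reduction)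
    moreover have "gconj G k (y [^] j) \<otimes> l \<in> K"
      using ab conj assms(1) by (simp add: subgroup.m_closed)
    ultimately show "a \<otimes> b \<in> ?L" by blast
  qed
qed

end

definition nf_values where
  "nf_values H f I e xs =
    {word_eval H f (pc_word xs a) |a. \<forall>x\<in>I \<inter> set xs. 0 \<le> a x \<and> a x < int (e x)}"

context word_evaluation
begin

lemma eval_pc_word_Cons:
  "x \<in> X \<Longrightarrow> set xs \<subseteq> X \<Longrightarrow>
    word_eval H f (pc_word (x # xs) a) = f x [^] a x \<otimes> word_eval H f (pc_word xs a)"
  by (simp add: pc_word_Cons)

lemma nf_values_Cons:
  assumes K: "subgroup (nf_values H f I e xs) H" and x: "x \<in> X" "set xs \<subseteq> X" "x \<notin> set xs"
    and pow: "x \<in> I \<Longrightarrow> 0 < e x \<and> f x [^] e x \<in> nf_values H f I e xs"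
  shows "nf_values H f I e (x # xs) = {f x [^] (i::int) \<otimes> k |i k. k \<in> nf_values H f I e xs}"
proof (intro equalityI subsetI)
  fix h assume "h \<in> nf_values H f I e (x # xs)"
  then show "h \<in> {f x [^] (i::int) \<otimes> k |i k. k \<in> nf_values H f I e xs}"
    using x by (fastforce simp: nf_values_def eval_pc_word_Cons)
next
  have *: "f x [^] (i::int) \<otimes> k \<in> nf_values H f I e (x # xs)"
    if i: "x \<in> I \<longrightarrow> 0 \<le> i \<and> i < int (e x)" and "k \<in> nf_values H f I e xs" for i k
  proof -
    from that obtain a where
      "k = word_eval H f (pc_word xs a)" "\<forall>x\<in>I \<inter> set xs. 0 \<le> a x \<and> a x < int (e x)"
      by (auto simp: nf_values_def)
    moreover have "pc_word xs (a(x := i)) = pc_word xs a"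
      using x by (intro pc_word_cong) auto
    ultimately show ?thesis
      using x i unfolding nf_values_def
      by (intro CollectI exI[of _ "a(x := i)"]) (auto simp: eval_pc_word_Cons)
  qed
  fix h assume "h \<in> {f x [^] (i::int) \<otimes> k |i k. k \<in> nf_values H f I e xs}"
  then obtain i k where h: "h = f x [^] (i::int) \<otimes> k" "k \<in> nf_values H f I e xs" by blast
  show "h \<in> nf_values H f I e (x # xs)"
  proof (cases "x \<in> I")
    case True
    define m where "m = int (e x)"
    have m: "0 < m" using pow True by (simp add: m_def)
    \<comment> \<open>reduce the exponent of \<open>x\<close> modulo \<open>e x\<close> and move the quotient into the tail\<close>
    have "f x [^] i = f x [^] (i mod m) \<otimes> (f x [^] m) [^] (i div m)"
      using x by (simp add: int_pow_pow flip: int_pow_mult)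
    moreover have "(f x [^] m) [^] (i div m) \<otimes> k \<in> nf_values H f I e xs"
      using pow True h K
      by (simp add: m_def int_pow_int subgroup.m_closed subgroup_int_pow_closed)
    moreover have "k \<in> carrier H" using h(2) by (rule subgroup.mem_carrier[OF K])
    ultimately show ?thesis
      using *[of "i mod m" "(f x [^] m) [^] (i div m) \<otimes> k"] h x m
      by (simp add: m_assoc m_def)
  qed (use * h in auto)
qed

text \<open>By induction from the right: the values of the normal form words in the last generators form a
  subgroup that is normalised by the generator in front of them, so putting this generator in front
  gives a cyclic extension, whose elements are again values of normal form words.\<close>

lemma nf_values_subgroup:
  assumes "set xs \<subseteq> X" "distinct xs"
    and pow: "\<And>us y vs. xs = us @ y # vs \<Longrightarrow> y \<in> I \<Longrightarrow>
      0 < e y \<and> (\<exists>a. f y [^] e y = word_eval H f (pc_word vs a))"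
    and conj: "\<And>us y vs x. xs = us @ y # vs \<Longrightarrow> x \<in> set vs \<Longrightarrow>
      \<exists>a. gconj H (f x) (f y) = word_eval H f (pc_word vs a)"
    and conj_inv: "\<And>us y vs x. xs = us @ y # vs \<Longrightarrow> x \<in> set vs \<Longrightarrow> y \<notin> I \<Longrightarrow>
      \<exists>a. gconj H (f x) (inv (f y)) = word_eval H f (pc_word vs a)"
  shows "subgroup (nf_values H f I e xs) H \<and> f ` set xs \<subseteq> nf_values H f I e xs"
proof -
  have "subgroup (nf_values H f I e ws) H \<and> f ` set ws \<subseteq> nf_values H f I e ws"
    if "xs = us @ ws" for us ws
    using that
  proof (induction ws arbitrary: us)
    case Nil
    have "nf_values H f I e [] = {\<one>}" by (auto simp: nf_values_def)
    then show ?case using triv_subgroup by simp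
  next
    case (Cons y vs)
    let ?K = "nf_values H f I e vs"
    from Cons.IH[of "us @ [y]"] Cons.prems
    have K: "subgroup ?K H" and fK: "\<And>x. x \<in> set vs \<Longrightarrow> f x \<in> ?K" by auto
    from Cons.prems assms(1,2) have y: "y \<in> X" "set vs \<subseteq> X" "y \<notin> set vs" by auto
    have word: "word_eval H f (pc_word vs a) \<in> ?K" for a
      by (rule word_eval_in_subgroup[OF K, of _ "set vs"]) (auto simp: fK)
    have kc: "k \<in> carrier H" if "k \<in> ?K" for k
      using that by (rule subgroup.mem_carrier[OF K])
    have normal: "gconj H k z \<in> ?K"
      if "z \<in> carrier H" "\<And>x. x \<in> set vs \<Longrightarrow> gconj H (f x) z \<in> ?K" "k \<in> ?K" for z k
    proof -
      from \<open>k \<in> ?K\<close> obtain a where a: "k = word_eval H f (pc_word vs a)"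
        by (auto simp: nf_values_def)
      interpret vs: word_evaluation H "set vs" f using y by unfold_locales auto
      have "gconj H k z = word_eval H ((\<lambda>k. gconj H k z) \<circ> f) (pc_word vs a)"
        unfolding a using that(1)
        by (intro hom_word_eval[OF vs.word_evaluation_axioms]) (auto simp: gconj_hom)
      also have "\<dots> \<in> ?K"
        by (rule word_eval_in_subgroup[OF K, of _ "set vs"]) (auto simp: that)
      finally show ?thesis .
    qed
    have normal_y: "gconj H k (f y) \<in> ?K" if "k \<in> ?K" for k
    proof (rule normal)
      show "gconj H (f x) (f y) \<in> ?K" if "x \<in> set vs" for x
        using conj[OF Cons.prems that] word by auto
    qed (use that y in auto)
    have pow_K: "0 < e y \<and> f y [^] e y \<in> ?K" if "y \<in> I"
      using pow[OF Cons.prems that] word by auto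
    have normal_inv_y: "gconj H k (inv (f y)) \<in> ?K" if "k \<in> ?K" for k
    proof (cases "y \<in> I")
      case True
      \<comment> \<open>\<open>f y\<inverse> = f y^(e y - 1) (f y^(e y))\<inverse>\<close>, and the last factor lies in the subgroup\<close>
      then obtain n where n: "e y = Suc n" using pow_K by (cases "e y") auto
      have "gconj H k (f y [^] n) \<in> ?K" for n :: nat
        using that by (induction n) (auto simp: normal_y kc y gconj_by_mult)
      then have "gconj H (gconj H k (f y [^] n)) (inv (f y [^] e y)) \<in> ?K"
        using pow_K[OF True] K
        unfolding gconj_def[of H "gconj H k (f y [^] n)"]
        by (simp add: subgroup.m_closed subgroup.m_inv_closed kc)
      moreover have "inv (f y) = f y [^] n \<otimes> inv (f y [^] e y)"
        using y unfolding n nat_pow_Suc2[OF gen_value_closed[OF y(1)]]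
        by (simp add: inv_mult_group)
      ultimately show ?thesis
        using y that by (simp add: gconj_by_mult kc)
    next
      case False
      show ?thesis
      proof (rule normal)
        show "gconj H (f x) (inv (f y)) \<in> ?K" if "x \<in> set vs" for x
          using conj_inv[OF Cons.prems that False] word by auto
      qed (use that y in auto)
    qed
    let ?L = "{f y [^] (i::int) \<otimes> k |i k. k \<in> ?K}"
    have eq: "nf_values H f I e (y # vs) = ?L"
      by (rule nf_values_Cons[OF K y pow_K])
    have "subgroup ?L H"
      using normal_y normal_inv_y y by (intro cyclic_extension_subgroup[OF K]) auto
    moreover have "f y \<in> ?L"
      using subgroup.one_closed[OF K] y by (intro CollectI exI[of _ 1] exI[of _ \<one>]) simp
    moreover have "f x \<in> ?L" if "x \<in> set vs" for x
      using fK[OF that] y that kc by (intro CollectI exI[of _ 0] exI[of _ "f x"]) simp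
    ultimately show ?case unfolding eq by auto
  qed
  from this[of "[]" xs] show ?thesis by simp
qed

end

lemma pc_presentation_relations:
  assumes "is_pc_presentation P"
  obtains \<alpha> \<beta> \<gamma> where "pc_rels P =
        {(wpow (gen x) (int (pc_exp P x)), pc_word vs (\<alpha> x)) |us x vs.
            pc_gens P = us @ x # vs \<and> x \<in> pc_index P} \<union>
        {(winv (gen y) @ gen x @ gen y, pc_word vs (\<beta> x y)) |us y vs x.
            pc_gens P = us @ y # vs \<and> x \<in> set vs} \<union>
        {(gen y @ gen x @ winv (gen y), pc_word vs (\<gamma> x y)) |us y vs x.
            pc_gens P = us @ y # vs \<and> x \<in> set vs \<and> y \<notin> pc_index P}"
  using assms unfolding is_pc_presentation_def by (elim conjE exE) (rule that)

lemma is_pc_presentation_words: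
  assumes "is_pc_presentation P" "(l, r) \<in> pc_rels P"
  shows "l \<in> words (set (pc_gens P))" and "r \<in> words (set (pc_gens P))"
proof -
  from assms(1) obtain \<alpha> \<beta> \<gamma> where "pc_rels P =
        {(wpow (gen x) (int (pc_exp P x)), pc_word vs (\<alpha> x)) |us x vs.
            pc_gens P = us @ x # vs \<and> x \<in> pc_index P} \<union>
        {(winv (gen y) @ gen x @ gen y, pc_word vs (\<beta> x y)) |us y vs x.
            pc_gens P = us @ y # vs \<and> x \<in> set vs} \<union>
        {(gen y @ gen x @ winv (gen y), pc_word vs (\<gamma> x y)) |us y vs x.
            pc_gens P = us @ y # vs \<and> x \<in> set vs \<and> y \<notin> pc_index P}"
    by (rule pc_presentation_relations)
  note rel = assms(2)[unfolded this]
  have "l \<in> words (set (pc_gens P)) \<and> r \<in> words (set (pc_gens P))"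
    using rel by (elim UnE CollectE exE conjE) (auto intro!: words_pc_word)
  then show "l \<in> words (set (pc_gens P))" "r \<in> words (set (pc_gens P))" by auto
qed

text \<open>Consistency of a polycyclic presentation is only a matter of uniqueness: the relations alone allow
  every word to be collected into a normal form word.\<close>

lemma pc_group_normal_form_exists:
  assumes P: "is_pc_presentation P" and A: "A \<in> carrier (pc_group P)"
  obtains a where "a \<in> nf_exponents P" "A = pc_class P (pc_word (pc_gens P) a)"
proof -
  interpret presentation "set (pc_gens P)" "pc_rels P" .
  let ?X = "set (pc_gens P)" and ?f = "\<lambda>x. cls (gen x)"
  from P have P': "distinct (pc_gens P)" "pc_index P \<subseteq> ?X" "\<And>x. x \<in> pc_index P \<Longrightarrow> 0 < pc_exp P x"
    by (simp_all add: is_pc_presentation_def)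
  from P obtain \<alpha> \<beta> \<gamma> where rels: "pc_rels P =
        {(wpow (gen x) (int (pc_exp P x)), pc_word vs (\<alpha> x)) |us x vs.
            pc_gens P = us @ x # vs \<and> x \<in> pc_index P} \<union>
        {(winv (gen y) @ gen x @ gen y, pc_word vs (\<beta> x y)) |us y vs x.
            pc_gens P = us @ y # vs \<and> x \<in> set vs} \<union>
        {(gen y @ gen x @ winv (gen y), pc_word vs (\<gamma> x y)) |us y vs x.
            pc_gens P = us @ y # vs \<and> x \<in> set vs \<and> y \<notin> pc_index P}"
    by (rule pc_presentation_relations)
  have eval_rel': "word_eval F ?f l = word_eval F ?f r" if "(l, r) \<in> pc_rels P" for l r
    using eval_rel is_pc_presentation_words[OF P that] that by blast
  have sub: "subgroup (nf_values F ?f (pc_index P) (pc_exp P) (pc_gens P)) F \<and>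
    ?f ` ?X \<subseteq> nf_values F ?f (pc_index P) (pc_exp P) (pc_gens P)"
  proof (rule nf_values_subgroup)
    fix us y vs assume us: "pc_gens P = us @ y # vs"
    then have X: "y \<in> ?X" "set vs \<subseteq> ?X" by auto
    { assume "y \<in> pc_index P"
      then have "(wpow (gen y) (int (pc_exp P y)), pc_word vs (\<alpha> y)) \<in> pc_rels P"
        using us unfolding rels by blast
      from eval_rel'[OF this] show "0 < pc_exp P y \<and>
          (\<exists>a. ?f y [^]\<^bsub>F\<^esub> pc_exp P y = word_eval F ?f (pc_word vs a))"
        using X \<open>y \<in> pc_index P\<close> P' by (auto simp: int_pow_int) }
    fix x assume x: "x \<in> set vs"
    with X have "x \<in> ?X" by blast
    have "(winv (gen y) @ gen x @ gen y, pc_word vs (\<beta> x y)) \<in> pc_rels P"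
      using us x unfolding rels by blast
    from eval_rel'[OF this]
    show "\<exists>a. gconj F (?f x) (?f y) = word_eval F ?f (pc_word vs a)"
      using X \<open>x \<in> ?X\<close> by (intro exI[of _ "\<beta> x y"]) (simp add: gconj_def m_assoc)
    assume "y \<notin> pc_index P"
    then have "(gen y @ gen x @ winv (gen y), pc_word vs (\<gamma> x y)) \<in> pc_rels P"
      using us x unfolding rels by blast
    from eval_rel'[OF this]
    show "\<exists>a. gconj F (?f x) (inv\<^bsub>F\<^esub> ?f y) = word_eval F ?f (pc_word vs a)"
      using X \<open>x \<in> ?X\<close> by (intro exI[of _ "\<gamma> x y"]) (simp add: gconj_def m_assoc)
  qed (use P' in auto)
  from A obtain u where u: "u \<in> words ?X" "A = cls u"
    unfolding pc_group_def by (rule carrier_cases)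
  have "A = word_eval F ?f u" using u by (simp add: eval_cls)
  also have "\<dots> \<in> nf_values F ?f (pc_index P) (pc_exp P) (pc_gens P)"
    using sub u by (intro word_eval_in_subgroup[of _ _ ?X]) auto
  finally obtain a where a: "A = word_eval F ?f (pc_word (pc_gens P) a)"
    "\<forall>x\<in>pc_index P \<inter> ?X. 0 \<le> a x \<and> a x < int (pc_exp P x)"
    by (auto simp: nf_values_def)
  let ?a = "\<lambda>x. if x \<in> ?X then a x else 0"
  have "?a \<in> nf_exponents P" using a P' by (auto simp: nf_exponents_def)
  moreover have "A = pc_class P (pc_word (pc_gens P) a)"
    using a by (simp add: eval_cls pc_class_def)
  then have "A = pc_class P (pc_word (pc_gens P) ?a)"
    by (simp cong: pc_word_cong)
  ultimately show thesis using that by blast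
qed

text \<open>The facts below transport the properties of \<open>pc_group P\<close> to the group that \<open>P\<close> presents, so that
  only evaluation of words in that group is used later.\<close>

locale consistently_presented = group H for H (structure) +
  fixes P :: "'x pc_presentation" and f :: "'x \<Rightarrow> 'a"
  assumes consistent: "consistent_pc_presentation P" and presents: "presents P H f"
begin

lemma pc: "is_pc_presentation P"
  using consistent by (simp add: consistent_pc_presentation_def)

lemma evaluation_iso:
  obtains \<theta> where "\<theta> \<in> iso (pc_group P) H"
    "\<And>u. u \<in> words (set (pc_gens P)) \<Longrightarrow> \<theta> (pc_class P u) = word_eval H f u"
proof -
  interpret P: presentation "set (pc_gens P)" "pc_rels P" .
  from presents obtain \<theta> where \<theta>: "\<theta> \<in> iso P.F H"
    "\<And>x. x \<in> set (pc_gens P) \<Longrightarrow> \<theta> (P.cls (gen x)) = f x"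
    unfolding presents_def pc_group_def pc_class_def by blast
  have "\<theta> (P.cls u) = word_eval H f u" if "u \<in> words (set (pc_gens P))" for u
  proof -
    have "\<theta> (P.cls u) = word_eval H (\<lambda>x. \<theta> (P.cls (gen x))) u"
      using \<theta>(1) that by (simp add: P.hom_cls iso_def)
    also have "\<dots> = word_eval H f u" using that \<theta>(2) by (rule word_eval_cong)
    finally show ?thesis .
  qed
  with \<theta>(1) that show thesis by (simp add: pc_group_def pc_class_def)
qed

sublocale word_evaluation H "set (pc_gens P)" f
proof
  interpret P: presentation "set (pc_gens P)" "pc_rels P" .
  from presents obtain \<theta> where \<theta>: "\<theta> \<in> iso P.F H"
    "\<And>x. x \<in> set (pc_gens P) \<Longrightarrow> \<theta> (P.cls (gen x)) = f x"
    unfolding presents_def pc_group_def pc_class_def by blast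
  fix x assume x: "x \<in> set (pc_gens P)"
  then have "\<theta> (P.cls (gen x)) \<in> carrier H"
    using \<theta>(1) by (auto simp: iso_def intro: hom_in_carrier)
  with x \<theta>(2) show "f x \<in> carrier H" by simp
qed

lemma relation_holds:
  assumes "(l, r) \<in> pc_rels P"
  shows "word_eval H f l = word_eval H f r"
proof -
  interpret P: presentation "set (pc_gens P)" "pc_rels P" .
  note w = is_pc_presentation_words[OF pc assms]
  obtain \<theta> where \<theta>: "\<And>u. u \<in> words (set (pc_gens P)) \<Longrightarrow> \<theta> (pc_class P u) = word_eval H f u"
    using evaluation_iso by blast
  have "pc_class P l = pc_class P r"
    using P.cls_rel[OF assms w] by (simp add: pc_class_def)
  with \<theta> w show ?thesis by metis
qed

lemma eval_surj:
  assumes "v \<in> carrier H" obtains u where "u \<in> words (set (pc_gens P))" "word_eval H f u = v"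
proof -
  interpret P: presentation "set (pc_gens P)" "pc_rels P" .
  obtain \<theta> where \<theta>: "\<theta> \<in> iso (pc_group P) H"
    "\<And>u. u \<in> words (set (pc_gens P)) \<Longrightarrow> \<theta> (pc_class P u) = word_eval H f u"
    using evaluation_iso by blast
  have "v \<in> \<theta> ` carrier (pc_group P)"
    using \<theta>(1) assms by (simp add: iso_def bij_betw_def)
  then obtain A where "A \<in> carrier (pc_group P)" "\<theta> A = v" by blast
  then show thesis
    using \<theta>(2) that by (metis P.carrier_cases pc_class_def pc_group_def)
qed

lemma normal_form_unique:
  assumes "v \<in> carrier H"
  shows "\<exists>!a. a \<in> nf_exponents P \<and> word_eval H f (pc_word (pc_gens P) a) = v"
proof -
  interpret P: presentation "set (pc_gens P)" "pc_rels P" .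
  obtain \<theta> where \<theta>: "\<theta> \<in> iso (pc_group P) H"
    "\<And>u. u \<in> words (set (pc_gens P)) \<Longrightarrow> \<theta> (pc_class P u) = word_eval H f u"
    using evaluation_iso by blast
  then have inj: "inj_on \<theta> (carrier (pc_group P))" by (simp add: iso_def bij_betw_def)
  have "v \<in> \<theta> ` carrier (pc_group P)"
    using \<theta>(1) assms by (simp add: iso_def bij_betw_def)
  then obtain A where A: "A \<in> carrier (pc_group P)" "\<theta> A = v" by blast
  have "word_eval H f (pc_word (pc_gens P) a) = v \<longleftrightarrow> A = pc_class P (pc_word (pc_gens P) a)" for a
  proof -
    have "pc_class P (pc_word (pc_gens P) a) \<in> carrier (pc_group P)"
      by (simp add: pc_class_def pc_group_def)
    from inj_on_eq_iff[OF inj A(1) this] show ?thesis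
      using A(2) \<theta>(2)[of "pc_word (pc_gens P) a"] by force
  qed
  with consistent A(1) show ?thesis
    by (simp add: consistent_pc_presentation_def)
qed

lemma eval_nf_word:
  assumes "v \<in> carrier H" shows "word_eval H f (nf_word P H f v) = v"
  using theI'[OF normal_form_unique[OF assms]] by (simp add: nf_word_def)

lemma words_nf_word [simp]: "nf_word P H f v \<in> words (set (pc_gens P))"
  by (simp add: nf_word_def)

lemma nf_exponents_eqI:
  assumes "a \<in> nf_exponents P" "b \<in> nf_exponents P"
    and "word_eval H f (pc_word (pc_gens P) a) = word_eval H f (pc_word (pc_gens P) b)"
  shows "a = b"
  using normal_form_unique[of "word_eval H f (pc_word (pc_gens P) a)"] assms by auto

end

section \<open>Equivariant pairings\<close>

text \<open>The symbols \<open>p g h\<close> behave like \<open>g \<otimes> h\<close> in a nonabelian tensor square: the two expansion rules are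
  those satisfied by the commutators \<open>[g, h]\<close>.\<close>

locale equivariant_pairing = G: group G + M: group M
  for G :: "('a, 'b) monoid_scheme" (structure) and M :: "('m, 'n) monoid_scheme" +
  fixes act :: "'a \<Rightarrow> 'm \<Rightarrow> 'm" and p :: "'a \<Rightarrow> 'a \<Rightarrow> 'm"
  assumes act_hom: "x \<in> carrier G \<Longrightarrow> act x \<in> hom M M"
    and act_by_mult: "\<lbrakk>x \<in> carrier G; y \<in> carrier G; m \<in> carrier M\<rbrakk> \<Longrightarrow>
      act (x \<otimes> y) m = act y (act x m)"
    and act_by_one [simp]: "m \<in> carrier M \<Longrightarrow> act \<one> m = m"
    and pairing_closed [simp]: "\<lbrakk>g \<in> carrier G; h \<in> carrier G\<rbrakk> \<Longrightarrow> p g h \<in> carrier M"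
    and act_pairing: "\<lbrakk>x \<in> carrier G; g \<in> carrier G; h \<in> carrier G\<rbrakk> \<Longrightarrow>
      act x (p g h) = p (gconj G g x) (gconj G h x)"
    and pairing_mult_right: "\<lbrakk>g \<in> carrier G; h \<in> carrier G; h1 \<in> carrier G\<rbrakk> \<Longrightarrow>
      p g (h \<otimes> h1) = p g h1 \<otimes>\<^bsub>M\<^esub> act h1 (p g h)"
    and pairing_mult_left: "\<lbrakk>g \<in> carrier G; g1 \<in> carrier G; h \<in> carrier G\<rbrakk> \<Longrightarrow>
      p (g \<otimes> g1) h = act g1 (p g h) \<otimes>\<^bsub>M\<^esub> p g1 h"
begin

lemma act_group_hom: "x \<in> carrier G \<Longrightarrow> group_hom M M (act x)"
  by (simp add: M.is_group act_hom group_hom_axioms.intro group_hom_def)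

lemma act_closed [simp]: "\<lbrakk>x \<in> carrier G; m \<in> carrier M\<rbrakk> \<Longrightarrow> act x m \<in> carrier M"
  by (rule hom_in_carrier[OF act_hom])

lemma act_mult:
  "\<lbrakk>x \<in> carrier G; m \<in> carrier M; n \<in> carrier M\<rbrakk> \<Longrightarrow>
    act x (m \<otimes>\<^bsub>M\<^esub> n) = act x m \<otimes>\<^bsub>M\<^esub> act x n"
  by (simp add: act_hom hom_mult)

lemma act_one [simp]: "x \<in> carrier G \<Longrightarrow> act x \<one>\<^bsub>M\<^esub> = \<one>\<^bsub>M\<^esub>"
  by (rule group_hom.hom_one[OF act_group_hom])

lemma act_inv: "\<lbrakk>x \<in> carrier G; m \<in> carrier M\<rbrakk> \<Longrightarrow> act x (inv\<^bsub>M\<^esub> m) = inv\<^bsub>M\<^esub> act x m"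
  by (rule group_hom.hom_inv[OF act_group_hom])

lemma act_gconj:
  "\<lbrakk>x \<in> carrier G; m \<in> carrier M; n \<in> carrier M\<rbrakk> \<Longrightarrow>
    act x (gconj M m n) = gconj M (act x m) (act x n)"
  by (simp add: gconj_def act_mult act_inv)

lemma act_inv_cancel [simp]:
  assumes "x \<in> carrier G" "m \<in> carrier M"
  shows "act (inv x) (act x m) = m" "act x (act (inv x) m) = m"
  using assms by (simp_all flip: act_by_mult)

lemma pairing_one_right [simp]: "k \<in> carrier G \<Longrightarrow> p k \<one> = \<one>\<^bsub>M\<^esub>"
  using pairing_mult_right[of k \<one> \<one>] by simp

lemma pairing_one_left [simp]: "k \<in> carrier G \<Longrightarrow> p \<one> k = \<one>\<^bsub>M\<^esub>"
  using pairing_mult_left[of \<one> \<one> k] by simp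

lemma pairing_inv_right:
  assumes "k \<in> carrier G" "x \<in> carrier G"
  shows "p k (inv x) = inv\<^bsub>M\<^esub> act (inv x) (p k x)"
proof -
  have "p k (inv x) \<otimes>\<^bsub>M\<^esub> act (inv x) (p k x) = p k (x \<otimes> inv x)"
    using assms by (subst pairing_mult_right) auto
  then show ?thesis using assms by (intro M.inv_equality[symmetric]) auto
qed

text \<open>Expand \<open>p (g g1) (h h1)\<close> once in the first argument and then in the second, and once the other
  way round: the outer factors agree and cancel, the inner ones give the identity.\<close>

lemma pairing_exchange:
  assumes "g \<in> carrier G" "g1 \<in> carrier G" "h \<in> carrier G" "h1 \<in> carrier G"
  shows "act (h1 \<otimes> g1) (p g h) \<otimes>\<^bsub>M\<^esub> p g1 h1 = p g1 h1 \<otimes>\<^bsub>M\<^esub> act (g1 \<otimes> h1) (p g h)"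
proof -
  let ?l = "act g1 (p g h1)" and ?r = "act h1 (p g1 h)"
  have "act g1 (p g (h \<otimes> h1)) \<otimes>\<^bsub>M\<^esub> p g1 (h \<otimes> h1) = p (g \<otimes> g1) (h \<otimes> h1)"
    using assms by (simp only: pairing_mult_left G.m_closed)
  also have "\<dots> = p (g \<otimes> g1) h1 \<otimes>\<^bsub>M\<^esub> act h1 (p (g \<otimes> g1) h)"
    using assms by (simp only: pairing_mult_right G.m_closed)
  finally have "?l \<otimes>\<^bsub>M\<^esub> ((act (h1 \<otimes> g1) (p g h) \<otimes>\<^bsub>M\<^esub> p g1 h1) \<otimes>\<^bsub>M\<^esub> ?r)
      = ?l \<otimes>\<^bsub>M\<^esub> ((p g1 h1 \<otimes>\<^bsub>M\<^esub> act (g1 \<otimes> h1) (p g h)) \<otimes>\<^bsub>M\<^esub> ?r)"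
    using assms
    by (simp add: pairing_mult_right pairing_mult_left act_mult act_by_mult M.m_assoc)
  then show ?thesis using assms by simp
qed

text \<open>This is \<open>pairing_exchange\<close> for the conjugates \<open>a', b'\<close> of \<open>a, b\<close> that \<open>h g\<close> sends back to
  \<open>a, b\<close>, since \<open>g h = h g [g, h]\<close>.\<close>

lemma act_gcomm_pairing:
  assumes "g \<in> carrier G" "h \<in> carrier G" "a \<in> carrier G" "b \<in> carrier G"
  shows "act (gcomm G g h) (p a b) = gconj M (p a b) (p g h)"
proof -
  define x where "x = h \<otimes> g"
  have x: "x \<in> carrier G" using assms by (simp add: x_def)
  define a' b' where "a' = gconj G a (inv x)" and "b' = gconj G b (inv x)"
  have a': "a' \<in> carrier G" "b' \<in> carrier G" using assms x by (simp_all add: a'_def b'_def)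
  have ab: "p a b = act x (p a' b')"
    using assms x by (simp add: act_pairing a'_def b'_def)
  have "g \<otimes> h = x \<otimes> gcomm G g h" using assms by (simp add: x_def G.free_reduction)
  then have "act (g \<otimes> h) (p a' b') = act (gcomm G g h) (p a b)"
    using assms x a' ab by (simp add: act_by_mult)
  then have "p a b \<otimes>\<^bsub>M\<^esub> p g h = p g h \<otimes>\<^bsub>M\<^esub> act (gcomm G g h) (p a b)"
    using pairing_exchange[of a' g b' h] assms x a' by (simp add: x_def[symmetric] ab[symmetric])
  then show ?thesis using assms by (simp add: gconj_def M.m_assoc)
qed

text \<open>Under the map sending \<open>p g h\<close> to \<open>[g, h]\<close> this becomes \<open>[k, c] = (c\<inverse>)\<^sup>k c\<close> for \<open>c = [g, h]\<close>.  Writing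
  \<open>[g, h] = (h\<^sup>g)\<inverse> h\<close> reduces it to an expansion of \<open>p (g k) h\<close>.\<close>

lemma pairing_gcomm_right:
  assumes "k \<in> carrier G" "g \<in> carrier G" "h \<in> carrier G"
  shows "p k (gcomm G g h) = inv\<^bsub>M\<^esub> act k (p g h) \<otimes>\<^bsub>M\<^esub> p g h"
proof -
  let ?t = "p g h" and ?u = "p k (gconj G h g)"
  have u: "act (gcomm G g h) ?u = gconj M ?u ?t"
    using assms by (simp add: act_gcomm_pairing)
  have "p k (inv (gconj G h g) \<otimes> h) = p k h \<otimes>\<^bsub>M\<^esub> inv\<^bsub>M\<^esub> act (inv (gconj G h g) \<otimes> h) ?u"
    using assms by (simp add: pairing_mult_right pairing_inv_right act_inv act_by_mult)
  moreover have "inv (gconj G h g) \<otimes> h = gcomm G g h"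
    using assms by (simp add: G.free_reduction)
  ultimately have "p k (gcomm G g h) = p k h \<otimes>\<^bsub>M\<^esub> inv\<^bsub>M\<^esub> act (gcomm G g h) ?u"
    by (simp only:)
  \<comment> \<open>expand \<open>p (g k) h\<close>, where \<open>g k = k\<^sup>x g\<close> for \<open>x = g\<inverse>\<close>\<close>
  moreover have "act k ?t \<otimes>\<^bsub>M\<^esub> p k h = ?u \<otimes>\<^bsub>M\<^esub> ?t"
  proof -
    have "g \<otimes> k = gconj G k (inv g) \<otimes> g" using assms by (simp add: G.free_reduction)
    then have "act k ?t \<otimes>\<^bsub>M\<^esub> p k h = p (gconj G k (inv g) \<otimes> g) h"
      using assms pairing_mult_left[of g k h] by simp
    also have "\<dots> = ?u \<otimes>\<^bsub>M\<^esub> ?t"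
      using assms by (simp add: pairing_mult_left act_pairing)
    finally show ?thesis .
  qed
  then have "p k h = inv\<^bsub>M\<^esub> act k ?t \<otimes>\<^bsub>M\<^esub> (?u \<otimes>\<^bsub>M\<^esub> ?t)"
    using assms by (metis M.cancel_left(1) act_closed pairing_closed)
  ultimately show ?thesis
    unfolding u using assms by (simp add: gconj_def M.inv_mult_group M.m_assoc)
qed

definition pairing_span :: "'m set" where
  "pairing_span = generate M {p a b |a b. a \<in> carrier G \<and> b \<in> carrier G}"

lemma pairing_span_subgroup: "subgroup pairing_span M"
  unfolding pairing_span_def by (rule M.generate_is_subgroup) auto

lemma pairing_span_carrier [simp]: "n \<in> pairing_span \<Longrightarrow> n \<in> carrier M"
  by (rule subgroup.mem_carrier[OF pairing_span_subgroup])

lemma pairing_in_span [simp]: "a \<in> carrier G \<Longrightarrow> b \<in> carrier G \<Longrightarrow> p a b \<in> pairing_span"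
  by (auto simp: pairing_span_def intro: generate.incl)

lemma act_span [simp]:
  assumes "x \<in> carrier G" "n \<in> pairing_span" shows "act x n \<in> pairing_span"
proof -
  let ?S = "{p a b |a b. a \<in> carrier G \<and> b \<in> carrier G}"
  have S: "act x h \<in> ?S" "h \<in> carrier M" if "h \<in> ?S" for h
    using that assms(1) by (auto simp: act_pairing) (metis G.gconj_closed)
  show ?thesis
    using assms(2) unfolding pairing_span_def
  proof (induction n rule: generate.induct)
    case (incl h)
    then show ?case by (rule generate.incl[OF S(1)])
  next
    case (inv h)
    then show ?case
      using generate.inv[OF S(1), of h M] S(2)[of h] assms(1) by (simp add: act_inv)
  next
    case (eng h1 h2)
    then show ?case
      using assms(1) generate.eng[of "act x h1" M ?S "act x h2"]
      by (simp add: act_mult flip: pairing_span_def)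
  qed (use assms(1) in \<open>simp add: generate.one\<close>)
qed

text \<open>Think of a boundary map sending \<open>p g h\<close> to \<open>[g, h]\<close>, and of \<open>s\<close> as a product of pairing values
  with boundary \<open>c\<close>.  Such \<open>s\<close> and \<open>c\<close> have the two properties listed here, which are inherited by
  products and inverses.\<close>

definition lies_over :: "'m \<Rightarrow> 'a \<Rightarrow> bool" where
  "lies_over s c \<longleftrightarrow> s \<in> pairing_span \<and> c \<in> carrier G \<and>
     (\<forall>n\<in>pairing_span. act c n = gconj M n s) \<and>
     (\<forall>k\<in>carrier G. p k c = inv\<^bsub>M\<^esub> act k s \<otimes>\<^bsub>M\<^esub> s)"

lemma pairing_lies_over:
  assumes "g \<in> carrier G" "h \<in> carrier G" shows "lies_over (p g h) (gcomm G g h)"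
proof -
  have "act (gcomm G g h) n = gconj M n (p g h)" if "n \<in> pairing_span" for n
    using that unfolding pairing_span_def
  proof (induction n rule: generate.induct)
    case (eng h1 h2)
    then show ?case
      using assms by (simp add: act_mult M.gconj_mult flip: pairing_span_def)
  qed (use assms in \<open>auto simp: act_inv M.gconj_inv act_gcomm_pairing\<close>)
  then show ?thesis
    using assms by (simp add: lies_over_def pairing_gcomm_right)
qed

lemma lies_over_one: "lies_over \<one>\<^bsub>M\<^esub> \<one>"
  by (simp add: lies_over_def subgroup.one_closed[OF pairing_span_subgroup])

lemma lies_over_mult:
  assumes "lies_over s c" "lies_over s' c'" shows "lies_over (s \<otimes>\<^bsub>M\<^esub> s') (c \<otimes> c')"
proof -
  note sub = subgroup.m_closed[OF pairing_span_subgroup]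
  from assms have cs: "c \<in> carrier G" "c' \<in> carrier G" "s \<in> pairing_span" "s' \<in> pairing_span"
    and act: "\<And>n. n \<in> pairing_span \<Longrightarrow> act c n = gconj M n s"
      "\<And>n. n \<in> pairing_span \<Longrightarrow> act c' n = gconj M n s'"
    and p: "\<And>k. k \<in> carrier G \<Longrightarrow> p k c = inv\<^bsub>M\<^esub> act k s \<otimes>\<^bsub>M\<^esub> s"
      "\<And>k. k \<in> carrier G \<Longrightarrow> p k c' = inv\<^bsub>M\<^esub> act k s' \<otimes>\<^bsub>M\<^esub> s'"
    by (auto simp: lies_over_def)
  have "act (c \<otimes> c') n = gconj M n (s \<otimes>\<^bsub>M\<^esub> s')" if n: "n \<in> pairing_span" for n
  proof -
    have "act (c \<otimes> c') n = act c' (gconj M n s)"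
      using n cs by (simp add: act_by_mult act)
    also have "\<dots> = gconj M (gconj M n s') (gconj M s s')"
      using n cs by (simp add: act_gconj act(2))
    finally show ?thesis using n cs by (simp add: M.free_reduction)
  qed
  moreover have "p k (c \<otimes> c') = inv\<^bsub>M\<^esub> act k (s \<otimes>\<^bsub>M\<^esub> s') \<otimes>\<^bsub>M\<^esub> (s \<otimes>\<^bsub>M\<^esub> s')"
    if k: "k \<in> carrier G" for k
  proof -
    have "p k (c \<otimes> c') = p k c' \<otimes>\<^bsub>M\<^esub> gconj M (p k c) s'"
      using k cs by (simp add: pairing_mult_right act(2))
    then show ?thesis
      using k cs by (simp add: p act_mult M.free_reduction)
  qed
  ultimately show ?thesis using cs by (simp add: lies_over_def sub)
qed

lemma lies_over_inv:
  assumes "lies_over s c" shows "lies_over (inv\<^bsub>M\<^esub> s) (inv c)"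
proof -
  note sub = subgroup.m_inv_closed[OF pairing_span_subgroup]
  from assms have cs: "c \<in> carrier G" "s \<in> pairing_span"
    and act: "\<And>n. n \<in> pairing_span \<Longrightarrow> act c n = gconj M n s"
    and p: "\<And>k. k \<in> carrier G \<Longrightarrow> p k c = inv\<^bsub>M\<^esub> act k s \<otimes>\<^bsub>M\<^esub> s"
    by (auto simp: lies_over_def)
  have act': "act (inv c) n = gconj M n (inv\<^bsub>M\<^esub> s)" if n: "n \<in> pairing_span" for n
  proof -
    have "gconj M (act (inv c) n) s = n"
      using act[of "act (inv c) n"] n cs by simp
    then have "gconj M (gconj M (act (inv c) n) s) (inv\<^bsub>M\<^esub> s) = gconj M n (inv\<^bsub>M\<^esub> s)" by simp
    then show ?thesis using n cs by (simp flip: M.gconj_by_mult)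
  qed
  moreover have "p k (inv c) = inv\<^bsub>M\<^esub> act k (inv\<^bsub>M\<^esub> s) \<otimes>\<^bsub>M\<^esub> inv\<^bsub>M\<^esub> s" if k: "k \<in> carrier G" for k
  proof -
    have "p k (inv c) = inv\<^bsub>M\<^esub> gconj M (p k c) (inv\<^bsub>M\<^esub> s)"
      using k cs by (simp add: pairing_inv_right act')
    then show ?thesis
      using k cs by (simp add: p act_inv M.free_reduction)
  qed
  ultimately show ?thesis using cs by (simp add: lies_over_def sub)
qed

lemma lies_over_pow: "lies_over s c \<Longrightarrow> lies_over (s [^]\<^bsub>M\<^esub> (n::nat)) (c [^] n)"
  by (induction n) (simp_all add: lies_over_one lies_over_mult)

lemma pairing_inv_pow_right:
  assumes "lies_over s c" "k \<in> carrier G"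
  shows "p k (inv (c [^] (n::nat))) = act k (s [^]\<^bsub>M\<^esub> n) \<otimes>\<^bsub>M\<^esub> inv\<^bsub>M\<^esub> (s [^]\<^bsub>M\<^esub> n)"
proof -
  from assms have "s \<in> carrier M" by (simp add: lies_over_def)
  then show ?thesis
    using lies_over_inv[OF lies_over_pow[OF assms(1)], of n] assms(2)
    by (simp add: lies_over_def act_inv)
qed

text \<open>The \<open>i\<close>-th factor is \<open>act (k^(q-i)) (s^i)\<close> times the inverse of \<open>act (k^(q-1-i)) (s^i)\<close>, so the
  product of two consecutive factors telescopes up to one factor \<open>act (k^(q-1-i)) s\<close>.  What remains is
  the product of the \<open>act (k^i) s\<close> for \<open>i = q-1, \<dots>, 0\<close>, which is the expansion of \<open>p (k^q) d\<close>.\<close>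

lemma pairing_pow_left:
  assumes k: "k \<in> carrier G" and d: "d \<in> carrier G" and "1 \<le> q"
  defines "s \<equiv> p k d"
  shows "list_prod M (map (\<lambda>i. act (k [^] (q - 1 - i)) (p k (inv (gcomm G k d [^] i)))) [1..<q])
    \<otimes>\<^bsub>M\<^esub> s [^]\<^bsub>M\<^esub> q = p (k [^] q) d"
proof -
  let ?F = "\<lambda>i. act (k [^] (q - 1 - i)) (p k (inv (gcomm G k d [^] i)))"
  have s: "s \<in> carrier M" using k d by (simp add: s_def)
  have F: "?F i = act (k [^] (q - i)) (s [^]\<^bsub>M\<^esub> i) \<otimes>\<^bsub>M\<^esub> inv\<^bsub>M\<^esub> act (k [^] (q - 1 - i)) (s [^]\<^bsub>M\<^esub> i)"
    if "i < q" for i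
  proof -
    from that have "q - i = Suc (q - 1 - i)" by simp
    then have "k [^] (q - i) = k \<otimes> k [^] (q - 1 - i)"
      using k by (metis G.nat_pow_Suc2)
    then show ?thesis
      using k d s
      by (simp add: s_def pairing_inv_pow_right[OF pairing_lies_over] act_mult act_inv act_by_mult)
  qed
  have "list_prod M (map ?F [1..<j]) \<otimes>\<^bsub>M\<^esub> act (k [^] (q - j)) (s [^]\<^bsub>M\<^esub> j)
      = act (k [^] (q - j)) (p (k [^] j) d)" if "1 \<le> j" "j \<le> q" for j
    using that
  proof (induction j rule: nat_induct_at_least)
    case base
    then show ?case using k d by (simp add: s_def)
  next
    case (Suc j)
    have "k [^] (q - j) = k \<otimes> k [^] (q - Suc j)"
      using k Suc by (metis G.nat_pow_Suc2 Suc_diff_Suc Suc_le_lessD)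
    have Fc: "set (map ?F [1..<j]) \<subseteq> carrier M" using k d by auto
    then have L: "list_prod M (map ?F [1..<j]) \<in> carrier M" by simp
    have "list_prod M (map ?F [1..<Suc j]) \<otimes>\<^bsub>M\<^esub> act (k [^] (q - Suc j)) (s [^]\<^bsub>M\<^esub> Suc j)
      = list_prod M (map ?F [1..<j]) \<otimes>\<^bsub>M\<^esub>
        (?F j \<otimes>\<^bsub>M\<^esub> act (k [^] (q - Suc j)) (s [^]\<^bsub>M\<^esub> Suc j))"
      using Suc Fc L k d s by (simp add: M.list_prod_append M.m_assoc)
    also have "?F j \<otimes>\<^bsub>M\<^esub> act (k [^] (q - Suc j)) (s [^]\<^bsub>M\<^esub> Suc j)
      = act (k [^] (q - j)) (s [^]\<^bsub>M\<^esub> j) \<otimes>\<^bsub>M\<^esub> act (k [^] (q - Suc j)) s"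
      using Suc k s F[of j] by (simp add: act_mult M.m_assoc)
    also have "list_prod M (map ?F [1..<j]) \<otimes>\<^bsub>M\<^esub> \<dots>
      = act (k [^] (q - j)) (p (k [^] j) d) \<otimes>\<^bsub>M\<^esub> act (k [^] (q - Suc j)) s"
      using Suc L k s by (simp flip: M.m_assoc)
    also have "\<dots> = act (k [^] (q - Suc j)) (act k (p (k [^] j) d) \<otimes>\<^bsub>M\<^esub> s)"
      using k d s by (simp add: \<open>k [^] (q - j) = _\<close> act_by_mult act_mult)
    also have "act k (p (k [^] j) d) \<otimes>\<^bsub>M\<^esub> s = p (k [^] Suc j) d"
      using k d by (simp add: s_def pairing_mult_left)
    finally show ?case .
  qed
  from this[of q] assms show ?thesis by simp
qed

end

section \<open>The extension of \<open>G \<times> G\<close> by a crossed pairing\<close>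

text \<open>The Peiffer identity of a crossed module, for the elements \<open>p g h\<close> of boundary \<open>[g, h]\<close>.\<close>

locale crossed_pairing = equivariant_pairing +
  assumes peiffer: "\<lbrakk>g \<in> carrier G; h \<in> carrier G; m \<in> carrier M\<rbrakk> \<Longrightarrow>
    act (gcomm G g h) m = gconj M m (p g h)"

text \<open>A triple \<open>(a, b, m)\<close> stands for \<open>a b\<^sup>\<phi> m\<close>.  In the product, \<open>a'\<close> has to move to the left past \<open>m\<close>, on
  which it acts, and past \<open>b\<^sup>\<phi>\<close>, which costs the factor \<open>[a', b\<^sup>\<phi>]\<inverse> = (p a' b)\<inverse>\<close>; then \<open>b'\<^sup>\<phi>\<close> moves to the left
  past everything in \<open>M\<close>.\<close>

definition pairing_extension ::
  "('a, 'b) monoid_scheme \<Rightarrow> ('m, 'n) monoid_scheme \<Rightarrow> ('a \<Rightarrow> 'm \<Rightarrow> 'm) \<Rightarrow> ('a \<Rightarrow> 'a \<Rightarrow> 'm) \<Rightarrow>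
    ('a \<times> 'a \<times> 'm) monoid" where
  "pairing_extension G M act p =
     \<lparr>carrier = carrier G \<times> carrier G \<times> carrier M,
      mult = (\<lambda>(a, b, m) (a', b', m').
        (a \<otimes>\<^bsub>G\<^esub> a', b \<otimes>\<^bsub>G\<^esub> b',
         act b' (inv\<^bsub>M\<^esub> p a' b) \<otimes>\<^bsub>M\<^esub> act (a' \<otimes>\<^bsub>G\<^esub> b') m \<otimes>\<^bsub>M\<^esub> m')),
      one = (\<one>\<^bsub>G\<^esub>, \<one>\<^bsub>G\<^esub>, \<one>\<^bsub>M\<^esub>)\<rparr>"

context crossed_pairing
begin

abbreviation "E \<equiv> pairing_extension G M act p"

lemma E_carrier [simp]:
  "(a, b, m) \<in> carrier E \<longleftrightarrow> a \<in> carrier G \<and> b \<in> carrier G \<and> m \<in> carrier M"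
  by (auto simp: pairing_extension_def)

lemma E_mult:
  "(a, b, m) \<otimes>\<^bsub>E\<^esub> (a', b', m') =
    (a \<otimes> a', b \<otimes> b', act b' (inv\<^bsub>M\<^esub> p a' b) \<otimes>\<^bsub>M\<^esub> act (a' \<otimes> b') m \<otimes>\<^bsub>M\<^esub> m')"
  by (simp add: pairing_extension_def)

lemma E_one: "\<one>\<^bsub>E\<^esub> = (\<one>, \<one>, \<one>\<^bsub>M\<^esub>)"
  by (simp add: pairing_extension_def)

text \<open>Acting first by \<open>a\<close> and then by \<open>b\<close> differs from the other order by conjugation with
  the pairing value; this is what makes the multiplication associative.\<close>

lemma pairing_commute:
  assumes "a \<in> carrier G" "b \<in> carrier G" "m \<in> carrier M"
  shows "p a b \<otimes>\<^bsub>M\<^esub> act b (act a m) = act a (act b m) \<otimes>\<^bsub>M\<^esub> p a b"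
proof -
  have "a \<otimes> b = (b \<otimes> a) \<otimes> gcomm G a b" using assms by (simp add: G.free_reduction)
  then have "act (a \<otimes> b) m = gconj M (act (b \<otimes> a) m) (p a b)"
    using assms by (simp add: act_by_mult peiffer)
  then show ?thesis
    using assms by (simp add: act_by_mult gconj_def M.m_assoc)
qed

text \<open>The part of associativity that does not involve elements of \<open>M\<close> other than pairing values.\<close>

lemma pairing_cocycle:
  assumes "a \<in> carrier G" "a' \<in> carrier G" "b \<in> carrier G" "b' \<in> carrier G"
  shows "act a' (act b' (p a b)) \<otimes>\<^bsub>M\<^esub> p a' (b \<otimes> b') = p a' b' \<otimes>\<^bsub>M\<^esub> act b' (p (a \<otimes> a') b)"
proof -
  have "act a' (act b' (p a b)) \<otimes>\<^bsub>M\<^esub> p a' (b \<otimes> b')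
      = (act a' (act b' (p a b)) \<otimes>\<^bsub>M\<^esub> p a' b') \<otimes>\<^bsub>M\<^esub> act b' (p a' b)"
    using assms by (simp add: pairing_mult_right M.m_assoc)
  also have "\<dots> = p a' b' \<otimes>\<^bsub>M\<^esub> act b' (act a' (p a b)) \<otimes>\<^bsub>M\<^esub> act b' (p a' b)"
    using assms by (simp add: pairing_commute)
  finally show ?thesis
    using assms by (simp add: pairing_mult_left act_mult M.m_assoc)
qed

lemma E_assoc:
  assumes "a \<in> carrier G" "b \<in> carrier G" "m \<in> carrier M"
    "a' \<in> carrier G" "b' \<in> carrier G" "m' \<in> carrier M"
    "a'' \<in> carrier G" "b'' \<in> carrier G" "m'' \<in> carrier M"
  shows "((a, b, m) \<otimes>\<^bsub>E\<^esub> (a', b', m')) \<otimes>\<^bsub>E\<^esub> (a'', b'', m'') =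
    (a, b, m) \<otimes>\<^bsub>E\<^esub> ((a', b', m') \<otimes>\<^bsub>E\<^esub> (a'', b'', m''))"
proof -
  define n where "n = act b' (act a' m)"
  have n: "n \<in> carrier M" using assms by (simp add: n_def)
  let ?x = "act a'' (act b' (p a' b))" and ?y = "p a'' (b \<otimes> b')"
    and ?z = "p a'' b'" and ?w = "act b' (p (a' \<otimes> a'') b)"
  have 1: "?x \<otimes>\<^bsub>M\<^esub> ?y = ?z \<otimes>\<^bsub>M\<^esub> ?w"
    using assms pairing_cocycle[of a' a'' b b'] by simp
  have 2: "?z \<otimes>\<^bsub>M\<^esub> act b' (act a'' (act a' m)) = act a'' (act b' (act a' m)) \<otimes>\<^bsub>M\<^esub> ?z"
    using assms by (simp add: pairing_commute)
  have "inv\<^bsub>M\<^esub> ?y \<otimes>\<^bsub>M\<^esub> inv\<^bsub>M\<^esub> ?x \<otimes>\<^bsub>M\<^esub> act a'' (act b' (act a' m))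
      = inv\<^bsub>M\<^esub> (?x \<otimes>\<^bsub>M\<^esub> ?y) \<otimes>\<^bsub>M\<^esub> act a'' (act b' (act a' m))"
    using assms by (simp add: M.inv_mult_group)
  also have "\<dots> = inv\<^bsub>M\<^esub> ?w \<otimes>\<^bsub>M\<^esub> inv\<^bsub>M\<^esub> ?z \<otimes>\<^bsub>M\<^esub>
      (act a'' (act b' (act a' m)) \<otimes>\<^bsub>M\<^esub> ?z) \<otimes>\<^bsub>M\<^esub> inv\<^bsub>M\<^esub> ?z"
    unfolding 1 using assms by (simp add: M.inv_mult_group M.m_assoc)
  also have "\<dots> = inv\<^bsub>M\<^esub> ?w \<otimes>\<^bsub>M\<^esub> act b' (act a'' (act a' m)) \<otimes>\<^bsub>M\<^esub> inv\<^bsub>M\<^esub> ?z"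
    unfolding 2[symmetric] using assms by (simp add: M.m_assoc)
  finally have 3: "act b'' (inv\<^bsub>M\<^esub> ?y \<otimes>\<^bsub>M\<^esub> inv\<^bsub>M\<^esub> ?x \<otimes>\<^bsub>M\<^esub> act a'' (act b' (act a' m)))
      = act b'' (inv\<^bsub>M\<^esub> ?w \<otimes>\<^bsub>M\<^esub> act b' (act a'' (act a' m)) \<otimes>\<^bsub>M\<^esub> inv\<^bsub>M\<^esub> ?z)"
    by simp
  have "act b'' (inv\<^bsub>M\<^esub> ?y \<otimes>\<^bsub>M\<^esub> inv\<^bsub>M\<^esub> ?x \<otimes>\<^bsub>M\<^esub> act a'' (act b' (act a' m)))
      \<otimes>\<^bsub>M\<^esub> (act b'' (act a'' m') \<otimes>\<^bsub>M\<^esub> m'')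
    = act b'' (inv\<^bsub>M\<^esub> ?w \<otimes>\<^bsub>M\<^esub> act b' (act a'' (act a' m)) \<otimes>\<^bsub>M\<^esub> inv\<^bsub>M\<^esub> ?z)
      \<otimes>\<^bsub>M\<^esub> (act b'' (act a'' m') \<otimes>\<^bsub>M\<^esub> m'')"
    by (simp only: 3)
  then show ?thesis
    using assms
    by (simp add: E_mult G.m_assoc M.m_assoc act_mult act_by_mult act_inv)
qed

lemma group_E: "group E"
proof (rule groupI)
  fix x y assume "x \<in> carrier E" "y \<in> carrier E"
  then show "x \<otimes>\<^bsub>E\<^esub> y \<in> carrier E" by (cases x; cases y) (simp add: E_mult)
next
  fix x y z assume "x \<in> carrier E" "y \<in> carrier E" "z \<in> carrier E"
  then show "x \<otimes>\<^bsub>E\<^esub> y \<otimes>\<^bsub>E\<^esub> z = x \<otimes>\<^bsub>E\<^esub> (y \<otimes>\<^bsub>E\<^esub> z)"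
    by (cases x; cases y; cases z) (simp add: E_assoc)
next
  fix x assume "x \<in> carrier E"
  then show "\<one>\<^bsub>E\<^esub> \<otimes>\<^bsub>E\<^esub> x = x" by (cases x) (simp add: E_mult E_one)
next
  fix x assume x: "x \<in> carrier E"
  obtain a b m where abm: "x = (a, b, m)" by (cases x)
  \<comment> \<open>for a left inverse \<open>(a\<inverse>, b\<inverse>, y)\<close> the third component of the product is \<open>n y\<^sup>a\<^sup>b m\<close>\<close>
  have c: "a \<in> carrier G" "b \<in> carrier G" "m \<in> carrier M" using x abm by auto
  define n where "n = act b (inv\<^bsub>M\<^esub> p a (inv b))"
  have n: "n \<in> carrier M" using c by (simp add: n_def)
  have "(inv a, inv b, act (inv (a \<otimes> b)) (inv\<^bsub>M\<^esub> n \<otimes>\<^bsub>M\<^esub> inv\<^bsub>M\<^esub> m)) \<otimes>\<^bsub>E\<^esub> x = \<one>\<^bsub>E\<^esub>"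
    using c n by (simp add: abm E_mult E_one M.m_assoc flip: n_def)
  moreover have "(inv a, inv b, act (inv (a \<otimes> b)) (inv\<^bsub>M\<^esub> n \<otimes>\<^bsub>M\<^esub> inv\<^bsub>M\<^esub> m)) \<in> carrier E"
    using c n by simp
  ultimately show "\<exists>y\<in>carrier E. y \<otimes>\<^bsub>E\<^esub> x = \<one>\<^bsub>E\<^esub>" by blast
qed (simp add: E_one)

sublocale E: group E by (rule group_E)

abbreviation "inL a \<equiv> (a, \<one>, \<one>\<^bsub>M\<^esub>)"
abbreviation "inR b \<equiv> (\<one>, b, \<one>\<^bsub>M\<^esub>)"
abbreviation "inM m \<equiv> (\<one>, \<one>, m)"

lemma inL_hom: "(\<lambda>a. inL a) \<in> hom G E"
  by (simp add: hom_def E_mult)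

lemma inR_hom: "(\<lambda>b. inR b) \<in> hom G E"
  by (simp add: hom_def E_mult)

lemma inM_hom: "(\<lambda>m. inM m) \<in> hom M E"
  by (simp add: hom_def E_mult)

lemma E_decompose:
  "\<lbrakk>a \<in> carrier G; b \<in> carrier G; m \<in> carrier M\<rbrakk> \<Longrightarrow>
    (a, b, m) = inL a \<otimes>\<^bsub>E\<^esub> inR b \<otimes>\<^bsub>E\<^esub> inM m"
  by (simp add: E_mult)

lemma E_inv:
  "a \<in> carrier G \<Longrightarrow> inv\<^bsub>E\<^esub> inL a = inL (inv a)"
  "b \<in> carrier G \<Longrightarrow> inv\<^bsub>E\<^esub> inR b = inR (inv b)"
  "m \<in> carrier M \<Longrightarrow> inv\<^bsub>E\<^esub> inM m = inM (inv\<^bsub>M\<^esub> m)"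
  by (rule E.inv_equality; simp add: E_mult E_one)+

lemma E_gconj:
  "a \<in> carrier G \<Longrightarrow> b \<in> carrier G \<Longrightarrow> gconj E (inR b) (inL a) = (\<one>, b, inv\<^bsub>M\<^esub> p a b)"
  "a \<in> carrier G \<Longrightarrow> m \<in> carrier M \<Longrightarrow> gconj E (inM m) (inL a) = inM (act a m)"
  "b \<in> carrier G \<Longrightarrow> m \<in> carrier M \<Longrightarrow> gconj E (inM m) (inR b) = inM (act b m)"
  "m \<in> carrier M \<Longrightarrow> n \<in> carrier M \<Longrightarrow> gconj E (inM m) (inM n) = inM (gconj M m n)"
  by (rule E.gconj_eqI; simp add: E_mult gconj_def M.m_assoc)+

lemma E_gcomm:
  assumes "a \<in> carrier G" "b \<in> carrier G"
  shows "gcomm E (inL a) (inR b) = inM (p a b)"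
proof -
  have "gcomm E (inL a) (inR b) = inv\<^bsub>E\<^esub> gconj E (inR b) (inL a) \<otimes>\<^bsub>E\<^esub> inR b"
    using assms by (simp add: E.free_reduction)
  also have "gconj E (inR b) (inL a) = inR b \<otimes>\<^bsub>E\<^esub> inM (inv\<^bsub>M\<^esub> p a b)"
    using assms by (simp add: E_gconj E_mult)
  also have "inv\<^bsub>E\<^esub> \<dots> \<otimes>\<^bsub>E\<^esub> inR b = inv\<^bsub>E\<^esub> inM (inv\<^bsub>M\<^esub> p a b)"
    using assms by (simp add: E.free_reduction)
  also have "\<dots> = inM (p a b)" using assms by (simp add: E_inv)
  finally show ?thesis .
qed

lemma E_gcomm_M:
  "m \<in> carrier M \<Longrightarrow> n \<in> carrier M \<Longrightarrow> gcomm E (inM m) (inM n) = inM (gcomm M m n)"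
  using inM_hom E_inv by (simp add: gcomm_def E_mult)

end

lemma crossed_pairing_quotient:
  assumes "crossed_pairing G T act p" "group M" "\<pi> \<in> hom T M" "\<pi> ` carrier T = carrier M"
    and act': "\<And>x t. x \<in> carrier G \<Longrightarrow> t \<in> carrier T \<Longrightarrow> act' x (\<pi> t) = \<pi> (act x t)"
  shows "crossed_pairing G M act' (\<lambda>g h. \<pi> (p g h))"
proof -
  interpret T: crossed_pairing G T act p by fact
  interpret M: group M by fact
  interpret \<pi>: group_hom T M \<pi>
    by (simp add: assms(3) group_hom_axioms.intro group_hom_def T.M.is_group M.is_group)
  have lift: "\<exists>t\<in>carrier T. m = \<pi> t" if "m \<in> carrier M" for m
    using that assms(4) by blast
  show ?thesis
  proof
    fix x assume x: "x \<in> carrier G"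
    show "act' x \<in> hom M M"
    proof (rule homI)
      fix m n assume "m \<in> carrier M" "n \<in> carrier M"
      then obtain s t where st: "s \<in> carrier T" "t \<in> carrier T" "m = \<pi> s" "n = \<pi> t"
        using lift by metis
      then have "act' x (\<pi> (s \<otimes>\<^bsub>T\<^esub> t)) = act' x m \<otimes>\<^bsub>M\<^esub> act' x n"
        using x by (simp add: act' T.act_mult del: \<pi>.hom_mult) (simp add: x)
      then show "act' x (m \<otimes>\<^bsub>M\<^esub> n) = act' x m \<otimes>\<^bsub>M\<^esub> act' x n" using st by simp
    qed (use lift x in \<open>force simp: act'\<close>)
  next
    fix x y m assume *: "x \<in> carrier G" "y \<in> carrier G" "m \<in> carrier M"
    with lift obtain t where "t \<in> carrier T" "m = \<pi> t" by blast
    with * show "act' (x \<otimes>\<^bsub>G\<^esub> y) m = act' y (act' x m)"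
      by (simp add: act' T.act_by_mult)
  next
    fix m assume "m \<in> carrier M"
    with lift obtain t where "t \<in> carrier T" "m = \<pi> t" by blast
    then show "act' \<one>\<^bsub>G\<^esub> m = m" by (simp add: act')
  next
    fix g h m assume *: "g \<in> carrier G" "h \<in> carrier G" "m \<in> carrier M"
    with lift obtain t where "t \<in> carrier T" "m = \<pi> t" by blast
    with * show "act' (gcomm G g h) m = gconj M m (\<pi> (p g h))"
      by (simp add: act' T.peiffer gconj_def)
  qed (simp_all add: act' T.act_pairing T.pairing_mult_right T.pairing_mult_left)
qed

section \<open>The hat symbols\<close>

text \<open>Apart from equivariance, the assumptions on hats are the relations of the tensor square in which
  hats occur.  For \<open>q = 0\<close> there are
  no hat symbols, and \<open>hat\<close> is then an arbitrary function.\<close>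

locale q_crossed_pairing = crossed_pairing +
  fixes q :: nat and hat :: "'a \<Rightarrow> 'c"
  assumes hat_closed [simp]: "1 \<le> q \<Longrightarrow> k \<in> carrier G \<Longrightarrow> hat k \<in> carrier M"
    and act_hat: "1 \<le> q \<Longrightarrow> x \<in> carrier G \<Longrightarrow> k \<in> carrier G \<Longrightarrow> act x (hat k) = hat (gconj G k x)"
    and pairing_hat: "\<lbrakk>1 \<le> q; g \<in> carrier G; h \<in> carrier G; k \<in> carrier G\<rbrakk> \<Longrightarrow>
      gconj M (p g h) (hat k) = act (k [^] q) (p g h)"
    and hat_mult: "\<lbrakk>1 \<le> q; k \<in> carrier G; k1 \<in> carrier G\<rbrakk> \<Longrightarrow>
      hat (k \<otimes> k1) = hat k \<otimes>\<^bsub>M\<^esub>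
        list_prod M (map (\<lambda>i. act (k [^] (q - 1 - i)) (p k (inv (k1 [^] i)))) [1..<q]) \<otimes>\<^bsub>M\<^esub> hat k1"
    and hat_hat: "\<lbrakk>1 \<le> q; k \<in> carrier G; k1 \<in> carrier G\<rbrakk> \<Longrightarrow>
      gcomm M (hat k) (hat k1) = p (k [^] q) (k1 [^] q)"
    and hat_gcomm: "\<lbrakk>1 \<le> q; g \<in> carrier G; h \<in> carrier G\<rbrakk> \<Longrightarrow>
      hat (gcomm G g h) = p g h [^]\<^bsub>M\<^esub> q"

lemma q_crossed_pairing_quotient:
  assumes "q_crossed_pairing G T act p q \<kappa>" "group M" "\<pi> \<in> hom T M" "\<pi> ` carrier T = carrier M"
    and act': "\<And>x t. x \<in> carrier G \<Longrightarrow> t \<in> carrier T \<Longrightarrow> act' x (\<pi> t) = \<pi> (act x t)"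
  shows "q_crossed_pairing G M act' (\<lambda>g h. \<pi> (p g h)) q (\<lambda>k. \<pi> (\<kappa> k))"
proof -
  interpret T: q_crossed_pairing G T act p q \<kappa> by fact
  interpret M: crossed_pairing G M act' "\<lambda>g h. \<pi> (p g h)"
    by (rule crossed_pairing_quotient[where T = T and act = act and \<pi> = \<pi> and p = p])
      (fact T.crossed_pairing_axioms assms)+
  interpret \<pi>: group_hom T M \<pi>
    by (simp add: assms(3) group_hom_axioms.intro group_hom_def T.M.is_group M.M.is_group)
  have conj: "gconj M (\<pi> s) (\<pi> t) = \<pi> (gconj T s t)" "gcomm M (\<pi> s) (\<pi> t) = \<pi> (gcomm T s t)"
    if "s \<in> carrier T" "t \<in> carrier T" for s t
    using that by (simp_all add: gconj_def gcomm_def)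
  show ?thesis
  proof
    fix k k1 assume *: "1 \<le> q" "k \<in> carrier G" "k1 \<in> carrier G"
    let ?l = "map (\<lambda>i. act (k [^]\<^bsub>G\<^esub> (q - 1 - i)) (p k (inv\<^bsub>G\<^esub> (k1 [^]\<^bsub>G\<^esub> i)))) [1..<q]"
    have l: "set ?l \<subseteq> carrier T" using * by auto
    have "\<pi> (list_prod T ?l) = list_prod M (map \<pi> ?l)" and "list_prod T ?l \<in> carrier T"
      by (rule hom_list_prod[OF T.M.is_group M.M.is_group assms(3) l])
        (rule T.M.list_prod_closed[OF l])
    then show "\<pi> (\<kappa> (k \<otimes>\<^bsub>G\<^esub> k1)) = \<pi> (\<kappa> k) \<otimes>\<^bsub>M\<^esub> list_prod M
        (map (\<lambda>i. act' (k [^]\<^bsub>G\<^esub> (q - 1 - i)) (\<pi> (p k (inv\<^bsub>G\<^esub> (k1 [^]\<^bsub>G\<^esub> i))))) [1..<q])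
        \<otimes>\<^bsub>M\<^esub> \<pi> (\<kappa> k1)"
      using * by (simp add: T.hat_mult act' comp_def)
  qed (simp_all add: act' conj T.act_hat T.pairing_hat T.hat_hat T.hat_gcomm \<pi>.hom_nat_pow)
qed

section \<open>The q-tensor square and the q-exterior square\<close>

locale q_squares = group G for G (structure) + fixes q :: nat
begin

abbreviation "T \<equiv> qtensor G q"
abbreviation "ext \<equiv> qext G q"
abbreviation "tcls \<equiv> qtensor_class G q"
abbreviation "tact \<equiv> qtensor_act G q"
abbreviation "tens g h \<equiv> tcls (gen (Tens g h))"
abbreviation "hatT k \<equiv> tcls (gen (Hat k))"
abbreviation "conj_sym x \<equiv> map_tensor_sym (\<lambda>y. gconj G y x)"

sublocale T: presentation "qtensor_gens G q" "qtensor_rels G q"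
  rewrites "presented_group (qtensor_gens G q) (qtensor_rels G q) = T"
    and "pres_class (qtensor_gens G q) (qtensor_rels G q) = tcls"
  by (simp_all add: qtensor_def qtensor_class_def)

lemma qtensor_gens_Tens [simp]:
  "Tens g h \<in> qtensor_gens G q \<longleftrightarrow> g \<in> carrier G \<and> h \<in> carrier G"
  by (auto simp: qtensor_gens_def)

lemma qtensor_gens_Hat [simp]: "Hat k \<in> qtensor_gens G q \<longleftrightarrow> 1 \<le> q \<and> k \<in> carrier G"
  by (auto simp: qtensor_gens_def)

lemma qtensor_rels_words:
  "(l, r) \<in> qtensor_rels G q \<Longrightarrow> l \<in> words (qtensor_gens G q) \<and> r \<in> words (qtensor_gens G q)"
  by (erule qtensor_rels.cases) (auto intro!: words_concat)

lemma qtensor_rel: "(l, r) \<in> qtensor_rels G q \<Longrightarrow> word_eval T (\<lambda>s. tcls (gen s)) l = word_eval T (\<lambda>s. tcls (gen s)) r"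
  using T.eval_rel qtensor_rels_words by blast

lemma conj_sym_gens:
  "x \<in> carrier G \<Longrightarrow> s \<in> qtensor_gens G q \<Longrightarrow> conj_sym x s \<in> qtensor_gens G q"
  by (cases s) auto

lemma conj_sym_rels:
  assumes x: "x \<in> carrier G" and "(l, r) \<in> qtensor_rels G q"
  shows "(wrename (conj_sym x) l, wrename (conj_sym x) r) \<in> qtensor_rels G q"
  using assms(2)
proof cases
  case (tens_right g h h1)
  then show ?thesis
    using qtensor_rels.tens_right[of "gconj G g x" G "gconj G h x" "gconj G h1 x" q] x
    by (simp add: gconj_mult gconj_gconj[of x])
next
  case (tens_left g g1 h)
  then show ?thesis
    using qtensor_rels.tens_left[of "gconj G g x" G "gconj G g1 x" "gconj G h x" q] x
    by (simp add: gconj_mult gconj_gconj[of x])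
next
  case (tens_hat g h k)
  then show ?thesis
    using qtensor_rels.tens_hat[of q "gconj G g x" G "gconj G h x" "gconj G k x"] x
    by (simp add: gconj_pow gconj_gconj[of x])
next
  case (hat_mult k k1)
  then show ?thesis
    using qtensor_rels.hat_mult[of q "gconj G k x" G "gconj G k1 x"] x
    by (simp add: gconj_mult gconj_pow gconj_inv gconj_gconj[of x] wrename_concat comp_def)
next
  case (hat_hat k k1)
  then show ?thesis
    using qtensor_rels.hat_hat[of q "gconj G k x" G "gconj G k1 x"] x
    by (simp add: gconj_pow)
next
  case (hat_comm g h)
  then show ?thesis
    using qtensor_rels.hat_comm[of q "gconj G g x" G "gconj G h x"] x
    by (simp add: gconj_gcomm)
qed

lemma tact_cls:
  assumes "x \<in> carrier G" "u \<in> words (qtensor_gens G q)"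
  shows "tact x (tcls u) = tcls (wrename (conj_sym x) u)"
  using T.rename_hom[OF conj_sym_gens conj_sym_rels, of x] assms
  unfolding qtensor_act_def by metis

lemma tact_hom: assumes "x \<in> carrier G" shows "tact x \<in> hom T T"
proof -
  obtain h where h: "h \<in> hom T T"
    "\<And>u. u \<in> words (qtensor_gens G q) \<Longrightarrow> h (tcls u) = tcls (wrename (conj_sym x) u)"
    using T.rename_hom[OF conj_sym_gens conj_sym_rels, of x] assms by metis
  have "tact x A = h A" if "A \<in> carrier T" for A
    using that by (rule T.carrier_cases) (simp add: tact_cls assms h)
  with h(1) show ?thesis by (simp add: hom_def Pi_def)
qed

lemma tensor_pairing: "equivariant_pairing G T tact tens"
proof
  fix x y A assume *: "x \<in> carrier G" "y \<in> carrier G" "A \<in> carrier T"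
  from *(3) obtain u where u: "u \<in> words (qtensor_gens G q)" "A = tcls u"
    by (rule T.carrier_cases)
  have "wrename (conj_sym x) u \<in> words (qtensor_gens G q)"
    using u(1) conj_sym_gens[OF *(1)] by (rule words_wrename)
  moreover have "wrename (conj_sym y \<circ> conj_sym x) u = wrename (conj_sym (x \<otimes> y)) u"
    using u(1)
  proof (rule wrename_cong)
    fix s assume "s \<in> qtensor_gens G q"
    then show "(conj_sym y \<circ> conj_sym x) s = conj_sym (x \<otimes> y) s"
      using * by (cases s) (simp_all add: gconj_by_mult)
  qed
  ultimately show "tact (x \<otimes> y) A = tact y (tact x A)"
    using * u by (simp add: tact_cls wrename_wrename)
next
  fix A assume "A \<in> carrier T"
  then obtain u where u: "u \<in> words (qtensor_gens G q)" "A = tcls u"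
    by (rule T.carrier_cases)
  have "wrename (conj_sym \<one>) u = wrename (\<lambda>s. s) u"
    using u(1)
  proof (rule wrename_cong)
    fix s assume "s \<in> qtensor_gens G q"
    then show "conj_sym \<one> s = s" by (cases s) simp_all
  qed
  then show "tact \<one> A = A" using u by (simp add: tact_cls wrename_id)
next
  fix g h h1 assume "g \<in> carrier G" "h \<in> carrier G" "h1 \<in> carrier G"
  then show "tens g (h \<otimes> h1) = tens g h1 \<otimes>\<^bsub>T\<^esub> tact h1 (tens g h)"
    using qtensor_rel[OF qtensor_rels.tens_right[of g G h h1 q]] by (simp add: tact_cls)
next
  fix g g1 h assume "g \<in> carrier G" "g1 \<in> carrier G" "h \<in> carrier G"
  then show "tens (g \<otimes> g1) h = tact g1 (tens g h) \<otimes>\<^bsub>T\<^esub> tens g1 h"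
    using qtensor_rel[OF qtensor_rels.tens_left[of g G g1 h q]] by (simp add: tact_cls)
qed (simp_all add: tact_cls tact_hom)

interpretation T: equivariant_pairing G T tact tens
  by (rule tensor_pairing)

lemma tensor_hat_mult:
  assumes "1 \<le> q" "k \<in> carrier G" "k1 \<in> carrier G"
  shows "hatT (k \<otimes> k1) = hatT k \<otimes>\<^bsub>T\<^esub>
        list_prod T (map (\<lambda>i. tact (k [^] (q - 1 - i)) (tens k (inv (k1 [^] i)))) [1..<q]) \<otimes>\<^bsub>T\<^esub> hatT k1"
proof -
  let ?w = "\<lambda>i. gen (Tens (gconj G k (k [^] (q - 1 - i))) (gconj G (inv (k1 [^] i)) (k [^] (q - 1 - i))))"
  let ?l = "map (\<lambda>i. tact (k [^] (q - 1 - i)) (tens k (inv (k1 [^] i)))) [1..<q]"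
  have "set ?l \<subseteq> carrier T" using assms by auto
  then have l: "list_prod T ?l \<in> carrier T" by (rule T.list_prod_closed)
  have w: "?w i \<in> words (qtensor_gens G q)" for i using assms by simp
  then have "concat (map ?w [1..<q]) \<in> words (qtensor_gens G q)"
    by (auto intro!: words_concat simp del: words_gen)
  then have "hatT (k \<otimes> k1) = hatT k \<otimes>\<^bsub>T\<^esub> (list_prod T ?l \<otimes>\<^bsub>T\<^esub> hatT k1)"
    using qtensor_rel[OF qtensor_rels.hat_mult[of q k G k1]] assms w
    by (simp add: T.eval_concat_map T.act_pairing)
  also have "\<dots> = hatT k \<otimes>\<^bsub>T\<^esub> list_prod T ?l \<otimes>\<^bsub>T\<^esub> hatT k1"
    by (rule T.m_assoc[symmetric]) (use assms l in auto)
  finally show ?thesis .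
qed

lemma tensor_pairing_hat:
  "\<lbrakk>1 \<le> q; g \<in> carrier G; h \<in> carrier G; k \<in> carrier G\<rbrakk> \<Longrightarrow>
      gconj T (tens g h) (hatT k) = tact (k [^] q) (tens g h)"
  using qtensor_rel[OF qtensor_rels.tens_hat[of q g G h k]] by (simp add: tact_cls)

lemma tensor_hat_gcomm:
  "\<lbrakk>1 \<le> q; g \<in> carrier G; h \<in> carrier G\<rbrakk> \<Longrightarrow> hatT (gcomm G g h) = tens g h [^]\<^bsub>T\<^esub> q"
  using qtensor_rel[OF qtensor_rels.hat_comm[of q g G h]] by (simp add: int_pow_int)

text \<open>This Peiffer identity for hats is hidden in the relations.  With \<open>d = [g, h]\<close> one has
  \<open>k\<^sup>d = k [k, d]\<close>, so the hat of \<open>k\<^sup>d\<close> expands by the product rule for hats, and the hat of \<open>[k, d]\<close> is the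
  \<open>q\<close>-th power of \<open>k \<otimes> d\<close>.  By \<open>pairing_pow_left\<close> all factors after the hat of \<open>k\<close> collapse to \<open>k\<^sup>q \<otimes> d\<close>, that is,
  to \<open>(t\<inverse>)\<^sup>x t\<close> with \<open>t = g \<otimes> h\<close> and \<open>x = k\<^sup>q\<close>; and \<open>k\<^sup>q\<close> acts on \<open>t\<close> as conjugation by the hat of \<open>k\<close>.\<close>

lemma act_gcomm_hat:
  assumes "1 \<le> q" "g \<in> carrier G" "h \<in> carrier G" "k \<in> carrier G"
  shows "tact (gcomm G g h) (hatT k) = gconj T (hatT k) (tens g h)"
proof -
  let ?d = "gcomm G g h" and ?t = "tens g h"
  have "gconj G k ?d = k \<otimes> gcomm G k ?d" using assms by (simp add: free_reduction)
  then have "tact ?d (hatT k) = hatT (k \<otimes> gcomm G k ?d)"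
    using assms by (simp add: tact_cls)
  also have "\<dots> = hatT k \<otimes>\<^bsub>T\<^esub> (list_prod T (map (\<lambda>i. tact (k [^] (q - 1 - i))
      (tens k (inv (gcomm G k ?d [^] i)))) [1..<q]) \<otimes>\<^bsub>T\<^esub> tens k ?d [^]\<^bsub>T\<^esub> q)"
  proof -
    have "set (map (\<lambda>i. tact (k [^] (q - 1 - i)) (tens k (inv (gcomm G k ?d [^] i)))) [1..<q])
        \<subseteq> carrier T"
      using assms by auto
    then show ?thesis
      using assms by (simp add: tensor_hat_mult tensor_hat_gcomm T.m_assoc)
  qed
  also have "\<dots> = hatT k \<otimes>\<^bsub>T\<^esub> tens (k [^] q) ?d"
    using assms T.pairing_pow_left[of k ?d q] by simp
  also have "tens (k [^] q) ?d = inv\<^bsub>T\<^esub> gconj T ?t (hatT k) \<otimes>\<^bsub>T\<^esub> ?t"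
    using assms by (simp add: T.pairing_gcomm_right tensor_pairing_hat)
  also have "hatT k \<otimes>\<^bsub>T\<^esub> \<dots> = gconj T (hatT k) ?t"
    using assms by (simp add: T.free_reduction)
  finally show ?thesis .
qed

lemma tensor_crossed: "q_crossed_pairing G T tact tens q hatT"
proof
  fix g h A assume *: "g \<in> carrier G" "h \<in> carrier G" "A \<in> carrier T"
  show "tact (gcomm G g h) A = gconj T A (tens g h)"
  proof (rule T.hom_eqI[where K = T, OF _ _ _ _ *(3)])
    fix s assume "s \<in> qtensor_gens G q"
    then show "tact (gcomm G g h) (tcls (gen s)) = gconj T (tcls (gen s)) (tens g h)"
      using * by (cases s) (simp_all add: T.act_gcomm_pairing act_gcomm_hat)
  qed (use * in \<open>simp_all add: T.is_group T.act_hom T.gconj_hom\<close>)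
next
  fix k k1 assume "1 \<le> q" "k \<in> carrier G" "k1 \<in> carrier G"
  then show "gcomm T (hatT k) (hatT k1) = tens (k [^] q) (k1 [^] q)"
    using qtensor_rel[OF qtensor_rels.hat_hat[of q k G k1]] by simp
qed (simp_all add: tact_cls tensor_pairing_hat tensor_hat_mult tensor_hat_gcomm)

end

context q_squares
begin

sublocale T: q_crossed_pairing G T tact tens q hatT
  by (rule tensor_crossed)

abbreviation "diag \<equiv> qdiag G q"

text \<open>By the Peiffer identity, conjugation by \<open>g \<otimes> g\<close> is the action of \<open>[g, g] = 1\<close>, so the diagonal is
  generated by central elements.\<close>

lemma diag_normal: "diag \<lhd> T"
  unfolding qdiag_def
proof (rule T.normal_generate_central)
  fix s A assume "s \<in> (\<lambda>g. tens g g) ` carrier G" and A: "A \<in> carrier T"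
  then obtain g where g: "g \<in> carrier G" "s = tens g g" by blast
  then have "gcomm G g g = \<one>" by (simp add: free_reduction)
  then have "gconj T A s = A" using T.peiffer[of g g A] g A by simp
  then have "s \<otimes>\<^bsub>T\<^esub> gconj T A s = s \<otimes>\<^bsub>T\<^esub> A" by simp
  then show "A \<otimes>\<^bsub>T\<^esub> s = s \<otimes>\<^bsub>T\<^esub> A" using g A by (simp add: gconj_def T.m_assoc)
qed auto

abbreviation "proj t \<equiv> diag #>\<^bsub>T\<^esub> t"

lemma proj_hom: "proj \<in> hom T ext"
  unfolding qext_def by (rule normal.r_coset_hom_Mod[OF diag_normal])

lemma proj_surj: "proj ` carrier T = carrier ext"
  by (auto simp: qext_def FactGroup_def RCOSETS_def)

lemma ext_group: "group ext"
  unfolding qext_def by (rule normal.factorgroup_is_group[OF diag_normal])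

lemma tact_diag:
  assumes "x \<in> carrier G" shows "tact x ` diag = diag"
proof -
  let ?S = "(\<lambda>g. tens g g) ` carrier G"
  have "tact x ` ?S = ?S"
  proof (intro equalityI subsetI)
    fix t assume "t \<in> ?S"
    then obtain g where g: "g \<in> carrier G" "t = tens g g" by blast
    then have "t = tact x (tens (gconj G g (inv x)) (gconj G g (inv x)))"
      using assms by (simp add: T.act_pairing)
    with g assms show "t \<in> tact x ` ?S"
      by (intro image_eqI[OF _ imageI[of "gconj G g (inv x)"]]) simp_all
  next
    fix t assume "t \<in> tact x ` ?S"
    then obtain g where g: "g \<in> carrier G" "t = tact x (tens g g)" by blast
    then show "t \<in> ?S"
      using assms by (intro image_eqI[of _ _ "gconj G g x"]) (simp_all add: T.act_pairing)
  qed
  moreover have "?S \<subseteq> carrier T" using T.pairing_closed by blast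
  ultimately show ?thesis
    unfolding qdiag_def using group_hom.generate_img[OF T.act_group_hom[OF assms], of ?S] by simp
qed

lemma qext_act_proj:
  assumes "x \<in> carrier G" "t \<in> carrier T" shows "qext_act G q x (proj t) = proj (tact x t)"
proof -
  have D: "d \<in> carrier T" if "d \<in> diag" for d
    using that normal_imp_subgroup[OF diag_normal] by (rule subgroup.mem_carrier[rotated])
  have "proj t = (\<lambda>d. d \<otimes>\<^bsub>T\<^esub> t) ` diag" for t
    unfolding r_coset_def by blast
  moreover have "tact x ` (\<lambda>d. d \<otimes>\<^bsub>T\<^esub> t) ` diag = (\<lambda>d. d \<otimes>\<^bsub>T\<^esub> tact x t) ` tact x ` diag"
    unfolding image_image by (rule image_cong) (simp_all add: assms D T.act_mult)
  ultimately show ?thesis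
    using assms by (simp add: qext_act_def tact_diag)
qed

lemma wedge_eq: "wedge G q g h = proj (tens g h)"
  by (simp add: wedge_def)

lemma hat_eq: "1 \<le> q \<Longrightarrow> hat G q k = proj (hatT k)"
  by (simp add: hat_def)

lemma exterior_crossed: "q_crossed_pairing G ext (qext_act G q) (wedge G q) q (\<lambda>k. proj (hatT k))"
proof -
  have "q_crossed_pairing G ext (qext_act G q) (\<lambda>g h. proj (tens g h)) q (\<lambda>k. proj (hatT k))"
    by (rule q_crossed_pairing_quotient[where T = T and act = tact and \<pi> = proj])
      (fact tensor_crossed ext_group proj_hom proj_surj qext_act_proj)+
  then show ?thesis by (simp add: wedge_def[abs_def])
qed

sublocale ext: q_crossed_pairing G ext "qext_act G q" "wedge G q" q "\<lambda>k. proj (hatT k)"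
  by (rule exterior_crossed)

lemma proj_eq_one_iff: "t \<in> carrier T \<Longrightarrow> proj t = \<one>\<^bsub>ext\<^esub> \<longleftrightarrow> t \<in> diag"
  using T.coset_join1[OF _ _ normal_imp_subgroup[OF diag_normal]]
    T.coset_join2[OF _ normal_imp_subgroup[OF diag_normal]]
    subgroup.subset[OF normal_imp_subgroup[OF diag_normal]]
  by (auto simp: qext_def FactGroup_def)

lemma hat_one: "hat G q \<one> = \<one>\<^bsub>ext\<^esub>"
proof (cases "q = 0")
  case False
  then have q: "1 \<le> q" by simp
  have l: "list_prod T (map (\<lambda>i. \<one>\<^bsub>T\<^esub>) l) = \<one>\<^bsub>T\<^esub>" for l :: "nat list"
    by (induction l) auto
  have "hatT \<one> = hatT \<one> \<otimes>\<^bsub>T\<^esub> hatT \<one>"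
    using T.hat_mult[OF q, of \<one> \<one>] q by (simp add: l)
  then have "hatT \<one> = \<one>\<^bsub>T\<^esub>" using q by simp
  then show ?thesis
    using q group_hom.hom_one[of T ext proj] proj_hom
    by (simp add: hat_eq group_hom_def group_hom_axioms_def T.is_group ext_group)
qed (simp add: hat_def)

lemma hat_closed [simp]: "k \<in> carrier G \<Longrightarrow> hat G q k \<in> carrier ext"
  using ext.M.one_closed ext.hat_closed[of k] by (cases "q = 0") (simp_all add: hat_def)

lemma lam_wedge: "g \<in> carrier G \<Longrightarrow> h \<in> carrier G \<Longrightarrow> lam G q g h \<one> = wedge G q g h"
  by (simp add: lam_def hat_one)

lemma lam_hat: "k \<in> carrier G \<Longrightarrow> lam G q \<one> \<one> k = hat G q k"
  by (simp add: lam_def)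

end

section \<open>The group \<open>\<nu>\<^sup>q(G)\<close>\<close>

context q_squares
begin

abbreviation "N \<equiv> nuq G q"
abbreviation "ncls \<equiv> nuq_class G q"
abbreviation "nG g \<equiv> ncls (gen (NG g))"
abbreviation "nP g \<equiv> ncls (gen (NP g))"
abbreviation "nH k \<equiv> ncls (gen (NH k))"

sublocale N: presentation "nuq_gens G q" "nuq_rels G q"
  rewrites "presented_group (nuq_gens G q) (nuq_rels G q) = N"
    and "pres_class (nuq_gens G q) (nuq_rels G q) = ncls"
  by (simp_all add: nuq_def nuq_class_def)

lemma nuq_gens_NG [simp]: "NG g \<in> nuq_gens G q \<longleftrightarrow> g \<in> carrier G"
  by (auto simp: nuq_gens_def)

lemma nuq_gens_NP [simp]: "NP g \<in> nuq_gens G q \<longleftrightarrow> g \<in> carrier G"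
  by (auto simp: nuq_gens_def)

lemma nuq_gens_NH [simp]: "NH k \<in> nuq_gens G q \<longleftrightarrow> 1 \<le> q \<and> k \<in> carrier G"
  by (auto simp: nuq_gens_def)

lemma words_nu_comm [simp]:
  "nu_comm g h \<in> words (nuq_gens G q) \<longleftrightarrow> g \<in> carrier G \<and> h \<in> carrier G"
  by (simp add: nu_comm_def)

lemma nuq_rels_words:
  "(l, r) \<in> nuq_rels G q \<Longrightarrow> l \<in> words (nuq_gens G q) \<and> r \<in> words (nuq_gens G q)"
  by (erule nuq_rels.cases) (auto intro!: words_concat)

lemma nuq_rel:
  "(l, r) \<in> nuq_rels G q \<Longrightarrow> word_eval N (\<lambda>s. ncls (gen s)) l = word_eval N (\<lambda>s. ncls (gen s)) r"
  using N.eval_rel nuq_rels_words by blast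

definition comm :: "'a \<Rightarrow> 'a \<Rightarrow> 'a nu_sym word set" where
  "comm g h = gcomm N (nG g) (nP h)"

lemma eval_nu_comm [simp]:
  "g \<in> carrier G \<Longrightarrow> h \<in> carrier G \<Longrightarrow> word_eval N (\<lambda>s. ncls (gen s)) (nu_comm g h) = comm g h"
  by (simp add: nu_comm_def comm_def)

lemma ncls_nu_comm: "g \<in> carrier G \<Longrightarrow> h \<in> carrier G \<Longrightarrow> ncls (nu_comm g h) = comm g h"
  using N.eval_cls[of "nu_comm g h"] by simp

lemma comm_closed [simp]: "g \<in> carrier G \<Longrightarrow> h \<in> carrier G \<Longrightarrow> comm g h \<in> carrier N"
  by (simp add: comm_def)

lemma nG_mult: "g \<in> carrier G \<Longrightarrow> h \<in> carrier G \<Longrightarrow> nG (g \<otimes> h) = nG g \<otimes>\<^bsub>N\<^esub> nG h"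
  using nuq_rel[OF nuq_rels.mult_G[of g G h q]] by simp

lemma nP_mult: "g \<in> carrier G \<Longrightarrow> h \<in> carrier G \<Longrightarrow> nP (g \<otimes> h) = nP g \<otimes>\<^bsub>N\<^esub> nP h"
  using nuq_rel[OF nuq_rels.mult_phi[of g G h q]] by simp

lemma comm_conj:
  assumes "g \<in> carrier G" "h \<in> carrier G" "k \<in> carrier G"
  shows "gconj N (comm g h) (nG k) = comm (gconj G g k) (gconj G h k)"
    and "gconj N (comm g h) (nP k) = comm (gconj G g k) (gconj G h k)"
  using nuq_rel[OF nuq_rels.conj_G[of g G h k q]] nuq_rel[OF nuq_rels.conj_phi[of g G h k q]] assms
  by simp_all

lemma nH_conj:
  assumes "1 \<le> q" "k \<in> carrier G" "g \<in> carrier G"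
  shows "gconj N (nH k) (nG g) = nH (gconj G k g)" and "gconj N (nH k) (nP g) = nH (gconj G k g)"
  using nuq_rel[OF nuq_rels.hat_conj_G[of q g G k]] nuq_rel[OF nuq_rels.hat_conj_phi[of q g G k]] assms
  by simp_all

lemma nG_hom: "nG \<in> hom G N" by (simp add: hom_def nG_mult)

lemma nP_hom: "nP \<in> hom G N" by (simp add: hom_def nP_mult)

fun nu_tensor :: "'a tensor_sym \<Rightarrow> 'a nu_sym word set" where
  "nu_tensor (Tens g h) = comm g h"
| "nu_tensor (Hat k) = nH k"

lemma nu_tensor_eval: "word_evaluation N (qtensor_gens G q) nu_tensor"
proof
  fix s assume "s \<in> qtensor_gens G q"
  then show "nu_tensor s \<in> carrier N" by (cases s) simp_all
qed

text \<open>The two expansion rules are commutator identities that hold in every group, combined with the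
  conjugation relations of \<open>\<nu>\<^sup>q(G)\<close>; the relations with hats are relations of \<open>\<nu>\<^sup>q(G)\<close>.\<close>

lemma nu_tensor_rels:
  assumes "(l, r) \<in> qtensor_rels G q"
  shows "word_eval N nu_tensor l = word_eval N nu_tensor r"
proof -
  interpret t: word_evaluation N "qtensor_gens G q" nu_tensor by (rule nu_tensor_eval)
  from assms show ?thesis
  proof cases
    case (tens_right g h h1)
    have "comm g (h \<otimes> h1) = comm g h1 \<otimes>\<^bsub>N\<^esub> gconj N (comm g h) (nP h1)"
      using tens_right by (simp add: comm_def nP_mult N.free_reduction)
    then show ?thesis using tens_right by (simp add: comm_conj)
  next
    case (tens_left g g1 h)
    have "comm (g \<otimes> g1) h = gconj N (comm g h) (nG g1) \<otimes>\<^bsub>N\<^esub> comm g1 h"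
      using tens_left by (simp add: comm_def nG_mult N.free_reduction)
    then show ?thesis using tens_left by (simp add: comm_conj)
  next
    case (tens_hat g h k)
    then show ?thesis using nuq_rel[OF nuq_rels.comm_hat[of q g G h k]] by simp
  next
    case (hat_mult k k1)
    let ?w = "\<lambda>i. gen (Tens (gconj G k (k [^] (q - 1 - i))) (gconj G (inv (k1 [^] i)) (k [^] (q - 1 - i))))"
    let ?v = "\<lambda>i. wconj (nu_comm k (inv (k1 [^] i))) (gen (NG (k [^] (q - 1 - i))))"
    let ?l = "map (\<lambda>i. gconj N (comm k (inv (k1 [^] i))) (nG (k [^] (q - 1 - i)))) [1..<q]"
    have w: "?w i \<in> words (qtensor_gens G q)" "?v i \<in> words (nuq_gens G q)" for i
      using hat_mult by simp_all
    then have cw: "concat (map ?w [1..<q]) \<in> words (qtensor_gens G q)"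
      "concat (map ?v [1..<q]) \<in> words (nuq_gens G q)"
      by (auto intro!: words_concat simp del: words_gen words_wconj)
    have "set ?l \<subseteq> carrier N" using hat_mult by auto
    then have l: "list_prod N ?l \<in> carrier N" by (rule N.list_prod_closed)
    have "word_eval N nu_tensor r = nH k \<otimes>\<^bsub>N\<^esub> (list_prod N ?l \<otimes>\<^bsub>N\<^esub> nH k1)"
      using hat_mult w cw by (simp add: t.eval_concat_map comm_conj)
    moreover have "inv\<^bsub>N\<^esub> nH k \<otimes>\<^bsub>N\<^esub> (nH (k \<otimes> k1) \<otimes>\<^bsub>N\<^esub> inv\<^bsub>N\<^esub> nH k1) = list_prod N ?l"
      using nuq_rel[OF nuq_rels.hat_mult[of q k G k1]] hat_mult w cw
      by (simp add: N.eval_concat_map)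
    moreover have "nH k \<otimes>\<^bsub>N\<^esub> ((inv\<^bsub>N\<^esub> nH k \<otimes>\<^bsub>N\<^esub> (nH (k \<otimes> k1) \<otimes>\<^bsub>N\<^esub> inv\<^bsub>N\<^esub> nH k1)) \<otimes>\<^bsub>N\<^esub> nH k1)
        = nH (k \<otimes> k1)"
      using hat_mult by (simp add: N.m_assoc)
    ultimately show ?thesis using hat_mult by simp
  next
    case (hat_hat k k1)
    then show ?thesis using nuq_rel[OF nuq_rels.hat_hat[of q k G k1]] by simp
  next
    case (hat_comm g h)
    then show ?thesis using nuq_rel[OF nuq_rels.hat_comm[of q g G h]] by simp
  qed
qed

lemma tensor_to_nu:
  obtains \<chi> where "\<chi> \<in> hom T N"
    "\<And>g h. g \<in> carrier G \<Longrightarrow> h \<in> carrier G \<Longrightarrow> \<chi> (tens g h) = comm g h"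
    "\<And>k. 1 \<le> q \<Longrightarrow> k \<in> carrier G \<Longrightarrow> \<chi> (hatT k) = nH k"
    "\<And>x t. x \<in> carrier G \<Longrightarrow> t \<in> carrier T \<Longrightarrow> \<chi> (tact x t) = gconj N (\<chi> t) (nG x)"
    "\<And>x t. x \<in> carrier G \<Longrightarrow> t \<in> carrier T \<Longrightarrow> \<chi> (tact x t) = gconj N (\<chi> t) (nP x)"
proof -
  interpret t: word_evaluation N "qtensor_gens G q" nu_tensor by (rule nu_tensor_eval)
  obtain \<chi> where \<chi>: "\<chi> \<in> hom T N" "\<And>u. u \<in> words (qtensor_gens G q) \<Longrightarrow> \<chi> (tcls u) = word_eval N nu_tensor u"
    using T.lift_exists[OF nu_tensor_eval nu_tensor_rels] by blast
  have tens: "\<chi> (tens g h) = comm g h" if "g \<in> carrier G" "h \<in> carrier G" for g h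
    using that by (simp add: \<chi>(2))
  have hat: "\<chi> (hatT k) = nH k" if "1 \<le> q" "k \<in> carrier G" for k
    using that by (simp add: \<chi>(2))
  have act: "\<chi> (tact x t) = gconj N (\<chi> t) z"
    if x: "x \<in> carrier G" "t \<in> carrier T" and z: "z = nG x \<or> z = nP x" for x t z
  proof -
    from z x have zc: "z \<in> carrier N" by auto
    have "(\<chi> \<circ> tact x) t = ((\<lambda>y. gconj N y z) \<circ> \<chi>) t"
    proof (rule T.hom_eqI[where K = N, OF _ _ _ _ x(2)])
      show "\<chi> \<circ> tact x \<in> hom T N" by (rule Group.hom_compose[OF T.act_hom[OF x(1)] \<chi>(1)])
      show "(\<lambda>y. gconj N y z) \<circ> \<chi> \<in> hom T N" by (rule Group.hom_compose[OF \<chi>(1) N.gconj_hom[OF zc]])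
      fix s assume "s \<in> qtensor_gens G q"
      then show "(\<chi> \<circ> tact x) (tcls (gen s)) = ((\<lambda>y. gconj N y z) \<circ> \<chi>) (tcls (gen s))"
        using x z
        by (cases s) (auto simp: tact_cls \<chi>(2) comm_conj nH_conj)
    qed (rule N.is_group)
    then show ?thesis by simp
  qed
  have act_nG: "\<chi> (tact x t) = gconj N (\<chi> t) (nG x)" and act_nP: "\<chi> (tact x t) = gconj N (\<chi> t) (nP x)"
    if "x \<in> carrier G" "t \<in> carrier T" for x t
    using act[OF that] by blast+
  show thesis by (rule that[OF \<chi>(1) tens hat act_nG act_nP])
qed

text \<open>Moving the generators of the first copy of \<open>G\<close> to the front, then those of the second,
  writes every element of \<open>\<nu>\<^sup>q(G)\<close> as \<open>a b\<^sup>\<phi> t\<close> with \<open>t\<close> in the image of the tensor square.\<close>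

lemma tensor_extension_to_nu:
  obtains \<Phi> \<chi> where "\<Phi> \<in> hom T.E N" "\<Phi> ` carrier T.E = carrier N" "\<chi> \<in> hom T N"
    "\<And>g h. g \<in> carrier G \<Longrightarrow> h \<in> carrier G \<Longrightarrow> \<chi> (tens g h) = comm g h"
    "\<And>k. 1 \<le> q \<Longrightarrow> k \<in> carrier G \<Longrightarrow> \<chi> (hatT k) = nH k"
    "\<And>a b t. \<Phi> (a, b, t) = nG a \<otimes>\<^bsub>N\<^esub> nP b \<otimes>\<^bsub>N\<^esub> \<chi> t"
proof -
  obtain \<chi> where \<chi>: "\<chi> \<in> hom T N"
    and tens: "\<And>g h. g \<in> carrier G \<Longrightarrow> h \<in> carrier G \<Longrightarrow> \<chi> (tens g h) = comm g h"
    and hat: "\<And>k. 1 \<le> q \<Longrightarrow> k \<in> carrier G \<Longrightarrow> \<chi> (hatT k) = nH k"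
    and act: "\<And>x t. x \<in> carrier G \<Longrightarrow> t \<in> carrier T \<Longrightarrow> \<chi> (tact x t) = gconj N (\<chi> t) (nG x)"
      "\<And>x t. x \<in> carrier G \<Longrightarrow> t \<in> carrier T \<Longrightarrow> \<chi> (tact x t) = gconj N (\<chi> t) (nP x)"
    by (rule tensor_to_nu) (rule that)
  interpret \<chi>: group_hom T N \<chi>
    by (simp add: \<chi> group_hom_axioms.intro group_hom_def T.is_group N.is_group)
  define \<Phi> where "\<Phi> = (\<lambda>(a, b, t). nG a \<otimes>\<^bsub>N\<^esub> nP b \<otimes>\<^bsub>N\<^esub> \<chi> t)"
  have \<Phi>: "\<Phi> (a, b, t) = nG a \<otimes>\<^bsub>N\<^esub> nP b \<otimes>\<^bsub>N\<^esub> \<chi> t" for a b t by (simp add: \<Phi>_def)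
  have hom: "\<Phi> \<in> hom T.E N"
  proof (rule homI)
    fix x assume "x \<in> carrier T.E"
    then show "\<Phi> x \<in> carrier N" by (cases x) (simp add: \<Phi>)
  next
    fix x y assume "x \<in> carrier T.E" "y \<in> carrier T.E"
    moreover obtain a b s where x: "x = (a, b, s)" by (cases x)
    moreover obtain a' b' t where y: "y = (a', b', t)" by (cases y)
    ultimately have c: "a \<in> carrier G" "b \<in> carrier G" "s \<in> carrier T"
      "a' \<in> carrier G" "b' \<in> carrier G" "t \<in> carrier T" by auto
    have s: "\<chi> s \<otimes>\<^bsub>N\<^esub> nG a' = nG a' \<otimes>\<^bsub>N\<^esub> \<chi> (tact a' s)"
      using c by (simp add: act(1) gconj_def N.m_assoc)
    have b: "nP b \<otimes>\<^bsub>N\<^esub> nG a' = nG a' \<otimes>\<^bsub>N\<^esub> nP b \<otimes>\<^bsub>N\<^esub> \<chi> (inv\<^bsub>T\<^esub> tens a' b)"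
      using c by (simp add: tens comm_def N.free_reduction)
    define m where "m = inv\<^bsub>T\<^esub> tens a' b \<otimes>\<^bsub>T\<^esub> tact a' s"
    have m: "m \<in> carrier T" using c by (simp add: m_def)
    have n: "\<chi> n \<otimes>\<^bsub>N\<^esub> nP b' = nP b' \<otimes>\<^bsub>N\<^esub> \<chi> (tact b' n)" if "n \<in> carrier T" for n
      using c that by (simp add: act(2) gconj_def N.m_assoc)
    have "\<Phi> x \<otimes>\<^bsub>N\<^esub> \<Phi> y = nG a \<otimes>\<^bsub>N\<^esub> (nP b \<otimes>\<^bsub>N\<^esub> (\<chi> s \<otimes>\<^bsub>N\<^esub> nG a')) \<otimes>\<^bsub>N\<^esub> nP b' \<otimes>\<^bsub>N\<^esub> \<chi> t"
      using c by (simp add: \<Phi> x y N.m_assoc)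
    also have "\<dots> = nG a \<otimes>\<^bsub>N\<^esub> (nP b \<otimes>\<^bsub>N\<^esub> nG a') \<otimes>\<^bsub>N\<^esub> \<chi> (tact a' s) \<otimes>\<^bsub>N\<^esub> nP b' \<otimes>\<^bsub>N\<^esub> \<chi> t"
      unfolding s using c by (simp add: N.m_assoc del: \<chi>.hom_mult)
    also have "\<dots> = nG (a \<otimes> a') \<otimes>\<^bsub>N\<^esub> nP b \<otimes>\<^bsub>N\<^esub> (\<chi> m \<otimes>\<^bsub>N\<^esub> nP b') \<otimes>\<^bsub>N\<^esub> \<chi> t"
      unfolding b using c by (simp add: m_def nG_mult N.m_assoc)
    also have "\<dots> = nG (a \<otimes> a') \<otimes>\<^bsub>N\<^esub> nP (b \<otimes> b') \<otimes>\<^bsub>N\<^esub> \<chi> (tact b' m \<otimes>\<^bsub>T\<^esub> t)"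
      unfolding n[OF m] using c m by (simp add: nP_mult N.m_assoc)
    also have "\<dots> = \<Phi> (x \<otimes>\<^bsub>T.E\<^esub> y)"
      using c by (simp add: m_def x y T.E_mult \<Phi> T.act_mult T.act_by_mult)
    finally show "\<Phi> (x \<otimes>\<^bsub>T.E\<^esub> y) = \<Phi> x \<otimes>\<^bsub>N\<^esub> \<Phi> y" by simp
  qed
  interpret \<Phi>: group_hom T.E N \<Phi>
    by (simp add: hom group_hom_axioms.intro group_hom_def T.group_E N.is_group)
  have one: "nG \<one> = \<one>\<^bsub>N\<^esub>" "nP \<one> = \<one>\<^bsub>N\<^esub>"
    using nG_hom nP_hom hom_one is_group N.is_group by blast+
  have gens: "ncls (gen s) \<in> \<Phi> ` carrier T.E" if "s \<in> nuq_gens G q" for s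
  proof (cases s)
    case (NG g)
    then have "ncls (gen s) = \<Phi> (T.inL g)" using that by (simp add: \<Phi> one)
    then show ?thesis using that NG by (intro image_eqI) auto
  next
    case (NP g)
    then have "ncls (gen s) = \<Phi> (T.inR g)" using that by (simp add: \<Phi> one)
    then show ?thesis using that NP by (intro image_eqI) auto
  next
    case (NH k)
    then have "ncls (gen s) = \<Phi> (T.inM (hatT k))" using that by (simp add: \<Phi> one hat)
    then show ?thesis using that NH by (intro image_eqI) auto
  qed
  have "A \<in> \<Phi> ` carrier T.E" if "A \<in> carrier N" for A
  proof -
    from that obtain u where u: "u \<in> words (nuq_gens G q)" "A = ncls u" by (rule N.carrier_cases)
    then have "A = word_eval N (\<lambda>s. ncls (gen s)) u" by (simp add: N.eval_cls)
    also have "\<dots> \<in> \<Phi> ` carrier T.E"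
      by (rule N.word_eval_in_subgroup[OF \<Phi>.img_is_subgroup u(1) gens])
    finally show ?thesis .
  qed
  then have "\<Phi> ` carrier T.E = carrier N" using \<Phi>.hom_closed by blast
  from hom this \<chi> tens hat \<Phi> show thesis by (rule that)
qed

fun nu_value :: "'a nu_sym \<Rightarrow> 'a \<times> 'a \<times> 'a qext_elem" where
  "nu_value (NG g) = ext.inL g"
| "nu_value (NP g) = ext.inR g"
| "nu_value (NH k) = ext.inM (proj (hatT k))"

lemma nu_value_eval: "word_evaluation ext.E (nuq_gens G q) nu_value"
proof (intro word_evaluation.intro word_evaluation_axioms.intro ext.group_E)
  fix s assume "s \<in> nuq_gens G q"
  then show "nu_value s \<in> carrier ext.E" by (cases s) simp_all
qed

lemma nu_value_rels:
  assumes "(l, r) \<in> nuq_rels G q"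
  shows "word_eval ext.E nu_value l = word_eval ext.E nu_value r"
proof -
  interpret v: word_evaluation ext.E "nuq_gens G q" nu_value by (rule nu_value_eval)
  have comm: "word_eval ext.E nu_value (nu_comm g h) = ext.inM (wedge G q g h)"
    if "g \<in> carrier G" "h \<in> carrier G" for g h
    using that by (simp add: nu_comm_def ext.E_gcomm)
  have inM_pow: "ext.inM (m [^]\<^bsub>ext\<^esub> n) = ext.inM m [^]\<^bsub>ext.E\<^esub> n" if "m \<in> carrier ext" for m and n :: nat
    by (rule hom_nat_pow[OF ext.inM_hom that ext.M.is_group ext.E.is_group])
  from assms show ?thesis
  proof cases
    case (hat_mult k k1)
    let ?v = "\<lambda>i. wconj (nu_comm k (inv (k1 [^] i))) (gen (NG (k [^] (q - 1 - i))))"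
    let ?l = "map (\<lambda>i. qext_act G q (k [^] (q - 1 - i)) (wedge G q k (inv (k1 [^] i)))) [1..<q]"
    have v: "?v i \<in> words (nuq_gens G q)" for i using hat_mult by simp
    then have cv: "concat (map ?v [1..<q]) \<in> words (nuq_gens G q)"
      by (auto intro!: words_concat simp del: words_gen words_wconj)
    have c: "set ?l \<subseteq> carrier ext" using hat_mult by auto
    then have l: "list_prod ext ?l \<in> carrier ext" by (rule ext.M.list_prod_closed)
    have "word_eval ext.E nu_value r = list_prod ext.E (map (\<lambda>m. ext.inM m) ?l)"
      using hat_mult v by (simp add: v.eval_concat_map comm ext.E_gconj comp_def)
    also have "\<dots> = ext.inM (list_prod ext ?l)"
      by (rule hom_list_prod[symmetric, OF ext.M.is_group ext.E.is_group ext.inM_hom c])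
    finally have r: "word_eval ext.E nu_value r = ext.inM (list_prod ext ?l)" .
    have hats: "proj (hatT k) \<in> carrier ext" "proj (hatT k1) \<in> carrier ext"
        "proj (hatT (k \<otimes> k1)) \<in> carrier ext"
      using hat_mult by (simp_all only: ext.hat_closed m_closed)
    have "word_eval ext.E nu_value l = ext.inM (inv\<^bsub>ext\<^esub> proj (hatT k) \<otimes>\<^bsub>ext\<^esub>
        (proj (hatT (k \<otimes> k1)) \<otimes>\<^bsub>ext\<^esub> inv\<^bsub>ext\<^esub> proj (hatT k1)))"
      using hat_mult hats by (simp add: ext.E_inv ext.E_mult)
    also have "inv\<^bsub>ext\<^esub> proj (hatT k) \<otimes>\<^bsub>ext\<^esub> (proj (hatT (k \<otimes> k1)) \<otimes>\<^bsub>ext\<^esub> inv\<^bsub>ext\<^esub> proj (hatT k1))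
        = list_prod ext ?l"
      unfolding ext.hat_mult[OF hat_mult(3-5)] using hats l by (simp only: ext.M.m_assoc
          ext.M.m_closed ext.M.inv_closed ext.M.cancel_left ext.M.r_inv ext.M.r_one)
    finally show ?thesis by (simp only: r)
  next
    case (hat_comm g h)
    then show ?thesis
      using ext.hat_gcomm[of g h] by (simp add: comm int_pow_int inM_pow)
  qed (simp_all add: ext.E_mult comm ext.E_gconj ext.act_pairing ext.act_hat ext.pairing_hat
      ext.E_gcomm_M ext.hat_hat ext.hat_closed)
qed

text \<open>Every element of \<open>\<nu>\<^sup>q(G)\<close> has the form \<open>a b\<^sup>\<phi> \<chi>(t)\<close>, and its image in the extension by the exterior
  square is \<open>(a, b, proj t)\<close>.  So the kernel is the \<open>\<chi>\<close>-image of the diagonal of the tensor square.\<close>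

lemma nu_to_extension:
  obtains \<Psi> where "\<Psi> \<in> hom N ext.E"
    "\<And>g. g \<in> carrier G \<Longrightarrow> \<Psi> (nG g) = ext.inL g" "\<And>g. g \<in> carrier G \<Longrightarrow> \<Psi> (nP g) = ext.inR g"
    "\<And>k. 1 \<le> q \<Longrightarrow> k \<in> carrier G \<Longrightarrow> \<Psi> (nH k) = ext.inM (proj (hatT k))"
    "kernel N ext.E \<Psi> = Delta G q"
proof -
  interpret v: word_evaluation ext.E "nuq_gens G q" nu_value by (rule nu_value_eval)
  obtain \<Psi> where \<Psi>: "\<Psi> \<in> hom N ext.E"
    "\<And>u. u \<in> words (nuq_gens G q) \<Longrightarrow> \<Psi> (ncls u) = word_eval ext.E nu_value u"
    using N.lift_exists[OF nu_value_eval nu_value_rels] by blast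
  interpret \<Psi>: group_hom N ext.E \<Psi>
    by (simp add: \<Psi> group_hom_axioms.intro group_hom_def ext.group_E N.is_group)
  obtain \<Phi> \<chi> where \<Phi>: "\<Phi> \<in> hom T.E N" "\<Phi> ` carrier T.E = carrier N" and \<chi>: "\<chi> \<in> hom T N"
    and tens: "\<And>g h. g \<in> carrier G \<Longrightarrow> h \<in> carrier G \<Longrightarrow> \<chi> (tens g h) = comm g h"
    and hat: "\<And>k. 1 \<le> q \<Longrightarrow> k \<in> carrier G \<Longrightarrow> \<chi> (hatT k) = nH k"
    and eq: "\<And>a b t. \<Phi> (a, b, t) = nG a \<otimes>\<^bsub>N\<^esub> nP b \<otimes>\<^bsub>N\<^esub> \<chi> t"
    by (rule tensor_extension_to_nu) (rule that)
  interpret \<chi>: group_hom T N \<chi>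
    by (simp add: \<chi> group_hom_axioms.intro group_hom_def T.is_group N.is_group)
  have \<Psi>_gen: "\<Psi> (nG g) = ext.inL g" "\<Psi> (nP g) = ext.inR g" if "g \<in> carrier G" for g
    using that by (simp_all add: \<Psi>(2))
  have \<Psi>_hat: "\<Psi> (nH k) = ext.inM (proj (hatT k))" if "1 \<le> q" "k \<in> carrier G" for k
    using that by (simp_all add: \<Psi>(2))
  have \<Psi>\<chi>: "\<Psi> (\<chi> t) = ext.inM (proj t)" if t: "t \<in> carrier T" for t
  proof -
    have "(\<Psi> \<circ> \<chi>) t = ((\<lambda>m. ext.inM m) \<circ> proj) t"
    proof (rule T.hom_eqI[where K = ext.E, OF _ _ _ _ t])
      show "\<Psi> \<circ> \<chi> \<in> hom T ext.E" by (rule Group.hom_compose[OF \<chi> \<Psi>(1)])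
      show "(\<lambda>m. ext.inM m) \<circ> proj \<in> hom T ext.E" by (rule Group.hom_compose[OF proj_hom ext.inM_hom])
      fix s assume "s \<in> qtensor_gens G q"
      then show "(\<Psi> \<circ> \<chi>) (tcls (gen s)) = ((\<lambda>m. ext.inM m) \<circ> proj) (tcls (gen s))"
      proof (cases s)
        case (Tens g h)
        with \<open>s \<in> _\<close> show ?thesis
          using \<Psi>.hom_gcomm[of "nG g" "nP h"] by (simp add: tens comm_def \<Psi>_gen ext.E_gcomm wedge_eq)
      next
        case (Hat k)
        with \<open>s \<in> _\<close> show ?thesis by (simp add: hat \<Psi>_hat)
      qed
    qed (rule ext.E.is_group)
    then show ?thesis by simp
  qed
  have Delta: "Delta G q = \<chi> ` diag"
  proof -
    have "(\<lambda>g. ncls (nu_comm g g)) ` carrier G = \<chi> ` (\<lambda>g. tens g g) ` carrier G"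
      unfolding image_image by (rule image_cong) (simp_all add: tens ncls_nu_comm)
    then show ?thesis
      unfolding Delta_def qdiag_def
      using \<chi>.generate_img[of "(\<lambda>g. tens g g) ` carrier G"] T.pairing_closed by (simp add: image_subset_iff)
  qed
  have diag: "t \<in> carrier T" if "t \<in> diag" for t
    using that subgroup.mem_carrier[OF normal_imp_subgroup[OF diag_normal]] by blast
  have one: "nG \<one> = \<one>\<^bsub>N\<^esub>" "nP \<one> = \<one>\<^bsub>N\<^esub>"
    using nG_hom nP_hom hom_one is_group N.is_group by blast+
  have "kernel N ext.E \<Psi> = \<chi> ` diag"
  proof (intro equalityI subsetI)
    fix A assume "A \<in> kernel N ext.E \<Psi>"
    then have A: "A \<in> carrier N" "\<Psi> A = \<one>\<^bsub>ext.E\<^esub>" by (auto simp: kernel_def)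
    from A(1) \<Phi>(2) obtain x where "x \<in> carrier T.E" "A = \<Phi> x" by blast
    then obtain a b t where abt: "a \<in> carrier G" "b \<in> carrier G" "t \<in> carrier T" "A = \<Phi> (a, b, t)"
      by (cases x) auto
    then have "\<Psi> A = (a, b, proj t)"
      using proj_hom
      by (simp add: eq \<Psi>_gen \<Psi>\<chi> hom_in_carrier flip: ext.E_decompose)
    with A(2) have "(a, b, proj t) = (\<one>, \<one>, \<one>\<^bsub>ext\<^esub>)" by (simp only: ext.E_one)
    then have "a = \<one>" "b = \<one>" "t \<in> diag"
      using proj_eq_one_iff[OF abt(3)] by blast+
    with abt show "A \<in> \<chi> ` diag" by (simp add: eq one)
  next
    fix A assume "A \<in> \<chi> ` diag"
    then obtain t where "t \<in> diag" "A = \<chi> t" by blast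
    with diag[of t] show "A \<in> kernel N ext.E \<Psi>"
      using proj_eq_one_iff[of t] by (simp add: kernel_def \<Psi>\<chi> ext.E_one)
  qed
  then have "kernel N ext.E \<Psi> = Delta G q" by (simp only: Delta)
  with \<Psi>(1) \<Psi>_gen \<Psi>_hat show thesis by (rule that)
qed

end

section \<open>The presentation of \<open>\<tau>\<^sup>q(G)\<close> is polycyclic\<close>

text \<open>The suffixes \<open>vs\<close> in the relations of a polycyclic presentation are described by \<open>later\<close> because it
  behaves well under concatenation and renaming, the operations from which the generators of
  \<open>\<tau>\<^sup>q(G)\<close> are built.\<close>

definition later :: "'x list \<Rightarrow> 'x \<Rightarrow> 'x list \<Rightarrow> bool" where
  "later xs y vs \<longleftrightarrow> (\<exists>us. xs = us @ y # vs)"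

lemma later_set: "later xs y vs \<Longrightarrow> y \<in> set xs \<and> set vs \<subseteq> set xs"
  by (auto simp: later_def)

lemma later_exists: "y \<in> set xs \<Longrightarrow> \<exists>vs. later xs y vs"
  unfolding later_def by (drule split_list) blast

lemma later_append:
  "later (xs @ ys) y vs \<longleftrightarrow> (\<exists>vs'. later xs y vs' \<and> vs = vs' @ ys) \<or> later ys y vs"
proof
  assume "later (xs @ ys) y vs"
  then obtain us where "xs @ ys = us @ y # vs" by (auto simp: later_def)
  then obtain us' where "xs = us @ us' \<and> us' @ ys = y # vs \<or> xs @ us' = us \<and> ys = us' @ y # vs"
    unfolding append_eq_append_conv2 by blast
  then show "(\<exists>vs'. later xs y vs' \<and> vs = vs' @ ys) \<or> later ys y vs"
    unfolding later_def by (cases us') auto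
next
  assume "(\<exists>vs'. later xs y vs' \<and> vs = vs' @ ys) \<or> later ys y vs"
  then show "later (xs @ ys) y vs"
    unfolding later_def by (metis append.assoc append_Cons)
qed

lemma later_map:
  "later (map f xs) y vs \<longleftrightarrow> (\<exists>z ws. later xs z ws \<and> y = f z \<and> vs = map f ws)"
  by (auto simp: later_def map_eq_append_conv Cons_eq_map_conv)

text \<open>The three kinds of relations in \<open>is_pc_presentation\<close>, as a predicate on pairs of words.\<close>

definition pc_relation ::
  "'x list \<Rightarrow> 'x set \<Rightarrow> ('x \<Rightarrow> nat) \<Rightarrow> ('x \<Rightarrow> 'x \<Rightarrow> int) \<Rightarrow> ('x \<Rightarrow> 'x \<Rightarrow> 'x \<Rightarrow> int) \<Rightarrow>
    ('x \<Rightarrow> 'x \<Rightarrow> 'x \<Rightarrow> int) \<Rightarrow> 'x word \<times> 'x word \<Rightarrow> bool" where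
  "pc_relation xs I e \<alpha> \<beta> \<gamma> lr \<longleftrightarrow>
    (\<exists>x vs. later xs x vs \<and> x \<in> I \<and> lr = (wpow (gen x) (int (e x)), pc_word vs (\<alpha> x))) \<or>
    (\<exists>y vs x. later xs y vs \<and> x \<in> set vs \<and>
      lr = (winv (gen y) @ gen x @ gen y, pc_word vs (\<beta> x y))) \<or>
    (\<exists>y vs x. later xs y vs \<and> x \<in> set vs \<and> y \<notin> I \<and>
      lr = (gen y @ gen x @ winv (gen y), pc_word vs (\<gamma> x y)))"

lemma pc_relation_cases [consumes 1, case_names pow conj conj_inv]:
  assumes "pc_relation xs I e \<alpha> \<beta> \<gamma> lr"
  obtains x vs where "later xs x vs" "x \<in> I" "lr = (wpow (gen x) (int (e x)), pc_word vs (\<alpha> x))"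
    | y vs x where "later xs y vs" "x \<in> set vs"
      "lr = (winv (gen y) @ gen x @ gen y, pc_word vs (\<beta> x y))"
    | y vs x where "later xs y vs" "x \<in> set vs" "y \<notin> I"
      "lr = (gen y @ gen x @ winv (gen y), pc_word vs (\<gamma> x y))"
  using assms unfolding pc_relation_def by blast

lemma pc_relationI:
  "\<lbrakk>later xs x vs; x \<in> I; l = wpow (gen x) (int (e x)); r = pc_word vs (\<alpha> x)\<rbrakk> \<Longrightarrow>
    pc_relation xs I e \<alpha> \<beta> \<gamma> (l, r)"
  "\<lbrakk>later xs y vs; x \<in> set vs; l = winv (gen y) @ gen x @ gen y; r = pc_word vs (\<beta> x y)\<rbrakk> \<Longrightarrow>
    pc_relation xs I e \<alpha> \<beta> \<gamma> (l, r)"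
  "\<lbrakk>later xs y vs; x \<in> set vs; y \<notin> I; l = gen y @ gen x @ winv (gen y); r = pc_word vs (\<gamma> x y)\<rbrakk> \<Longrightarrow>
    pc_relation xs I e \<alpha> \<beta> \<gamma> (l, r)"
  unfolding pc_relation_def by blast+

text \<open>Carries the relations of a polycyclic presentation over to a block of generators inside a larger
  presentation: \<open>h vs\<close> is the renamed list \<open>vs\<close> followed by the generators of the later blocks.\<close>

lemma pc_relation_wrename:
  assumes "pc_relation xs I e \<alpha> \<beta> \<gamma> (l, r)"
    and I: "\<And>x. f x \<in> I' \<longleftrightarrow> x \<in> I" and e: "\<And>x. e' (f x) = e x"
    and later: "\<And>x vs. later xs x vs \<Longrightarrow> later xs' (f x) (h vs) \<and> f ` set vs \<subseteq> set (h vs)"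
    and exps: "\<And>x vs. later xs x vs \<Longrightarrow> pc_word (h vs) (\<alpha>' (f x)) = wrename f (pc_word vs (\<alpha> x))"
      "\<And>x y vs. later xs y vs \<Longrightarrow> pc_word (h vs) (\<beta>' (f x) (f y)) = wrename f (pc_word vs (\<beta> x y))"
      "\<And>x y vs. later xs y vs \<Longrightarrow> pc_word (h vs) (\<gamma>' (f x) (f y)) = wrename f (pc_word vs (\<gamma> x y))"
  shows "pc_relation xs' I' e' \<alpha>' \<beta>' \<gamma>' (wrename f l, wrename f r)"
  using assms(1)
proof (cases rule: pc_relation_cases)
  case (pow x vs)
  with later[of x vs] exps show ?thesis
    by (intro pc_relationI(1)[of xs' "f x" "h vs"]) (simp_all add: I e)
next
  case (conj y vs x)
  with later[of y vs] exps show ?thesis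
    by (intro pc_relationI(2)[of xs' "f y" "h vs" "f x"]) auto
next
  case (conj_inv y vs x)
  with later[of y vs] exps show ?thesis
    by (intro pc_relationI(3)[of xs' "f y" "h vs" "f x"]) (auto simp: I)
qed

lemma is_pc_presentation_iff:
  "is_pc_presentation P \<longleftrightarrow>
    distinct (pc_gens P) \<and> pc_index P \<subseteq> set (pc_gens P) \<and> (\<forall>x\<in>pc_index P. 0 < pc_exp P x) \<and>
    (\<exists>\<alpha> \<beta> \<gamma>. pc_rels P = Collect (pc_relation (pc_gens P) (pc_index P) (pc_exp P) \<alpha> \<beta> \<gamma>))"
proof -
  have "Collect (pc_relation (pc_gens P) (pc_index P) (pc_exp P) \<alpha> \<beta> \<gamma>) =
        {(wpow (gen x) (int (pc_exp P x)), pc_word vs (\<alpha> x)) |us x vs.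
            pc_gens P = us @ x # vs \<and> x \<in> pc_index P} \<union>
        {(winv (gen y) @ gen x @ gen y, pc_word vs (\<beta> x y)) |us y vs x.
            pc_gens P = us @ y # vs \<and> x \<in> set vs} \<union>
        {(gen y @ gen x @ winv (gen y), pc_word vs (\<gamma> x y)) |us y vs x.
            pc_gens P = us @ y # vs \<and> x \<in> set vs \<and> y \<notin> pc_index P}" for \<alpha> \<beta> \<gamma>
    unfolding pc_relation_def later_def by (rule Set.set_eqI) (simp only: mem_Collect_eq Un_iff, blast)
  then show ?thesis by (simp only: is_pc_presentation_def)
qed

fun tau_pow_exps :: "('x \<Rightarrow> 'x \<Rightarrow> int) \<Rightarrow> ('y \<Rightarrow> 'y \<Rightarrow> int) \<Rightarrow>
    ('x, 'y) tau_sym \<Rightarrow> ('x, 'y) tau_sym \<Rightarrow> int" where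
  "tau_pow_exps a b (TG x) = case_tau_sym (a x) (\<lambda>_. 0) (\<lambda>_. 0)"
| "tau_pow_exps a b (TP x) = case_tau_sym (\<lambda>_. 0) (a x) (\<lambda>_. 0)"
| "tau_pow_exps a b (TW y) = case_tau_sym (\<lambda>_. 0) (\<lambda>_. 0) (b y)"

text \<open>The parameters \<open>a\<close> and \<open>b\<close> describe conjugates within one block of generators, \<open>c\<close> and \<open>d\<close> the
  exterior square parts of the conjugates of \<open>TP\<close> and \<open>TW\<close> symbols by symbols of earlier blocks.  The
  last equation is for symbols conjugated by a symbol of a later block, which no relation does.\<close>

fun tau_conj_exps :: "('x \<Rightarrow> 'x \<Rightarrow> 'x \<Rightarrow> int) \<Rightarrow> ('y \<Rightarrow> 'y \<Rightarrow> 'y \<Rightarrow> int) \<Rightarrow> ('x \<Rightarrow> 'x \<Rightarrow> 'y \<Rightarrow> int) \<Rightarrow>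
    ('y \<Rightarrow> 'x \<Rightarrow> 'y \<Rightarrow> int) \<Rightarrow> ('x, 'y) tau_sym \<Rightarrow> ('x, 'y) tau_sym \<Rightarrow> ('x, 'y) tau_sym \<Rightarrow> int" where
  "tau_conj_exps a b c d (TG x) (TG y) = case_tau_sym (a x y) (\<lambda>_. 0) (\<lambda>_. 0)"
| "tau_conj_exps a b c d (TP x) (TP y) = case_tau_sym (\<lambda>_. 0) (a x y) (\<lambda>_. 0)"
| "tau_conj_exps a b c d (TW x) (TW y) = case_tau_sym (\<lambda>_. 0) (\<lambda>_. 0) (b x y)"
| "tau_conj_exps a b c d (TP x) (TG y) = case_tau_sym (\<lambda>_. 0) (\<lambda>z. if z = x then 1 else 0) (c x y)"
| "tau_conj_exps a b c d (TW x) (TG y) = case_tau_sym (\<lambda>_. 0) (\<lambda>_. 0) (d x y)"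
| "tau_conj_exps a b c d (TW x) (TP y) = case_tau_sym (\<lambda>_. 0) (\<lambda>_. 0) (d x y)"
| "tau_conj_exps a b c d s t = (\<lambda>_. 0)"

lemma pc_word_const_0 [simp]: "pc_word xs (\<lambda>_. 0) = []"
  by (rule pc_word_zero) simp

locale tau_setup = q_squares G q + P: consistently_presented G P g + Q: consistently_presented "qext G q" Q w
  for G :: "('a, 'b) monoid_scheme" (structure) and q
    and P :: "'x pc_presentation" and g :: "'x \<Rightarrow> 'a"
    and Q :: "'y pc_presentation" and w :: "'y \<Rightarrow> 'a qext_elem"
begin

abbreviation "tpres \<equiv> tau_pres G q P g Q w"
abbreviation "trels \<equiv> tau_rels G q P g Q w"
abbreviation "Wword \<equiv> tau_W_word G q Q w"
abbreviation "tgens \<equiv> map TG (pc_gens P) @ map TP (pc_gens P) @ map TW (pc_gens Q)"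
abbreviation "tindex \<equiv> TG ` pc_index P \<union> TP ` pc_index P \<union> TW ` pc_index Q"
abbreviation "texp \<equiv> case_tau_sym (pc_exp P) (pc_exp P) (pc_exp Q)"

definition nf_exps :: "'a qext_elem \<Rightarrow> 'y \<Rightarrow> int" where
  "nf_exps v = (THE a. a \<in> nf_exponents Q \<and> word_eval ext w (pc_word (pc_gens Q) a) = v)"

lemma Wword_eq: "Wword v = wrename TW (pc_word (pc_gens Q) (nf_exps v))"
  by (simp add: tau_W_word_def nf_word_def nf_exps_def)

lemma later_tgens:
  "later tgens y vs \<longleftrightarrow>
    (\<exists>z ws. later (pc_gens P) z ws \<and> y = TG z \<and>
      vs = map TG ws @ map TP (pc_gens P) @ map TW (pc_gens Q)) \<or>
    (\<exists>z ws. later (pc_gens P) z ws \<and> y = TP z \<and> vs = map TP ws @ map TW (pc_gens Q)) \<or>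
    (\<exists>z ws. later (pc_gens Q) z ws \<and> y = TW z \<and> vs = map TW ws)"
  by (auto simp: later_append later_map)

text \<open>Every word on the right-hand side of a relation of \<open>\<tau>\<^sup>q(G)\<close> is a product of powers of later generators,
  once it is padded with zero exponents in the blocks that it does not involve.  The rules \<open>T1\<close>,
  \<open>T2\<close>, \<open>T3\<close> give the pairs within one block, \<open>T4\<close> and \<open>T4_inv\<close> the pairs of a \<open>TG\<close> and a \<open>TP\<close> symbol, and the
  remaining rules the pairs of a \<open>TW\<close> symbol and one of an earlier block; so no pair is missing and none
  occurs twice.\<close>

lemma tau_rels_pc_relation:
  assumes P: "pc_rels P = Collect (pc_relation (pc_gens P) (pc_index P) (pc_exp P) \<alpha> \<beta> \<gamma>)"
    and Q: "pc_rels Q = Collect (pc_relation (pc_gens Q) (pc_index Q) (pc_exp Q) \<alpha>' \<beta>' \<gamma>')"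
  defines "C \<equiv> \<lambda>z x' x. nf_exps (inv\<^bsub>ext\<^esub> lam G q (z x) (g x') \<one>)"
    and "D \<equiv> \<lambda>z y x. nf_exps (qext_act G q (z x) (w y))"
  shows "trels = Collect (pc_relation tgens tindex texp (tau_pow_exps \<alpha> \<alpha>')
    (tau_conj_exps \<beta> \<beta>' (C g) (D g)) (tau_conj_exps \<gamma> \<gamma>' (C (\<lambda>x. inv g x)) (D (\<lambda>x. inv g x))))"
    (is "_ = Collect ?R")
proof (intro equalityI subsetI)
  note simps = pc_word_append pc_word_map comp_def Wword_eq C_def D_def
  fix lr assume "lr \<in> trels"
  then obtain l0 r0 where lr: "(l0, r0) \<in> trels" "lr = (l0, r0)" by (cases lr) blast
  have distinct: "distinct (pc_gens P)" using P.pc by (simp add: is_pc_presentation_def)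
  have laterG: "later tgens (TG z) (map TG ws @ map TP (pc_gens P) @ map TW (pc_gens Q)) \<and>
      TG ` set ws \<subseteq> set (map TG ws @ map TP (pc_gens P) @ map TW (pc_gens Q))"
    and laterP: "later tgens (TP z) (map TP ws @ map TW (pc_gens Q)) \<and>
      TP ` set ws \<subseteq> set (map TP ws @ map TW (pc_gens Q))"
    if "later (pc_gens P) z ws" for z ws
    using that by (auto simp: later_tgens)
  have laterW: "later tgens (TW z) (map TW ws) \<and> TW ` set ws \<subseteq> set (map TW ws)"
    if "later (pc_gens Q) z ws" for z ws
    using that by (auto simp: later_tgens)
  have "?R (l0, r0)"
    using lr(1)
  proof (cases rule: tau_rels.cases)
    case (T1 l r)
    have rel: "pc_relation (pc_gens P) (pc_index P) (pc_exp P) \<alpha> \<beta> \<gamma> (l, r)"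
      using T1(3) by (simp add: P)
    show ?thesis unfolding T1(1,2)
      by (rule pc_relation_wrename[OF rel _ _ laterG]; auto simp: simps)
  next
    case (T2 l r)
    have rel: "pc_relation (pc_gens P) (pc_index P) (pc_exp P) \<alpha> \<beta> \<gamma> (l, r)"
      using T2(3) by (simp add: P)
    show ?thesis unfolding T2(1,2)
      by (rule pc_relation_wrename[OF rel _ _ laterP]; auto simp: simps)
  next
    case (T3 l r)
    have rel: "pc_relation (pc_gens Q) (pc_index Q) (pc_exp Q) \<alpha>' \<beta>' \<gamma>' (l, r)"
      using T3(3) by (simp add: Q)
    show ?thesis unfolding T3(1,2)
      by (rule pc_relation_wrename[OF rel _ _ laterW]; auto simp: simps)
  next
    case (T4 x x')
    obtain ws where ws: "later (pc_gens P) x ws" using later_exists[OF T4(3)] by blast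
    show ?thesis unfolding T4(1,2)
      by (rule pc_relationI(2)[OF conjunct1[OF laterG[OF ws]], of "TP x'"])
        (use T4 in \<open>simp_all add: simps pc_word_single distinct\<close>)
  next
    case (T4_inv x x')
    obtain ws where ws: "later (pc_gens P) x ws" using later_exists[OF T4_inv(3)] by blast
    show ?thesis unfolding T4_inv(1,2)
      by (rule pc_relationI(3)[OF conjunct1[OF laterG[OF ws]], of "TP x'"])
        (use T4_inv in \<open>auto simp: simps pc_word_single distinct\<close>)
  next
    case (T5_G y x)
    obtain ws where ws: "later (pc_gens P) x ws" using later_exists[OF T5_G(4)] by blast
    show ?thesis unfolding T5_G(1,2)
      by (rule pc_relationI(2)[OF conjunct1[OF laterG[OF ws]], of "TW y"])
        (use T5_G in \<open>simp_all add: simps\<close>)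
  next
    case (T5_phi y x)
    obtain ws where ws: "later (pc_gens P) x ws" using later_exists[OF T5_phi(4)] by blast
    show ?thesis unfolding T5_phi(1,2)
      by (rule pc_relationI(2)[OF conjunct1[OF laterP[OF ws]], of "TW y"])
        (use T5_phi in \<open>simp_all add: simps\<close>)
  next
    case (T5_G_inv y x)
    obtain ws where ws: "later (pc_gens P) x ws" using later_exists[OF T5_G_inv(4)] by blast
    show ?thesis unfolding T5_G_inv(1,2)
      by (rule pc_relationI(3)[OF conjunct1[OF laterG[OF ws]], of "TW y"])
        (use T5_G_inv in \<open>auto simp: simps\<close>)
  next
    case (T5_phi_inv y x)
    obtain ws where ws: "later (pc_gens P) x ws" using later_exists[OF T5_phi_inv(4)] by blast
    show ?thesis unfolding T5_phi_inv(1,2)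
      by (rule pc_relationI(3)[OF conjunct1[OF laterP[OF ws]], of "TW y"])
        (use T5_phi_inv in \<open>auto simp: simps\<close>)
  qed
  then show "lr \<in> Collect ?R" by (simp add: lr(2))
next
  note simps = pc_word_append pc_word_map comp_def Wword_eq C_def D_def
  have distinct: "distinct (pc_gens P)" using P.pc by (simp add: is_pc_presentation_def)
  have T123: "pc_relation (pc_gens P) (pc_index P) (pc_exp P) \<alpha> \<beta> \<gamma> lr \<Longrightarrow>
      (wrename TG (fst lr), wrename TG (snd lr)) \<in> trels"
    "pc_relation (pc_gens P) (pc_index P) (pc_exp P) \<alpha> \<beta> \<gamma> lr \<Longrightarrow>
      (wrename TP (fst lr), wrename TP (snd lr)) \<in> trels"
    "pc_relation (pc_gens Q) (pc_index Q) (pc_exp Q) \<alpha>' \<beta>' \<gamma>' lr' \<Longrightarrow>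
      (wrename TW (fst lr'), wrename TW (snd lr')) \<in> trels" for lr lr'
    by (auto intro!: tau_rels.T1 tau_rels.T2 tau_rels.T3 simp: P Q)
  fix lr assume "lr \<in> Collect ?R"
  then have "?R lr" by simp
  then show "lr \<in> trels"
  proof (cases rule: pc_relation_cases)
    case (pow s vs)
    from pow(1)[unfolded later_tgens] show ?thesis
    proof (elim disjE exE conjE)
      fix z ws assume *: "later (pc_gens P) z ws" "s = TG z"
        "vs = map TG ws @ map TP (pc_gens P) @ map TW (pc_gens Q)"
      then show ?thesis using pow(2,3) T123(1)[OF pc_relationI(1)[OF *(1) _ HOL.refl HOL.refl]]
        by (auto simp: simps)
    next
      fix z ws assume *: "later (pc_gens P) z ws" "s = TP z" "vs = map TP ws @ map TW (pc_gens Q)"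
      then show ?thesis using pow(2,3) T123(2)[OF pc_relationI(1)[OF *(1) _ HOL.refl HOL.refl]]
        by (auto simp: simps)
    next
      fix z ws assume *: "later (pc_gens Q) z ws" "s = TW z" "vs = map TW ws"
      then show ?thesis using pow(2,3) T123(3)[OF pc_relationI(1)[OF *(1) _ HOL.refl HOL.refl]]
        by (auto simp: simps)
    qed
  next
    case (conj s vs t)
    from conj(1)[unfolded later_tgens] show ?thesis
    proof (elim disjE exE conjE)
      fix z ws assume *: "later (pc_gens P) z ws" "s = TG z"
        "vs = map TG ws @ map TP (pc_gens P) @ map TW (pc_gens Q)"
      note z = later_set[OF *(1)]
      from conj(2) * consider x where "t = TG x" "x \<in> set ws" | x where "t = TP x" "x \<in> set (pc_gens P)"
        | y where "t = TW y" "y \<in> set (pc_gens Q)" by auto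
      then show ?thesis
      proof cases
        case 1
        then show ?thesis using * conj(3) T123(1)[OF pc_relationI(2)[OF *(1) _ HOL.refl HOL.refl]]
          by (simp add: simps)
      next
        case 2
        then show ?thesis using * z conj(3) tau_rels.T4[where x = z and P = P and G = G and q = q and g = g and Q = Q and w = w]
          by (simp add: simps pc_word_single distinct)
      next
        case 3
        then show ?thesis using * z conj(3) tau_rels.T5_G[where x = z and P = P and G = G and q = q and g = g and Q = Q and w = w] by (simp add: simps)
      qed
    next
      fix z ws assume *: "later (pc_gens P) z ws" "s = TP z" "vs = map TP ws @ map TW (pc_gens Q)"
      note z = later_set[OF *(1)]
      from conj(2) * consider x where "t = TP x" "x \<in> set ws"
        | y where "t = TW y" "y \<in> set (pc_gens Q)" by auto
      then show ?thesis
      proof cases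
        case 1
        then show ?thesis using * conj(3) T123(2)[OF pc_relationI(2)[OF *(1) _ HOL.refl HOL.refl]]
          by (simp add: simps)
      next
        case 2
        then show ?thesis using * z conj(3) tau_rels.T5_phi[where x = z and P = P and G = G and q = q and g = g and Q = Q and w = w] by (simp add: simps)
      qed
    next
      fix z ws assume *: "later (pc_gens Q) z ws" "s = TW z" "vs = map TW ws"
      then obtain y where "t = TW y" "y \<in> set ws" using conj(2) by auto
      then show ?thesis using * conj(3) T123(3)[OF pc_relationI(2)[OF *(1) _ HOL.refl HOL.refl]]
        by (simp add: simps)
    qed
  next
    case (conj_inv s vs t)
    from conj_inv(1)[unfolded later_tgens] show ?thesis
    proof (elim disjE exE conjE)
      fix z ws assume *: "later (pc_gens P) z ws" "s = TG z"
        "vs = map TG ws @ map TP (pc_gens P) @ map TW (pc_gens Q)"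
      note z = later_set[OF *(1)]
      have zI: "z \<notin> pc_index P" using conj_inv(3) *(2) by auto
      from conj_inv(2) * consider x where "t = TG x" "x \<in> set ws" | x where "t = TP x" "x \<in> set (pc_gens P)"
        | y where "t = TW y" "y \<in> set (pc_gens Q)" by auto
      then show ?thesis
      proof cases
        case 1
        then show ?thesis using * zI conj_inv(4) T123(1)[OF pc_relationI(3)[OF *(1) _ _ HOL.refl HOL.refl]]
          by (simp add: simps)
      next
        case 2
        then show ?thesis using * z zI conj_inv(4) tau_rels.T4_inv[where x = z and P = P and G = G and q = q and g = g and Q = Q and w = w]
          by (simp add: simps pc_word_single distinct)
      next
        case 3
        then show ?thesis using * z zI conj_inv(4) tau_rels.T5_G_inv[where x = z and P = P and G = G and q = q and g = g and Q = Q and w = w] by (simp add: simps)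
      qed
    next
      fix z ws assume *: "later (pc_gens P) z ws" "s = TP z" "vs = map TP ws @ map TW (pc_gens Q)"
      note z = later_set[OF *(1)]
      have zI: "z \<notin> pc_index P" using conj_inv(3) *(2) by auto
      from conj_inv(2) * consider x where "t = TP x" "x \<in> set ws"
        | y where "t = TW y" "y \<in> set (pc_gens Q)" by auto
      then show ?thesis
      proof cases
        case 1
        then show ?thesis using * zI conj_inv(4) T123(2)[OF pc_relationI(3)[OF *(1) _ _ HOL.refl HOL.refl]]
          by (simp add: simps)
      next
        case 2
        then show ?thesis using * z zI conj_inv(4) tau_rels.T5_phi_inv[where x = z and P = P and G = G and q = q and g = g and Q = Q and w = w] by (simp add: simps)
      qed
    next
      fix z ws assume *: "later (pc_gens Q) z ws" "s = TW z" "vs = map TW ws"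
      have zI: "z \<notin> pc_index Q" using conj_inv(3) *(2) by auto
      from * obtain y where "t = TW y" "y \<in> set ws" using conj_inv(2) by auto
      then show ?thesis using * zI conj_inv(4) T123(3)[OF pc_relationI(3)[OF *(1) _ _ HOL.refl HOL.refl]]
        by (simp add: simps)
    qed
  qed
qed

end

context tau_setup
begin

lemma tpres_simps [simp]:
  "pc_gens tpres = tgens" "pc_index tpres = tindex" "pc_exp tpres = texp" "pc_rels tpres = trels"
  by (simp_all add: tau_pres_def)

lemma tau_pc_presentation: "is_pc_presentation tpres"
proof -
  obtain \<alpha> \<beta> \<gamma> where P: "distinct (pc_gens P)" "pc_index P \<subseteq> set (pc_gens P)" "\<forall>x\<in>pc_index P. 0 < pc_exp P x"
    "pc_rels P = Collect (pc_relation (pc_gens P) (pc_index P) (pc_exp P) \<alpha> \<beta> \<gamma>)"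
    using P.pc unfolding is_pc_presentation_iff by (elim conjE exE) (rule that)
  obtain \<alpha>' \<beta>' \<gamma>' where Q: "distinct (pc_gens Q)" "pc_index Q \<subseteq> set (pc_gens Q)" "\<forall>x\<in>pc_index Q. 0 < pc_exp Q x"
    "pc_rels Q = Collect (pc_relation (pc_gens Q) (pc_index Q) (pc_exp Q) \<alpha>' \<beta>' \<gamma>')"
    using Q.pc unfolding is_pc_presentation_iff by (elim conjE exE) (rule that)
  have "distinct tgens"
    using P(1) Q(1) by (auto simp: distinct_map inj_on_def)
  moreover have "tindex \<subseteq> set tgens" using P(2) Q(2) by auto
  moreover have "\<forall>x\<in>tindex. 0 < texp x" using P(3) Q(3) by auto
  ultimately show ?thesis
    unfolding is_pc_presentation_iff tpres_simps tau_rels_pc_relation[OF P(4) Q(4)] by blast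
qed

section \<open>Comparison of \<open>\<tau>\<^sup>q(G)\<close> with the extension\<close>

abbreviation "tau_group \<equiv> tau G q P g Q w"
abbreviation "tau_cls \<equiv> tau_class G q P g Q w"

sublocale tau: presentation "set (pc_gens tpres)" "pc_rels tpres"
  rewrites "presented_group (set (pc_gens tpres)) (pc_rels tpres) = tau_group"
    and "pres_class (set (pc_gens tpres)) (pc_rels tpres) = tau_cls"
  by (simp_all only: tau_def pc_group_def tau_class_def pc_class_def)

fun tau_value :: "('x, 'y) tau_sym \<Rightarrow> 'a \<times> 'a \<times> 'a qext_elem" where
  "tau_value (TG x) = ext.inL (g x)"
| "tau_value (TP x) = ext.inR (g x)"
| "tau_value (TW y) = ext.inM (w y)"

sublocale tv: word_evaluation ext.E "set (pc_gens tpres)" tau_value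
proof (intro word_evaluation.intro word_evaluation_axioms.intro ext.group_E)
  fix s assume "s \<in> set (pc_gens tpres)"
  then show "tau_value s \<in> carrier ext.E" by auto
qed

abbreviation "tval \<equiv> word_eval ext.E tau_value"

lemma tval_wrename:
  "u \<in> words (set (pc_gens P)) \<Longrightarrow> tval (wrename TG u) = ext.inL (word_eval G g u)"
  "u \<in> words (set (pc_gens P)) \<Longrightarrow> tval (wrename TP u) = ext.inR (word_eval G g u)"
  "v \<in> words (set (pc_gens Q)) \<Longrightarrow> tval (wrename TW v) = ext.inM (word_eval ext w v)"
  using hom_word_eval[OF P.word_evaluation_axioms ext.group_E ext.inL_hom]
    hom_word_eval[OF P.word_evaluation_axioms ext.group_E ext.inR_hom]
    hom_word_eval[OF Q.word_evaluation_axioms ext.group_E ext.inM_hom]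
  by (simp_all add: word_eval_wrename comp_def)

abbreviation "tset \<equiv> TG ` set (pc_gens P) \<union> (TP ` set (pc_gens P) \<union> TW ` set (pc_gens Q))"

lemma words_wrename_tau [simp]:
  "u \<in> words (set (pc_gens P)) \<Longrightarrow> wrename TG u \<in> words tset"
  "u \<in> words (set (pc_gens P)) \<Longrightarrow> wrename TP u \<in> words tset"
  "v \<in> words (set (pc_gens Q)) \<Longrightarrow> wrename TW v \<in> words tset"
  by (auto elim!: words_wrename)

lemma words_Wword [simp]: "Wword v \<in> words tset"
  by (simp add: tau_W_word_def)

lemma tval_Wword: "v \<in> carrier ext \<Longrightarrow> tval (Wword v) = ext.inM v"
  by (simp add: tau_W_word_def tval_wrename Q.eval_nf_word)

lemma tval_conj:
  assumes "s \<in> set (pc_gens tpres)" "t \<in> set (pc_gens tpres)"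
  shows "tval (winv (gen s) @ gen t @ gen s) = gconj ext.E (tau_value t) (tau_value s)"
    and "tval (gen s @ gen t @ winv (gen s)) = gconj ext.E (tau_value t) (inv\<^bsub>ext.E\<^esub> tau_value s)"
proof -
  have "gen s \<in> words (set (pc_gens tpres))" "gen t \<in> words (set (pc_gens tpres))"
    "tau_value s \<in> carrier ext.E" "tau_value t \<in> carrier ext.E"
    using assms by (simp_all only: words_gen tv.gen_value_closed)
  then show "tval (winv (gen s) @ gen t @ gen s) = gconj ext.E (tau_value t) (tau_value s)"
    "tval (gen s @ gen t @ winv (gen s)) = gconj ext.E (tau_value t) (inv\<^bsub>ext.E\<^esub> tau_value s)"
    using assms
    by (simp_all only: words_append words_winv tv.eval_append tv.eval_winv tv.eval_gen gconj_def
        ext.E.m_assoc ext.E.m_closed ext.E.inv_closed ext.E.inv_inv simp_thms)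
qed

lemma tval_TP_Wword:
  assumes "x \<in> set (pc_gens P)" "v \<in> carrier ext"
  shows "tval (gen (TP x) @ Wword v) = (\<one>, g x, v)"
proof -
  have s: "TP x \<in> set (pc_gens tpres)" using assms by simp
  have "tval (gen (TP x) @ Wword v) = tval (gen (TP x)) \<otimes>\<^bsub>ext.E\<^esub> tval (Wword v)"
    using s by (intro tv.eval_append) simp_all
  also have "\<dots> = ext.inR (g x) \<otimes>\<^bsub>ext.E\<^esub> ext.inM v"
    using s assms by (simp only: tv.eval_gen tval_Wword tau_value.simps)
  also have "\<dots> = (\<one>, g x, v)" using assms by (simp add: ext.E_mult)
  finally show ?thesis .
qed

lemma tval_rels:
  assumes "(l, r) \<in> trels"
  shows "tval l = tval r"
  using assms
proof (cases rule: tau_rels.cases)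
  case (T1 l' r')
  then show ?thesis
    using is_pc_presentation_words[OF P.pc T1(3)] P.relation_holds[OF T1(3)] by (simp add: tval_wrename)
next
  case (T2 l' r')
  then show ?thesis
    using is_pc_presentation_words[OF P.pc T2(3)] P.relation_holds[OF T2(3)] by (simp add: tval_wrename)
next
  case (T3 l' r')
  then show ?thesis
    using is_pc_presentation_words[OF Q.pc T3(3)] Q.relation_holds[OF T3(3)] by (simp add: tval_wrename)
next
  case (T4 x x')
  have l: "tval l = gconj ext.E (tau_value (TP x')) (tau_value (TG x))"
    unfolding T4(1) by (rule tval_conj(1)) (use T4 in auto)
  show ?thesis
    unfolding l unfolding T4(2) using T4(3-)
    by (simp del: tv.eval_append add: tval_TP_Wword ext.E_gconj lam_wedge)
next
  case (T4_inv x x')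
  have l: "tval l = gconj ext.E (tau_value (TP x')) (inv\<^bsub>ext.E\<^esub> tau_value (TG x))"
    unfolding T4_inv(1) by (rule tval_conj(2)) (use T4_inv in auto)
  show ?thesis
    unfolding l unfolding T4_inv(2) using T4_inv(3-)
    by (simp del: tv.eval_append add: tval_TP_Wword ext.E_inv ext.E_gconj lam_wedge)
next
  case (T5_G y x)
  have l: "tval l = gconj ext.E (tau_value (TW y)) (tau_value (TG x))"
    unfolding T5_G(1) by (rule tval_conj(1)) (use T5_G in auto)
  show ?thesis
    unfolding l unfolding T5_G(2) using T5_G(3-)
    by (simp add: tval_Wword ext.E_gconj)
next
  case (T5_phi y x)
  have l: "tval l = gconj ext.E (tau_value (TW y)) (tau_value (TP x))"
    unfolding T5_phi(1) by (rule tval_conj(1)) (use T5_phi in auto)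
  show ?thesis
    unfolding l unfolding T5_phi(2) using T5_phi(3-)
    by (simp add: tval_Wword ext.E_gconj)
next
  case (T5_G_inv y x)
  have l: "tval l = gconj ext.E (tau_value (TW y)) (inv\<^bsub>ext.E\<^esub> tau_value (TG x))"
    unfolding T5_G_inv(1) by (rule tval_conj(2)) (use T5_G_inv in auto)
  show ?thesis
    unfolding l unfolding T5_G_inv(2) using T5_G_inv(3-)
    by (simp add: tval_Wword ext.E_inv ext.E_gconj)
next
  case (T5_phi_inv y x)
  have l: "tval l = gconj ext.E (tau_value (TW y)) (inv\<^bsub>ext.E\<^esub> tau_value (TP x))"
    unfolding T5_phi_inv(1) by (rule tval_conj(2)) (use T5_phi_inv in auto)
  show ?thesis
    unfolding l unfolding T5_phi_inv(2) using T5_phi_inv(3-)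
    by (simp add: tval_Wword ext.E_inv ext.E_gconj)
qed

lemma tval_parts:
  assumes "u \<in> words (set (pc_gens P))" "v \<in> words (set (pc_gens P))" "z \<in> words (set (pc_gens Q))"
  shows "tval (wrename TG u @ wrename TP v @ wrename TW z) =
    (word_eval G g u, word_eval G g v, word_eval ext w z)"
proof -
  have "tval (wrename TG u @ wrename TP v @ wrename TW z) =
      tval (wrename TG u) \<otimes>\<^bsub>ext.E\<^esub> (tval (wrename TP v) \<otimes>\<^bsub>ext.E\<^esub> tval (wrename TW z))"
    using assms by (simp add: tv.eval_append)
  then show ?thesis using assms by (simp add: tval_wrename ext.E_mult)
qed

lemma pc_word_tgens:
  "pc_word tgens a = wrename TG (pc_word (pc_gens P) (a \<circ> TG)) @
    wrename TP (pc_word (pc_gens P) (a \<circ> TP)) @ wrename TW (pc_word (pc_gens Q) (a \<circ> TW))"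
  by (simp add: pc_word_append pc_word_map)

text \<open>Normal form words of the presentation of \<open>\<tau>\<^sup>q(G)\<close> are triples of normal form words, and
  their values in the extension are the triples of values.\<close>

lemma tval_nf_inj:
  assumes "a \<in> nf_exponents tpres" "b \<in> nf_exponents tpres"
    and "tval (pc_word tgens a) = tval (pc_word tgens b)"
  shows "a = b"
proof
  have nf: "c \<circ> TG \<in> nf_exponents P" "c \<circ> TP \<in> nf_exponents P" "c \<circ> TW \<in> nf_exponents Q"
    if c: "c \<in> nf_exponents tpres" for c
  proof -
    have 1: "0 \<le> c s \<and> c s < int (texp s)" if "s \<in> tindex" for s
      using c that unfolding nf_exponents_def tpres_simps by blast
    have 2: "c s = 0" if "s \<notin> set tgens" for s
      using c that unfolding nf_exponents_def tpres_simps by blast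
    show "c \<circ> TG \<in> nf_exponents P" "c \<circ> TP \<in> nf_exponents P" "c \<circ> TW \<in> nf_exponents Q"
      using 1[of "TG _"] 1[of "TP _"] 1[of "TW _"] 2[of "TG _"] 2[of "TP _"] 2[of "TW _"]
      by (simp_all add: nf_exponents_def image_iff)
  qed
  from assms(3) have "word_eval G g (pc_word (pc_gens P) (a \<circ> TG)) = word_eval G g (pc_word (pc_gens P) (b \<circ> TG))"
    "word_eval G g (pc_word (pc_gens P) (a \<circ> TP)) = word_eval G g (pc_word (pc_gens P) (b \<circ> TP))"
    "word_eval ext w (pc_word (pc_gens Q) (a \<circ> TW)) = word_eval ext w (pc_word (pc_gens Q) (b \<circ> TW))"
    by (simp_all add: pc_word_tgens tval_parts del: tv.eval_append)
  then have "a \<circ> TG = b \<circ> TG" "a \<circ> TP = b \<circ> TP" "a \<circ> TW = b \<circ> TW"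
    using P.nf_exponents_eqI Q.nf_exponents_eqI nf assms(1,2) by blast+
  then show "a s = b s" for s by (cases s) (simp_all add: fun_eq_iff)
qed

text \<open>Surjectivity is clear from \<open>tval_parts\<close>.  Injectivity holds because every element is the class of some
  normal form word, and distinct ones have distinct values.\<close>

lemma tau_iso:
  obtains \<Theta> where "\<Theta> \<in> iso tau_group ext.E"
    "\<And>u. u \<in> words (set tgens) \<Longrightarrow> \<Theta> (tau_cls u) = tval u"
proof -
  obtain \<Theta> where \<Theta>: "\<Theta> \<in> hom tau_group ext.E"
    "\<And>u. u \<in> words (set tgens) \<Longrightarrow> \<Theta> (tau_cls u) = tval u"
    using tau.lift_exists[OF tv.word_evaluation_axioms] tval_rels by (metis tpres_simps(1,4))
  have nf: "\<exists>a\<in>nf_exponents tpres. A = tau_cls (pc_word tgens a)" if "A \<in> carrier tau_group" for A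
    using pc_group_normal_form_exists[OF tau_pc_presentation, of A] that
    unfolding tau_def tau_class_def tpres_simps by metis
  have words: "pc_word tgens a \<in> words (set tgens)" for a by simp
  have "inj_on \<Theta> (carrier tau_group)"
  proof (rule inj_onI)
    fix A B assume AB: "A \<in> carrier tau_group" "B \<in> carrier tau_group" "\<Theta> A = \<Theta> B"
    obtain a b where "a \<in> nf_exponents tpres" "A = tau_cls (pc_word tgens a)"
      "b \<in> nf_exponents tpres" "B = tau_cls (pc_word tgens b)"
      using nf[OF AB(1)] nf[OF AB(2)] by blast
    with AB(3) show "A = B" using tval_nf_inj \<Theta>(2)[OF words] by metis
  qed
  moreover have "x \<in> \<Theta> ` carrier tau_group" if x: "x \<in> carrier ext.E" for x
  proof -
    obtain a b m where abm: "x = (a, b, m)" by (cases x)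
    with x have "a \<in> carrier G" "b \<in> carrier G" "m \<in> carrier ext" by auto
    then obtain u v z where u: "u \<in> words (set (pc_gens P))" "word_eval G g u = a"
      and v: "v \<in> words (set (pc_gens P))" "word_eval G g v = b"
      and z: "z \<in> words (set (pc_gens Q))" "word_eval ext w z = m"
      using P.eval_surj Q.eval_surj by metis
    let ?y = "wrename TG u @ wrename TP v @ wrename TW z"
    have y: "?y \<in> words (set tgens)" using u v z by simp
    have "\<Theta> (tau_cls ?y) = x" using \<Theta>(2)[OF y] tval_parts[of u v z] u v z abm by simp
    moreover have "tau_cls ?y \<in> carrier tau_group" using y tau.cls_closed by simp
    ultimately show ?thesis by blast
  qed
  ultimately have "\<Theta> \<in> iso tau_group ext.E"
    using \<Theta>(1) hom_in_carrier[OF \<Theta>(1)] by (auto simp: iso_def bij_betw_def)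
  with \<Theta>(2) that show thesis by blast
qed

lemma tau_consistent: "consistent_pc_presentation tpres"
  unfolding consistent_pc_presentation_def
proof (intro conjI ballI tau_pc_presentation)
  fix A assume A: "A \<in> carrier (pc_group tpres)"
  then obtain a where a: "a \<in> nf_exponents tpres" "A = pc_class tpres (pc_word (pc_gens tpres) a)"
    using tau_pc_presentation by (auto elim: pc_group_normal_form_exists)
  obtain \<Theta> where \<Theta>: "\<And>u. u \<in> words (set tgens) \<Longrightarrow> \<Theta> (tau_cls u) = tval u"
    using tau_iso by metis
  show "\<exists>!a. a \<in> nf_exponents tpres \<and> A = pc_class tpres (pc_word (pc_gens tpres) a)"
  proof (rule ex1I[of _ a])
    fix b assume b: "b \<in> nf_exponents tpres \<and> A = pc_class tpres (pc_word (pc_gens tpres) b)"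
    with a have "tau_cls (pc_word tgens a) = tau_cls (pc_word tgens b)"
      by (simp add: tau_class_def)
    then have "tval (pc_word tgens a) = tval (pc_word tgens b)"
      using \<Theta>[of "pc_word tgens a"] \<Theta>[of "pc_word tgens b"] by simp
    with a b show "b = a" using tval_nf_inj[of a b] by simp
  qed (use a in simp)
qed

end

theorem theorem6p2:
  fixes G :: "('a, 'b) monoid_scheme"
    and q :: nat
    and P :: "'x pc_presentation" and g :: "'x \<Rightarrow> 'a"
    and Q :: "'y pc_presentation" and w :: "'y \<Rightarrow> 'a qext_elem"
  assumes "group G"
    and "consistent_pc_presentation P" and "presents P G g"
    and "consistent_pc_presentation Q" and "presents Q (qext G q) w"
  shows "(tau_W G q P g Q w \<lhd> tau G q P g Q w \<and>
          (tau G q P g Q w Mod tau_W G q P g Q w) \<cong> (G \<times>\<times> G)) \<and>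
         consistent_pc_presentation (tau_pres G q P g Q w) \<and>
         ((tau G q P g Q w)\<lparr>carrier := tau_W G q P g Q w\<rparr>) \<cong> qext G q \<and>
         (\<exists>\<psi>\<in>hom (nuq G q) (tau G q P g Q w).
            (\<forall>x\<in>set (pc_gens P).
               \<psi> (nuq_class G q (gen (NG (g x)))) = tau_class G q P g Q w (gen (TG x)) \<and>
               \<psi> (nuq_class G q (gen (NP (g x)))) = tau_class G q P g Q w (gen (TP x))) \<and>
            (1 \<le> q \<longrightarrow> (\<forall>k\<in>carrier G.
               \<psi> (nuq_class G q (gen (NH k))) =
               tau_class G q P g Q w (tau_W_word G q Q w (lam G q \<one>\<^bsub>G\<^esub> \<one>\<^bsub>G\<^esub> k)))) \<and>
            kernel (nuq G q) (tau G q P g Q w) \<psi> = Delta G q)"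
proof -
  interpret q_squares G q using assms(1) by (simp add: q_squares_def)
  interpret tau_setup G q P g Q w
    using assms by (intro tau_setup.intro consistently_presented.intro
        consistently_presented_axioms.intro q_squares_axioms ext_group)
  let ?tau = "tau G q P g Q w" and ?W = "tau_W G q P g Q w"
  obtain \<Theta> where iso: "\<Theta> \<in> iso ?tau ext.E"
    and \<Theta>: "\<And>u. u \<in> words (set tgens) \<Longrightarrow> \<Theta> (tau_cls u) = tval u"
    by (rule tau_iso) (rule that)
  have hom: "\<Theta> \<in> hom ?tau ext.E" and inj: "inj_on \<Theta> (carrier ?tau)"
    and surj: "\<Theta> ` carrier ?tau = carrier ext.E"
    using iso by (auto simp: iso_def bij_betw_def)
  have gen_words: "gen s \<in> words (set tgens)" if "s \<in> set tgens" for s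
    using that by (simp only: words_gen)
  have \<Theta>_gen: "\<Theta> (tau_cls (gen s)) = tau_value s" "tau_cls (gen s) \<in> carrier ?tau" if "s \<in> set tgens" for s
    using \<Theta>[OF gen_words[OF that]] tv.eval_gen[of s] tau.cls_closed[of "gen s"] that
    by (simp_all only: tpres_simps words_gen)
  \<comment> \<open>the projection to \<open>G \<times> G\<close>; its kernel turns out to be \<open>W\<close>\<close>
  define \<rho> where "\<rho> = (\<lambda>A. (fst (\<Theta> A), fst (snd (\<Theta> A))))"
  have "(\<lambda>x. (fst x, fst (snd x))) \<in> hom ext.E (G \<times>\<times> G)"
    by (auto simp: hom_def DirProd_def ext.E_mult)
  from Group.hom_compose[OF hom this] have "\<rho> \<in> hom ?tau (G \<times>\<times> G)"
    by (simp add: \<rho>_def comp_def)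
  then interpret \<rho>: group_hom ?tau "G \<times>\<times> G" \<rho>
    by (simp add: group_hom_axioms.intro group_hom_def DirProd_group is_group tau.is_group)
  have \<rho>_surj: "\<rho> ` carrier ?tau = carrier (G \<times>\<times> G)"
  proof -
    have "(\<lambda>x. (fst x, fst (snd x))) ` carrier ext.E = carrier (G \<times>\<times> G)"
    proof (intro equalityI subsetI)
      fix z assume "z \<in> carrier (G \<times>\<times> G)"
      then have "(fst z, snd z, \<one>\<^bsub>ext\<^esub>) \<in> carrier ext.E" by (auto simp: DirProd_def)
      then show "z \<in> (\<lambda>x. (fst x, fst (snd x))) ` carrier ext.E"
        by (rule image_eqI[rotated]) simp
    next
      fix z assume "z \<in> (\<lambda>x. (fst x, fst (snd x))) ` carrier ext.E"
      then obtain x where "x \<in> carrier ext.E" "z = (fst x, fst (snd x))" by blast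
      then show "z \<in> carrier (G \<times>\<times> G)" by (cases x) (simp add: DirProd_def)
    qed
    then show ?thesis unfolding surj[symmetric] image_image \<rho>_def .
  qed
  have in_kernel: "A \<in> kernel ?tau (G \<times>\<times> G) \<rho> \<longleftrightarrow> A \<in> carrier ?tau \<and> (\<exists>m\<in>carrier ext. \<Theta> A = ext.inM m)" for A
    using hom_in_carrier[OF hom, of A] by (cases "\<Theta> A") (auto simp: kernel_def \<rho>_def DirProd_def)
  have W: "?W = kernel ?tau (G \<times>\<times> G) \<rho>"
  proof (intro equalityI subsetI)
    fix A assume "A \<in> ?W"
    moreover have "(\<lambda>y. tau_cls (gen (TW y))) ` set (pc_gens Q) \<subseteq> kernel ?tau (G \<times>\<times> G) \<rho>"
      using \<Theta>_gen[of "TW _"] by (auto simp: in_kernel)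
    ultimately show "A \<in> kernel ?tau (G \<times>\<times> G) \<rho>"
      using tau.generate_subgroup_incl[OF _ \<rho>.subgroup_kernel] unfolding tau_W_def by blast
  next
    fix A assume "A \<in> kernel ?tau (G \<times>\<times> G) \<rho>"
    then obtain m where A: "A \<in> carrier ?tau" "m \<in> carrier ext" "\<Theta> A = ext.inM m"
      by (auto simp: in_kernel)
    then obtain u where u: "u \<in> words (set (pc_gens Q))" "word_eval ext w u = m"
      using Q.eval_surj by blast
    have uw: "wrename TW u \<in> words (set tgens)" using u(1) by simp
    have "\<Theta> (tau_cls (wrename TW u)) = \<Theta> A" using \<Theta>[OF uw] u A by (simp add: tval_wrename)
    moreover have uc: "tau_cls (wrename TW u) \<in> carrier ?tau" using uw tau.cls_closed by simp
    ultimately have "A = tau_cls (wrename TW u)" using inj A(1) by (simp add: inj_on_eq_iff)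
    also have "\<dots> = word_eval ?tau (\<lambda>s. tau_cls (gen s)) (wrename TW u)"
      using uw tau.eval_cls[of "wrename TW u"] by simp
    also have "\<dots> \<in> ?W"
    proof (rule tau.word_eval_in_subgroup)
      have "(\<lambda>y. tau_cls (gen (TW y))) ` set (pc_gens Q) \<subseteq> carrier ?tau"
        using \<Theta>_gen(2)[of "TW _"] by auto
      then show "subgroup ?W ?tau" unfolding tau_W_def by (rule tau.generate_is_subgroup)
      show "wrename TW u \<in> words (TW ` set (pc_gens Q))" using u(1) by (rule words_wrename) simp
      show "tau_cls (gen s) \<in> ?W" if "s \<in> TW ` set (pc_gens Q)" for s
        using that unfolding tau_W_def by (auto intro: generate.incl)
    qed
    finally show "A \<in> ?W" .
  qed
  have normal: "?W \<lhd> ?tau" unfolding W by (rule \<rho>.normal_kernel)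
  have quotient: "(?tau Mod ?W) \<cong> (G \<times>\<times> G)"
    unfolding W by (rule \<rho>.FactGroup_iso[OF \<rho>_surj])
  have W_iso: "(?tau\<lparr>carrier := ?W\<rparr>) \<cong> qext G q"
  proof -
    have W_elem: "A \<in> carrier ?tau" "snd (snd (\<Theta> A)) \<in> carrier ext" "\<Theta> A = ext.inM (snd (snd (\<Theta> A)))"
      if "A \<in> ?W" for A
      using that unfolding W in_kernel by auto
    have "(\<lambda>A. snd (snd (\<Theta> A))) \<in> iso (?tau\<lparr>carrier := ?W\<rparr>) ext"
    proof (rule isoI)
      show "(\<lambda>A. snd (snd (\<Theta> A))) \<in> hom (?tau\<lparr>carrier := ?W\<rparr>) ext"
      proof (rule homI)
        fix A B assume "A \<in> carrier (?tau\<lparr>carrier := ?W\<rparr>)" "B \<in> carrier (?tau\<lparr>carrier := ?W\<rparr>)"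
        then have AB: "A \<in> ?W" "B \<in> ?W" by simp_all
        then obtain a b where ab: "a \<in> carrier ext" "\<Theta> A = ext.inM a" "b \<in> carrier ext" "\<Theta> B = ext.inM b"
          using W_elem(2,3) by metis
        have "\<Theta> (A \<otimes>\<^bsub>?tau\<^esub> B) = ext.inM a \<otimes>\<^bsub>ext.E\<^esub> ext.inM b"
          using hom_mult[OF hom W_elem(1)[OF AB(1)] W_elem(1)[OF AB(2)]] by (simp only: ab)
        also have "\<dots> = ext.inM (a \<otimes>\<^bsub>ext\<^esub> b)" using ab by (simp add: ext.E_mult)
        finally show "snd (snd (\<Theta> (A \<otimes>\<^bsub>?tau\<lparr>carrier := ?W\<rparr>\<^esub> B))) = snd (snd (\<Theta> A)) \<otimes>\<^bsub>ext\<^esub> snd (snd (\<Theta> B))"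
          by (simp add: ab)
      qed (use W_elem in simp)
      have "inj_on (\<lambda>A. snd (snd (\<Theta> A))) ?W"
      proof (rule inj_onI)
        fix A B assume AB: "A \<in> ?W" "B \<in> ?W" "snd (snd (\<Theta> A)) = snd (snd (\<Theta> B))"
        then have "\<Theta> A = \<Theta> B" using W_elem(3) by metis
        then show "A = B" using inj_onD[OF inj] W_elem(1) AB by blast
      qed
      moreover have "(\<lambda>A. snd (snd (\<Theta> A))) ` ?W = carrier ext"
      proof (intro equalityI subsetI)
        fix m assume m: "m \<in> carrier ext"
        then have "ext.inM m \<in> \<Theta> ` carrier ?tau" unfolding surj by simp
        then obtain A where A: "A \<in> carrier ?tau" "\<Theta> A = ext.inM m" by (metis imageE)
        then have "A \<in> ?W" unfolding W in_kernel using m by blast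
        with A show "m \<in> (\<lambda>A. snd (snd (\<Theta> A))) ` ?W" by (intro image_eqI[of _ _ A]) simp_all
      qed (use W_elem in auto)
      ultimately show "bij_betw (\<lambda>A. snd (snd (\<Theta> A))) (carrier (?tau\<lparr>carrier := ?W\<rparr>)) (carrier ext)"
        by (simp add: bij_betw_def)
    qed
    then show ?thesis by (rule is_isoI)
  qed
  obtain \<Psi> where \<Psi>: "\<Psi> \<in> hom (nuq G q) ext.E"
    and NG: "\<And>h. h \<in> carrier G \<Longrightarrow> \<Psi> (nG h) = ext.inL h"
    and NP: "\<And>h. h \<in> carrier G \<Longrightarrow> \<Psi> (nP h) = ext.inR h"
    and NH: "\<And>k. 1 \<le> q \<Longrightarrow> k \<in> carrier G \<Longrightarrow> \<Psi> (nH k) = ext.inM (proj (hatT k))"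
    and ker: "kernel (nuq G q) ext.E \<Psi> = Delta G q"
    by (rule nu_to_extension) (rule that)
  \<comment> \<open>the map from \<open>\<nu>\<^sup>q(G)\<close> to the extension, followed by the inverse of the isomorphism with \<open>\<tau>\<^sup>q(G)\<close>\<close>
  define \<theta> where "\<theta> = inv_into (carrier ?tau) \<Theta>"
  have \<theta>_iso: "\<theta> \<in> iso ext.E ?tau"
    unfolding \<theta>_def by (rule tau.iso_set_sym[OF iso])
  have \<theta>\<Theta>: "\<theta> (\<Theta> A) = A" if "A \<in> carrier ?tau" for A
    unfolding \<theta>_def using inj that by (rule inv_into_f_f)
  have \<theta>_hom: "\<theta> \<in> hom ext.E ?tau" and \<theta>_inj: "inj_on \<theta> (carrier ext.E)"
    using \<theta>_iso by (auto simp: iso_def bij_betw_def)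
  have "\<theta> \<circ> \<Psi> \<in> hom (nuq G q) ?tau" by (rule Group.hom_compose[OF \<Psi> \<theta>_hom])
  moreover have "(\<theta> \<circ> \<Psi>) (nG (g x)) = tau_cls (gen (TG x))" "(\<theta> \<circ> \<Psi>) (nP (g x)) = tau_cls (gen (TP x))"
    if "x \<in> set (pc_gens P)" for x
    using that \<theta>\<Theta>[OF \<Theta>_gen(2), of "TG x"] \<theta>\<Theta>[OF \<Theta>_gen(2), of "TP x"]
      \<Theta>_gen(1)[of "TG x"] \<Theta>_gen(1)[of "TP x"]
    by (simp_all add: NG NP)
  moreover have "(\<theta> \<circ> \<Psi>) (nH k) = tau_cls (Wword (lam G q \<one>\<^bsub>G\<^esub> \<one>\<^bsub>G\<^esub> k))"
    if "1 \<le> q" "k \<in> carrier G" for k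
  proof -
    have "\<Theta> (tau_cls (Wword (hat G q k))) = ext.inM (hat G q k)"
      using \<Theta>[of "Wword (hat G q k)"] that by (simp add: tval_Wword)
    moreover have "tau_cls (Wword (hat G q k)) \<in> carrier ?tau"
      using tau.cls_closed by simp
    ultimately show ?thesis
      using \<theta>\<Theta>[of "tau_cls (Wword (hat G q k))"] that by (simp add: NH hat_eq lam_hat)
  qed
  moreover have "kernel (nuq G q) ?tau (\<theta> \<circ> \<Psi>) = Delta G q"
    unfolding ker[symmetric]
    by (rule kernel_compose_inj[OF ext.E.is_group tau.is_group \<theta>_inj \<theta>_hom \<Psi>])
  ultimately have map: "\<exists>\<psi>\<in>hom (nuq G q) ?tau.
            (\<forall>x\<in>set (pc_gens P). \<psi> (nG (g x)) = tau_cls (gen (TG x)) \<and> \<psi> (nP (g x)) = tau_cls (gen (TP x))) \<and>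
            (1 \<le> q \<longrightarrow> (\<forall>k\<in>carrier G. \<psi> (nH k) = tau_cls (Wword (lam G q \<one>\<^bsub>G\<^esub> \<one>\<^bsub>G\<^esub> k)))) \<and>
            kernel (nuq G q) ?tau \<psi> = Delta G q"
    by (intro bexI[of _ "\<theta> \<circ> \<Psi>"]) simp_all
  show ?thesis by (intro conjI normal quotient tau_consistent W_iso map)
qed

end
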